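(* Let $\mathbb{K}$ be an arbitrary field and let $I\subset R=\mathbb{K}[x_1,x_2]$ be a height two ideal minimally generated by three homogeneous polynomials of the same degree $d$. Let $\mathfrak{m}=(x_1,x_2)\subset R$, let $g_1,g_2$ be the equations of the symmetric algebra of $I$, and let $\mathcal{K}$ be the kernel of the canonical map $\mathrm{Sym}(I)\to\mathrm{Rees}(I)$. Then there is an isomorphism of bigraded $S$-modules $$\mathcal{K}\cong\Big\{w\in \mathrm{H}^2_{\mathfrak{m}}(S)(-2,-d)\ \Big|\ g_1\cdot w=0\text{ and }g_2\cdot w=0\Big\}.$$
   Context: Write $I=(f_1,f_2,f_3)$ with $f_i$ homogeneous of degree $d$. By Hilbert–Burch $I$ has a graded free resolution $0\to R(-d-\mu)\oplus R(-2d+\mu)\xrightarrow{\varphi}R(-d)^3\xrightarrow{[f_1,f_2,f_3]}I\to 0$, where the first column of $\varphi$ has homogeneous entries of degree $\mu$ and the second of degree $d-\mu$ (one may order the columns so that $0<\mu\le d-\mu$). Let $S=R[T_1,T_2,T_3]$, bigraded by $\mathrm{bideg}(T_i)=(1,0)$, $\mathrm{bideg}(x_i)=(0,1)$. Put $[g_1,g_2]=[T_1,T_2,T_3]\cdot\varphi$, so $\mathrm{Sym}(I)\cong S/(g_1,g_2)$ with $\mathrm{bideg}(g_1)=(1,\mu)$, $\mathrm{bideg}(g_2)=(1,d-\mu)$. $\mathrm{Rees}(I)=\bigoplus_{i\ge0}I^it^i$ is the quotient of $S$ via $T_i\mapsto f_it$ (with $\mathrm{bideg}(t)=(1,-d)$),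 so $\mathcal{K}$ is a bigraded $S$-module. For a bigraded $S$-module $M=\bigoplus_pM_p$, with $M_p=\bigoplus_qM_{p,q}$ a graded $R$-module, the local cohomology $\mathrm{H}^j_{\mathfrak{m}}(M)=\bigoplus_p\mathrm{H}^j_{\mathfrak{m}}(M_p)$ is a bigraded $S$-module with $\mathrm{H}^j_{\mathfrak{m}}(M)_{p,q}=\mathrm{H}^j_{\mathfrak{m}}(M_p)_q$, where $T_i$ acts by the maps induced by multiplication $T_i:M_p\to M_{p+1}$. For a bigraded module $N$, $N(a,b)_{p,q}=N_{p+a,q+b}$. *)

theory Defs
  imports
    "HOL-Analysis.Finite_Cartesian_Product"
    "HOL-Library.Poly_Mapping"
    "HOL-Library.Extended_Nat"
    "HOL-Computational_Algebra.Polynomial"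
    "HOL-Algebra.Algebraic_Closure_Type"
    "HOL-Algebra.Ideal_Product"
    "HOL-Algebra.QuotRing"
    "HOL-Algebra.Module"
begin

text \<open>
  \<open>('v \<Rightarrow>\<^sub>0 nat) \<Rightarrow>\<^sub>0 'r\<close> with its convolution product is the polynomial ring over \<open>'r\<close> in
  the variables \<open>'v\<close>.
\<close>

definition pconst :: "'r::comm_ring_1 \<Rightarrow> ('v \<Rightarrow>\<^sub>0 nat) \<Rightarrow>\<^sub>0 'r" where
  "pconst c = Poly_Mapping.single 0 c"

definition pvar :: "'v \<Rightarrow> ('v \<Rightarrow>\<^sub>0 nat) \<Rightarrow>\<^sub>0 'r::comm_ring_1" where
  "pvar v = Poly_Mapping.single (Poly_Mapping.single v 1) 1"

text \<open>
  Substitution: for a ring homomorphism \<open>h\<close>, \<open>psubst h y\<close> is the homomorphism extending \<open>h\<close>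
  that sends the variable \<open>v\<close> to \<open>y v\<close>.
\<close>

definition psubst ::
    "('r::comm_ring_1 \<Rightarrow> 'a::comm_ring_1) \<Rightarrow> ('v \<Rightarrow> 'a) \<Rightarrow> (('v \<Rightarrow>\<^sub>0 nat) \<Rightarrow>\<^sub>0 'r) \<Rightarrow> 'a" where
  "psubst h y p =
     (\<Sum>m\<in>Poly_Mapping.keys p. h (Poly_Mapping.lookup p m) *
        (\<Prod>v\<in>Poly_Mapping.keys m. y v ^ Poly_Mapping.lookup m v))"

definition mon_degree :: "('v::finite \<Rightarrow>\<^sub>0 nat) \<Rightarrow> nat" where
  "mon_degree m = (\<Sum>v\<in>UNIV. Poly_Mapping.lookup m v)"

text \<open>\<open>R = K[x\<^sub>1, x\<^sub>2]\<close> and \<open>S = R[T\<^sub>1, T\<^sub>2, T\<^sub>3]\<close>.\<close>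

type_synonym 'k rpoly = "(2 \<Rightarrow>\<^sub>0 nat) \<Rightarrow>\<^sub>0 'k"
type_synonym 'k spoly = "(3 \<Rightarrow>\<^sub>0 nat) \<Rightarrow>\<^sub>0 'k rpoly"

text \<open>As usual, \<open>0\<close> counts as homogeneous of every degree.\<close>

definition homogeneous :: "nat \<Rightarrow> 'k::field rpoly \<Rightarrow> bool" where
  "homogeneous e r \<longleftrightarrow> (\<forall>m\<in>Poly_Mapping.keys r. mon_degree m = e)"

definition S_piece :: "int \<Rightarrow> int \<Rightarrow> 'k::field spoly set" where
  "S_piece p q =
     {s. \<forall>m\<in>Poly_Mapping.keys s. int (mon_degree m) = p \<and>
           (\<forall>n\<in>Poly_Mapping.keys (Poly_Mapping.lookup s m). int (mon_degree n) = q)}"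

text \<open>
  The record type of modules in \<^theory>\<open>HOL-Algebra.Module\<close> extends the record of rings; its
  fields \<open>mult\<close> and \<open>one\<close> carry no meaning for a module.
\<close>

record ('s, 'm) bigraded = "('s, 'm) module" +
  piece :: "int \<Rightarrow> int \<Rightarrow> 'm set"

definition bigraded_module :: "('k::field spoly, 'm) bigraded \<Rightarrow> bool" where
  "bigraded_module M \<longleftrightarrow>
     Module.module ring_of_type_algebra M \<and>
     (\<forall>p q. subgroup (piece M p q) (add_monoid M)) \<and>
     (\<forall>a b p q. \<forall>s\<in>S_piece a b. \<forall>m\<in>piece M p q. s \<odot>\<^bsub>M\<^esub> m \<in> piece M (p + a) (q + b)) \<and>
     (\<forall>m\<in>carrier M. \<exists>!c :: int \<times> int \<Rightarrow> 'm.
        (\<forall>p q. c (p, q) \<in> piece M p q) \<and> finite {pq. c pq \<noteq> \<zero>\<^bsub>M\<^esub>} \<and>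
        m = finsum M c {pq. c pq \<noteq> \<zero>\<^bsub>M\<^esub>})"

definition bigraded_iso ::
    "('k::field spoly, 'm) bigraded \<Rightarrow> ('k spoly, 'n) bigraded \<Rightarrow> bool" where
  "bigraded_iso M N \<longleftrightarrow>
     bigraded_module M \<and> bigraded_module N \<and>
     (\<exists>h. bij_betw h (carrier M) (carrier N) \<and>
          (\<forall>a\<in>carrier M. \<forall>b\<in>carrier M. h (a \<oplus>\<^bsub>M\<^esub> b) = h a \<oplus>\<^bsub>N\<^esub> h b) \<and>
          (\<forall>s. \<forall>a\<in>carrier M. h (s \<odot>\<^bsub>M\<^esub> a) = s \<odot>\<^bsub>N\<^esub> h a) \<and>
          (\<forall>p q. h ` piece M p q = piece N p q))"

definition S_module :: "('k::field spoly, 'k spoly) bigraded" where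
  "S_module =
     \<lparr>carrier = UNIV, monoid.mult = (*), one = 1, ring.zero = 0, add = (+),
      module.smult = (*), piece = S_piece\<rparr>"

definition twist :: "('s, 'm) bigraded \<Rightarrow> int \<Rightarrow> int \<Rightarrow> ('s, 'm) bigraded" where
  "twist M a b = M\<lparr>piece := \<lambda>p q. piece M (p + a) (q + b)\<rparr>"

definition submod :: "('s, 'm) bigraded \<Rightarrow> 'm set \<Rightarrow> ('s, 'm) bigraded" where
  "submod M N = M\<lparr>carrier := N, piece := \<lambda>p q. piece M p q \<inter> N\<rparr>"

definition quotmod :: "('s, 'm) bigraded \<Rightarrow> 'm set \<Rightarrow> ('s, 'm set) bigraded" where
  "quotmod M N =
     \<lparr>carrier = a_rcosets\<^bsub>M\<^esub> N, monoid.mult = undefined, one = undefined,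
      ring.zero = N, add = set_add M,
      module.smult = (\<lambda>s A. \<Union>a\<in>A. N +>\<^bsub>M\<^esub> (s \<odot>\<^bsub>M\<^esub> a)),
      piece = (\<lambda>p q. {N +>\<^bsub>M\<^esub> a |a. a \<in> piece M p q})\<rparr>"

text \<open>
  \<open>frac M s m i\<close> is the fraction \<open>m / s\<^sup>i\<close>; \<open>localization M s e\<close> is \<open>M\<^sub>s\<close> for \<open>s\<close> of
  bidegree \<open>(0, e)\<close>, so that \<open>m / s\<^sup>i\<close> has bidegree \<open>bideg m - (0, i * e)\<close>.
\<close>

definition frac_rel ::
    "('s::comm_ring_1, 'm) bigraded \<Rightarrow> 's \<Rightarrow> (('m \<times> nat) \<times> ('m \<times> nat)) set" where
  "frac_rel M s =
     {((m, i), (n, j)). m \<in> carrier M \<and> n \<in> carrier M \<and>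
        (\<exists>k. s ^ (k + j) \<odot>\<^bsub>M\<^esub> m = s ^ (k + i) \<odot>\<^bsub>M\<^esub> n)}"

definition frac ::
    "('s::comm_ring_1, 'm) bigraded \<Rightarrow> 's \<Rightarrow> 'm \<Rightarrow> nat \<Rightarrow> ('m \<times> nat) set" where
  "frac M s m i = frac_rel M s `` {(m, i)}"

definition localization ::
    "('s::comm_ring_1, 'm) bigraded \<Rightarrow> 's \<Rightarrow> nat \<Rightarrow> ('s, ('m \<times> nat) set) bigraded" where
  "localization M s e =
     \<lparr>carrier = (carrier M \<times> UNIV) // frac_rel M s,
      monoid.mult = undefined, one = undefined,
      ring.zero = frac M s \<zero>\<^bsub>M\<^esub> 0,
      add = (\<lambda>A B. \<Union>(m, i)\<in>A. \<Union>(n, j)\<in>B.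
               frac M s ((s ^ j \<odot>\<^bsub>M\<^esub> m) \<oplus>\<^bsub>M\<^esub> (s ^ i \<odot>\<^bsub>M\<^esub> n)) (i + j)),
      module.smult = (\<lambda>r A. \<Union>(m, i)\<in>A. frac M s (r \<odot>\<^bsub>M\<^esub> m) i),
      piece = (\<lambda>p q. {frac M s m i |m i. m \<in> piece M p (q + int i * int e)})\<rparr>"

text \<open>The canonical map \<open>M\<^sub>s \<rightarrow> M\<^sub>s\<^sub>t\<close>, \<open>m / s\<^sup>i \<mapsto> t\<^sup>i m / (s t)\<^sup>i\<close>.\<close>

definition loc_map ::
    "('s::comm_ring_1, 'm) bigraded \<Rightarrow> 's \<Rightarrow> 's \<Rightarrow> ('m \<times> nat) set \<Rightarrow> ('m \<times> nat) set" where
  "loc_map M s t A = (\<Union>(m, i)\<in>A. frac M (s * t) (t ^ i \<odot>\<^bsub>M\<^esub> m) i)"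

definition xvar :: "2 \<Rightarrow> 'k::field spoly" where
  "xvar v = pconst (pvar v)"

definition xprod :: "2 set \<Rightarrow> 'k::field spoly" where
  "xprod \<sigma> = (\<Prod>v\<in>\<sigma>. xvar v)"

abbreviation loc_at ::
    "('k::field spoly, 'm) bigraded \<Rightarrow> 2 set \<Rightarrow> ('k spoly, ('m \<times> nat) set) bigraded" where
  "loc_at M \<sigma> \<equiv> localization M (xprod \<sigma>) (card \<sigma>)"

text \<open>
  Local cohomology with support in \<open>(x\<^sub>1, x\<^sub>2)\<close> is the cohomology of the Cech complex
  \<open>C\<^sup>j(M) = \<Prod>\<^bsub>|\<sigma>| = j\<^esub> M\<^bsub>x\<^sub>\<sigma>\<^esub>\<close> on \<open>x\<^sub>1, x\<^sub>2\<close>, that is of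
  \<open>0 \<rightarrow> M \<rightarrow> M\<^bsub>x\<^sub>1\<^esub> \<times> M\<^bsub>x\<^sub>2\<^esub> \<rightarrow> M\<^bsub>x\<^sub>1 x\<^sub>2\<^esub> \<rightarrow> 0\<close>.  The \<open>x\<^sub>i\<close> have
  bidegree \<open>(0, 1)\<close>, so localising commutes with the decomposition \<open>M = \<Oplus>\<^sub>p M\<^sub>p\<close>:
  the piece \<open>(p, q)\<close> below is the degree \<open>q\<close> part of the local cohomology of the graded
  \<open>R\<close>-module \<open>M\<^sub>p\<close>, and the \<open>T\<^sub>i\<close> act by functoriality.
\<close>

definition cech ::
    "('k::field spoly, 'm) bigraded \<Rightarrow> nat \<Rightarrow>
     ('k spoly, 2 set \<Rightarrow> ('m \<times> nat) set) bigraded" where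
  "cech M j =
     \<lparr>carrier = (\<Pi>\<^sub>E \<sigma>\<in>{\<sigma>. card \<sigma> = j}. carrier (loc_at M \<sigma>)),
      monoid.mult = undefined, one = undefined,
      ring.zero = (\<lambda>\<sigma>\<in>{\<sigma>. card \<sigma> = j}. \<zero>\<^bsub>loc_at M \<sigma>\<^esub>),
      add = (\<lambda>c c'. \<lambda>\<sigma>\<in>{\<sigma>. card \<sigma> = j}. c \<sigma> \<oplus>\<^bsub>loc_at M \<sigma>\<^esub> c' \<sigma>),
      module.smult = (\<lambda>s c. \<lambda>\<sigma>\<in>{\<sigma>. card \<sigma> = j}. s \<odot>\<^bsub>loc_at M \<sigma>\<^esub> c \<sigma>),
      piece = (\<lambda>p q. \<Pi>\<^sub>E \<sigma>\<in>{\<sigma>. card \<sigma> = j}. piece (loc_at M \<sigma>) p q)\<rparr>"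

definition cech_diff ::
    "('k::field spoly, 'm) bigraded \<Rightarrow> nat \<Rightarrow>
     (2 set \<Rightarrow> ('m \<times> nat) set) \<Rightarrow> (2 set \<Rightarrow> ('m \<times> nat) set)" where
  "cech_diff M j c =
     (\<lambda>\<tau>\<in>{\<tau>. card \<tau> = Suc j}.
        finsum (loc_at M \<tau>)
          (\<lambda>v. (-1) ^ card {u \<in> \<tau>. u < v} \<odot>\<^bsub>loc_at M \<tau>\<^esub>
                 loc_map M (xprod (\<tau> - {v})) (xvar v) (c (\<tau> - {v}))) \<tau>)"

definition cocycles ::
    "('k::field spoly, 'm) bigraded \<Rightarrow> nat \<Rightarrow> (2 set \<Rightarrow> ('m \<times> nat) set) set" where
  "cocycles M j = a_kernel (cech M j) (cech M (Suc j)) (cech_diff M j)"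

definition coboundaries ::
    "('k::field spoly, 'm) bigraded \<Rightarrow> nat \<Rightarrow> (2 set \<Rightarrow> ('m \<times> nat) set) set" where
  "coboundaries M j =
     (case j of 0 \<Rightarrow> {\<zero>\<^bsub>cech M 0\<^esub>} | Suc i \<Rightarrow> cech_diff M i ` carrier (cech M i))"

definition local_cohomology ::
    "nat \<Rightarrow> ('k::field spoly, 'm) bigraded \<Rightarrow>
     ('k spoly, (2 set \<Rightarrow> ('m \<times> nat) set) set) bigraded" where
  "local_cohomology j M = quotmod (submod (cech M j) (cocycles M j)) (coboundaries M j)"

text \<open>
  The symmetric algebra of a module \<open>M\<close> over \<open>'r\<close>: the polynomial ring with one variable for each
  element of \<open>M\<close>, modulo the relations making \<open>a \<mapsto> pvar a\<close> linear.
\<close>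

definition sym_free :: "('r::comm_ring_1, 'm) module \<Rightarrow> (('m \<Rightarrow>\<^sub>0 nat) \<Rightarrow>\<^sub>0 'r) ring" where
  "sym_free M =
     ring_of_type_algebra
       \<lparr>carrier := {p. \<forall>m\<in>Poly_Mapping.keys p. Poly_Mapping.keys m \<subseteq> carrier M}\<rparr>"

definition sym_rel :: "('r::comm_ring_1, 'm) module \<Rightarrow> (('m \<Rightarrow>\<^sub>0 nat) \<Rightarrow>\<^sub>0 'r) set" where
  "sym_rel M =
     Idl\<^bsub>sym_free M\<^esub>
       ({pvar (a \<oplus>\<^bsub>M\<^esub> b) - pvar a - pvar b |a b. a \<in> carrier M \<and> b \<in> carrier M} \<union>
        {pvar (r \<odot>\<^bsub>M\<^esub> a) - pconst r * pvar a |r a. a \<in> carrier M})"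

definition sym_alg :: "('r::comm_ring_1, 'm) module \<Rightarrow> (('m \<Rightarrow>\<^sub>0 nat) \<Rightarrow>\<^sub>0 'r) set ring" where
  "sym_alg M = sym_free M Quot sym_rel M"

definition ideal_as_module :: "'r::comm_ring_1 set \<Rightarrow> ('r, 'r) module" where
  "ideal_as_module I =
     \<lparr>carrier = I, monoid.mult = (*), one = 1, ring.zero = 0, add = (+), module.smult = (*)\<rparr>"

definition rees_alg :: "'r::comm_ring_1 set \<Rightarrow> 'r poly ring" where
  "rees_alg I =
     ring_of_type_algebra
       \<lparr>carrier := {P. \<forall>i. Polynomial.coeff P i \<in> I [^]\<^bsub>ideals_set ring_of_type_algebra\<^esub> i}\<rparr>"

text \<open>
  The canonical map sends the class of \<open>pvar a\<close>, for \<open>a \<in> I\<close>, to \<open>a t\<close>.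
\<close>

definition sym_to_rees :: "(('r::comm_ring_1 \<Rightarrow>\<^sub>0 nat) \<Rightarrow>\<^sub>0 'r) set \<Rightarrow> 'r poly" where
  "sym_to_rees A = the_elem (psubst (\<lambda>r. [:r:]) (\<lambda>a. Polynomial.monom a 1) ` A)"

text \<open>
  The \<open>S\<close>-algebra structure \<open>S \<rightarrow> Sym(I)\<close>, \<open>T\<^sub>i \<mapsto> f\<^sub>i\<close>, which is onto when the \<open>f\<^sub>i\<close>
  generate \<open>I\<close>; the bigrading of \<open>Sym(I)\<close> is the one induced from \<open>S\<close>.
\<close>

definition S_to_sym ::
    "'k::field rpoly set \<Rightarrow> 'k rpoly ^ 3 \<Rightarrow> 'k spoly \<Rightarrow>
     (('k rpoly \<Rightarrow>\<^sub>0 nat) \<Rightarrow>\<^sub>0 'k rpoly) set" where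
  "S_to_sym I f s =
     sym_rel (ideal_as_module I) +>\<^bsub>sym_free (ideal_as_module I)\<^esub>
       psubst pconst (\<lambda>i. pvar (f $ i)) s"

definition sym_module ::
    "'k::field rpoly set \<Rightarrow> 'k rpoly ^ 3 \<Rightarrow>
     ('k spoly, (('k rpoly \<Rightarrow>\<^sub>0 nat) \<Rightarrow>\<^sub>0 'k rpoly) set) bigraded" where
  "sym_module I f = (let A = sym_alg (ideal_as_module I) in
     \<lparr>carrier = carrier A, monoid.mult = monoid.mult A, one = one A, ring.zero = ring.zero A,
      add = add A, module.smult = (\<lambda>s w. S_to_sym I f s \<otimes>\<^bsub>A\<^esub> w),
      piece = (\<lambda>p q. S_to_sym I f ` S_piece p q)\<rparr>)"

definition rees_kernel ::
    "'k::field rpoly set \<Rightarrow> 'k rpoly ^ 3 \<Rightarrow>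
     ('k spoly, (('k rpoly \<Rightarrow>\<^sub>0 nat) \<Rightarrow>\<^sub>0 'k rpoly) set) bigraded" where
  "rees_kernel I f =
     submod (sym_module I f) (a_kernel (sym_alg (ideal_as_module I)) (rees_alg I) sym_to_rees)"

definition prime_height :: "('a, 'b) ring_scheme \<Rightarrow> 'a set \<Rightarrow> enat" where
  "prime_height A P =
     Sup {enat n |n. \<exists>c :: nat \<Rightarrow> 'a set.
            (\<forall>i\<le>n. primeideal (c i) A) \<and> (\<forall>i<n. c i \<subset> c (Suc i)) \<and> c n = P}"

definition ideal_height :: "('a, 'b) ring_scheme \<Rightarrow> 'a set \<Rightarrow> enat" where
  "ideal_height A I = Inf {prime_height A P |P. primeideal P A \<and> I \<subseteq> P}"

definition minimally_generated_by :: "'r::comm_ring_1 set \<Rightarrow> 'r ^ 'n \<Rightarrow> bool" where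
  "minimally_generated_by I f \<longleftrightarrow>
     I = Idl\<^bsub>ring_of_type_algebra\<^esub> (range (($) f)) \<and>
     (\<forall>A. A \<subset> UNIV \<longrightarrow> Idl\<^bsub>ring_of_type_algebra\<^esub> (($) f ` A) \<noteq> I)"

text \<open>
  \<open>0 \<rightarrow> R(-d-\<mu>) \<oplus> R(-2d+\<mu>) \<rightarrow> R(-d)\<^sup>3 \<rightarrow> I \<rightarrow> 0\<close> with the maps \<open>\<phi>\<close> and \<open>[f\<^sub>1, f\<^sub>2, f\<^sub>3]\<close> is
  exact; exactness at \<open>I\<close> means that the \<open>f\<^sub>i\<close> generate \<open>I\<close>.
\<close>

definition hilbert_burch ::
    "'k::field rpoly set \<Rightarrow> nat \<Rightarrow> nat \<Rightarrow> 'k rpoly ^ 3 \<Rightarrow> 'k rpoly ^ 2 ^ 3 \<Rightarrow> bool" where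
  "hilbert_burch I d \<mu> f \<phi> \<longleftrightarrow>
     0 < \<mu> \<and> \<mu> \<le> d - \<mu> \<and>
     (\<forall>i. homogeneous \<mu> (\<phi> $ i $ 1) \<and> homogeneous (d - \<mu>) (\<phi> $ i $ 2)) \<and>
     inj ((*v) \<phi>) \<and>
     range ((*v) \<phi>) = {c. (\<Sum>i\<in>UNIV. f $ i * c $ i) = 0} \<and>
     range (\<lambda>c :: 'k rpoly ^ 3. \<Sum>i\<in>UNIV. f $ i * c $ i) = I"

definition sym_equations :: "'k::field rpoly ^ 2 ^ 3 \<Rightarrow> 'k spoly ^ 2" where
  "sym_equations \<phi> = (\<chi> i. pvar i) v* map_matrix pconst \<phi>"

end

theory Submission
  imports Defs "HOL-Analysis.Cartesian_Space" "HOL-Computational_Algebra.Polynomial_Factorial"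
begin

text \<open>
  The isomorphism is the connecting homomorphism of the Koszul complex of \<open>g\<^sub>1, g\<^sub>2\<close>, made explicit
  with denominators.  Put \<open>G = (g\<^sub>1, g\<^sub>2)\<close> and \<open>J\<^sub>n = (x\<^sub>1\<^sup>n, x\<^sub>2\<^sup>n)\<close> in \<open>S\<close>.  Three facts carry
  the proof:

  \<^item> \<open>Sym(I) = S/G\<close>, compatibly with \<open>T\<^sub>i \<mapsto> f\<^sub>i\<close> (\<open>kappa_eq_iff\<close>);
  \<^item> the kernel of \<open>Sym(I) \<rightarrow> Rees(I)\<close> consists of the classes of those \<open>F\<close> for which \<open>x\<^sub>1\<^sup>n F\<close> and
    \<open>x\<^sub>2\<^sup>n F\<close> lie in \<open>G\<close> for some \<open>n\<close> (\<open>torsion_eq\<close>);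
  \<^item> \<open>a g\<^sub>1 + b g\<^sub>2 = 0\<close> implies \<open>(a, b) = c (g\<^sub>2, -g\<^sub>1)\<close>, that is, \<open>g\<^sub>1, g\<^sub>2\<close> is a regular sequence
    (the assumption \<open>koszul\<close> of the locale \<open>koszul_cech\<close>).

  The last two hold because everything becomes trivial after inverting an element \<open>h\<close> of \<open>I\<close>.  If
  \<open>h = \<Sum> c\<^sub>i f\<^sub>i\<close> and \<open>L = \<Sum> c\<^sub>i T\<^sub>i\<close>, then \<open>h T\<^sub>j = f\<^sub>j L + \<alpha>\<^sub>j g\<^sub>1 + \<beta>\<^sub>j g\<^sub>2\<close>, because the coefficient
  vector of \<open>h T\<^sub>j - f\<^sub>j L\<close> is a syzygy of \<open>f\<close>.  So, up to \<open>h\<close>, the forms \<open>L, g\<^sub>1, g\<^sub>2\<close> are new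
  coordinates (\<open>coordinate_change\<close>), and in them \<open>g\<^sub>1, g\<^sub>2\<close> are variables and \<open>Rees(I)\<close> is a
  polynomial ring in \<open>L\<close>.  Since \<open>I\<close> has height two, a power of either \<open>x\<^sub>v\<close> can be taken for \<open>h\<close>
  (\<open>pvar_power_in_ideal\<close>): otherwise all \<open>f\<^sub>i\<close> would vanish at a common point of the projective line,
  whose homogeneous prime ideal has height one.

  Now let \<open>x\<^sub>1\<^sup>n F = a g\<^sub>1 + b g\<^sub>2\<close> and \<open>x\<^sub>2\<^sup>n F = a' g\<^sub>1 + b' g\<^sub>2\<close>.  Comparing the two expressions of
  \<open>(x\<^sub>1 x\<^sub>2)\<^sup>n F\<close> gives a unique \<open>w\<close> with \<open>x\<^sub>2\<^sup>n a - x\<^sub>1\<^sup>n a' = w g\<^sub>2\<close> and \<open>x\<^sub>2\<^sup>n b - x\<^sub>1\<^sup>n b' = -w g\<^sub>1\<close>.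
  These equations say that \<open>g\<^sub>1\<close> and \<open>g\<^sub>2\<close> kill the class of \<open>w / (x\<^sub>1 x\<^sub>2)\<^sup>n\<close> in the second local
  cohomology \<open>S\<^bsub>x\<^sub>1x\<^sub>2\<^esub> / (S\<^bsub>x\<^sub>1\<^esub> + S\<^bsub>x\<^sub>2\<^esub>)\<close> of \<open>S\<close>, a class that is zero iff \<open>w\<close> is in \<open>J\<^sub>n\<close>.  The
  four equations form the relation \<open>linked n F w\<close>.  It is linear, compatible with raising \<open>n\<close>, can be
  solved for \<open>w\<close> given \<open>F\<close> and for \<open>F\<close> given \<open>w\<close>, and relates \<open>G\<close> exactly to \<open>J\<^sub>n\<close>, so it induces
  an isomorphism.  Its equations are bihomogeneous: if \<open>F\<close> has bidegree \<open>(p, q)\<close>, then \<open>w\<close> can be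
  taken of bidegree \<open>(p - 2, q + 2n - d)\<close>, which is the twist by \<open>(-2, -d)\<close>.

  That both sides are bigraded \<open>S\<close>-modules follows from one general argument, because both are
  increasing unions of images of graded submodules of \<open>S\<close> (\<open>graded_presented_module\<close>).
\<close>

section \<open>Polynomials and substitution\<close>

abbreviation "lookup \<equiv> Poly_Mapping.lookup"
abbreviation "keys \<equiv> Poly_Mapping.keys"
abbreviation "single \<equiv> Poly_Mapping.single"

locale ring_map =
  fixes h :: "'a::comm_ring_1 \<Rightarrow> 'b::comm_ring_1"
  assumes add: "h (x + y) = h x + h y"
    and mult: "h (x * y) = h x * h y"
    and one: "h 1 = 1"
begin

lemma zero [simp]: "h 0 = 0"
  using add[of 0 0] by simp

lemma diff: "h (x - y) = h x - h y"
  using add[of "x - y" y] by (simp add: algebra_simps)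

lemma uminus: "h (- x) = - h x"
  using diff[of 0 x] by simp

lemma sum: "h (sum u A) = (\<Sum>a\<in>A. h (u a))"
  by (induction A rule: infinite_finite_induct) (auto simp: add)

lemma power: "h (x ^ n) = h x ^ n"
  by (induction n) (auto simp: mult one)

end

lemma poly_mapping_eq_sum_single:
  "p = (\<Sum>m\<in>keys p. single m (lookup p m))"
  by (rule poly_mapping_eqI)
     (auto simp: lookup_sum lookup_single when_def not_in_keys_iff_lookup_eq_zero)

text \<open>
  The predicate \<open>Q\<close> restricts the monomials and coefficients that occur, so that the rule also proves
  statements about polynomials in a subset of the variables or of a fixed degree.
\<close>

lemma poly_mapping_restricted_induct [consumes 1, case_names zero single add]:
  assumes "\<forall>m\<in>keys p. Q m (lookup p m)"
    and "P 0" "\<And>m c. Q m c \<Longrightarrow> P (single m c)"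
    and "\<And>p q. P p \<Longrightarrow> P q \<Longrightarrow> P (p + q)"
  shows "P (p :: 'a \<Rightarrow>\<^sub>0 'b::comm_monoid_add)"
proof -
  have "P (\<Sum>m\<in>A. single m (lookup p m))"
    if "finite A" "A \<subseteq> keys p" for A
    using that by (induction A) (use assms in auto)
  from this[of "keys p"] show ?thesis
    using poly_mapping_eq_sum_single[of p] by simp
qed

lemmas poly_mapping_sum_induct =
  poly_mapping_restricted_induct[where Q = "\<lambda>_ _. True", simplified, case_names zero single add]

lemma pconst_mult_single: "pconst c * single m a = single m (c * a)"
  by (simp add: pconst_def mult_single)

lemma pconst_ring_map: "ring_map pconst"
  by unfold_locales (auto simp: pconst_def single_add mult_single)

interpretation pconst: ring_map pconst
  by (rule pconst_ring_map)

lemma lookup_pconst_mult: "lookup (pconst c * p) m = c * lookup p m"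
proof (induction p rule: poly_mapping_sum_induct)
  case zero
  then show ?case by simp
next
  case (single k c)
  then show ?case by (auto simp: pconst_mult_single lookup_single when_def)
next
  case (add p q)
  then show ?case by (simp add: lookup_add algebra_simps)
qed

lemma pconst_inject [simp]: "pconst a = pconst b \<longleftrightarrow> a = b"
  by (metis pconst_def lookup_single_eq)

lemma pconst_eq_0 [simp]: "pconst a = 0 \<longleftrightarrow> a = 0"
  using pconst_inject[of a 0] by (simp del: pconst_inject)

text \<open>
  The inner product of \<^const>\<open>psubst\<close>: the value at \<open>y\<close> of the monomial with exponent \<open>m\<close>.
\<close>

definition monom_at :: "('v \<Rightarrow> 'a::comm_ring_1) \<Rightarrow> ('v \<Rightarrow>\<^sub>0 nat) \<Rightarrow> 'a" where
  "monom_at y m = (\<Prod>v\<in>keys m. y v ^ lookup m v)"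

lemma monom_at_superset:
  assumes "finite A" "keys m \<subseteq> A"
  shows "monom_at y m = (\<Prod>v\<in>A. y v ^ lookup m v)"
  unfolding monom_at_def using assms
  by (intro prod.mono_neutral_left) (auto simp: not_in_keys_iff_lookup_eq_zero)

lemma monom_at_0 [simp]: "monom_at y 0 = 1"
  by (simp add: monom_at_def)

lemma monom_at_add: "monom_at y (m + n) = monom_at y m * monom_at y n"
proof -
  let ?A = "keys m \<union> keys n"
  have k: "keys (m + n) \<subseteq> ?A" by (rule keys_add)
  show ?thesis
    using monom_at_superset[of ?A "m + n" y, OF _ k] monom_at_superset[of ?A m y]
      monom_at_superset[of ?A n y]
    by (simp add: lookup_add power_add prod.distrib)
qed

lemma monom_at_single [simp]: "monom_at y (single v k) = y v ^ k"
  by (cases "k = 0") (auto simp: monom_at_def)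

lemma psubst_superset:
  assumes "ring_map h" "finite A" "keys p \<subseteq> A"
  shows "psubst h y p = (\<Sum>m\<in>A. h (lookup p m) * monom_at y m)"
proof -
  interpret ring_map h by fact
  show ?thesis
    unfolding psubst_def monom_at_def using assms(2,3)
    by (intro sum.mono_neutral_left) (auto simp: not_in_keys_iff_lookup_eq_zero)
qed

lemma psubst_single:
  assumes "ring_map h"
  shows "psubst h y (single m c) = h c * monom_at y m"
  using psubst_superset[OF assms, of "{m}" "single m c" y] by simp

lemma psubst_ring_map:
  assumes h: "ring_map h"
  shows "ring_map (psubst h y)"
proof -
  interpret ring_map h by (rule h)
  have add': "psubst h y (p + q) = psubst h y p + psubst h y q" for p q
  proof -
    let ?A = "keys p \<union> keys q"
    have k: "keys (p + q) \<subseteq> ?A" by (rule keys_add)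
    show ?thesis
      using psubst_superset[OF h, of ?A "p + q" y, OF _ k] psubst_superset[OF h, of ?A p y]
        psubst_superset[OF h, of ?A q y]
      by (simp add: lookup_add add distrib_right sum.distrib)
  qed
  have zero': "psubst h y 0 = 0" by (simp add: psubst_def)
  have mult': "psubst h y (p * q) = psubst h y p * psubst h y q" for p q
  proof (induction p rule: poly_mapping_sum_induct)
    case (single m c)
    show ?case
    proof (induction q rule: poly_mapping_sum_induct)
      case (single n c')
      show ?case
        by (simp add: mult_single psubst_single[OF h] mult monom_at_add)
    qed (auto simp: add' zero' distrib_left)
  qed (auto simp: add' zero' distrib_right)
  show ?thesis
    by unfold_locales
      (use psubst_single[OF h, of y 0 1] in \<open>auto simp: add' mult' one\<close>)
qed

lemma psubst_pconst: "ring_map h \<Longrightarrow> psubst h y (pconst c) = h c"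
  by (simp add: pconst_def psubst_single)

lemma psubst_pvar: "ring_map h \<Longrightarrow> psubst h y (pvar v) = y v"
  by (simp add: pvar_def psubst_single ring_map.one)

definition polys_in :: "'v set \<Rightarrow> (('v \<Rightarrow>\<^sub>0 nat) \<Rightarrow>\<^sub>0 'r::comm_ring_1) set" where
  "polys_in V = {p. \<forall>m\<in>keys p. keys m \<subseteq> V}"

lemma polys_in_UNIV [simp]: "polys_in UNIV = UNIV"
  by (simp add: polys_in_def)

lemma monom_at_pvar: "monom_at pvar m = single m 1"
proof (induction m rule: poly_mapping_sum_induct)
  case (single v k)
  have "(pvar v :: ('a \<Rightarrow>\<^sub>0 nat) \<Rightarrow>\<^sub>0 'b) ^ k = single (single v k) 1" for k
    by (induction k) (auto simp: pvar_def mult_single simp flip: single_add)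
  then show ?case by simp
qed (auto simp: monom_at_add mult_single)

lemma polys_in_induct [consumes 1, case_names pconst pvar add mult]:
  assumes "p \<in> polys_in V"
    and const: "\<And>c. P (pconst c)" and var: "\<And>v. v \<in> V \<Longrightarrow> P (pvar v)"
    and add: "\<And>p q. P p \<Longrightarrow> P q \<Longrightarrow> P (p + q)" and mult: "\<And>p q. P p \<Longrightarrow> P q \<Longrightarrow> P (p * q)"
  shows "P p"
proof -
  have "\<forall>m\<in>keys p. keys m \<subseteq> V"
    using assms(1) by (simp add: polys_in_def)
  then show ?thesis
  proof (induction p rule: poly_mapping_restricted_induct)
  case zero
  then show ?case using const[of 0] by simp
next
  case (single m c)
  have one: "P 1" using const[of 1] by (simp add: pconst.one)
  have pow: "v \<in> V \<Longrightarrow> P (pvar v ^ k)" for v k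
    by (induction k) (auto intro: one mult var)
  have "P (\<Prod>v\<in>A. pvar v ^ lookup m v)" if "finite A" "A \<subseteq> V" for A
    using that by (induction A) (auto intro: one mult pow)
  then have "P (monom_at pvar m)"
    using single by (auto simp: monom_at_def)
  then have "P (pconst c * monom_at pvar m)"
    by (intro mult const)
  then show ?case by (simp add: monom_at_pvar pconst_mult_single)
qed (rule add)
qed

lemmas poly_induct = polys_in_induct[where V = UNIV, simplified polys_in_UNIV, OF UNIV_I]

lemma ring_map_eqI:
  assumes "ring_map \<phi>" "ring_map \<psi>" "p \<in> polys_in V"
    and "\<And>c. \<phi> (pconst c) = \<psi> (pconst c)" "\<And>v. v \<in> V \<Longrightarrow> \<phi> (pvar v) = \<psi> (pvar v)"
  shows "\<phi> p = \<psi> p"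
proof -
  interpret \<phi>: ring_map \<phi> by fact
  interpret \<psi>: ring_map \<psi> by fact
  show ?thesis using assms(3)
    by (induction rule: polys_in_induct) (auto simp: assms \<phi>.add \<psi>.add \<phi>.mult \<psi>.mult)
qed

text \<open>
  Changing the values of the variables modulo an ideal changes the value of a polynomial only modulo
  that ideal.  The subring \<open>C\<close> allows \<open>J\<close> to be an ideal of a proper subring only; the ideal that
  defines the symmetric algebra is of this kind, as it lives among the polynomials whose variables
  are elements of \<open>I\<close>.
\<close>

lemma ring_map_cong_mod:
  assumes \<phi>: "ring_map \<phi>" and \<psi>: "ring_map \<psi>" and p: "p \<in> polys_in V"
    and C: "\<And>x y. x \<in> C \<Longrightarrow> y \<in> C \<Longrightarrow> x + y \<in> C" "\<And>x y. x \<in> C \<Longrightarrow> y \<in> C \<Longrightarrow> x * y \<in> C"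
    and J: "\<And>x y. x \<in> J \<Longrightarrow> y \<in> J \<Longrightarrow> x + y \<in> J" "\<And>x y. x \<in> C \<Longrightarrow> y \<in> J \<Longrightarrow> x * y \<in> J"
    and const: "\<And>c. \<phi> (pconst c) \<in> C \<and> \<psi> (pconst c) \<in> C \<and> \<phi> (pconst c) - \<psi> (pconst c) \<in> J"
    and var: "\<And>v. v \<in> V \<Longrightarrow> \<phi> (pvar v) \<in> C \<and> \<psi> (pvar v) \<in> C \<and> \<phi> (pvar v) - \<psi> (pvar v) \<in> J"
  shows "\<phi> p \<in> C \<and> \<psi> p \<in> C \<and> \<phi> p - \<psi> p \<in> J"
proof -
  interpret \<phi>: ring_map \<phi> by fact
  interpret \<psi>: ring_map \<psi> by fact
  show ?thesis using p
  proof (induction rule: polys_in_induct)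
    case (add p q)
    have "(\<phi> p - \<psi> p) + (\<phi> q - \<psi> q) \<in> J" using add by (intro J) auto
    then show ?case using add by (auto simp: \<phi>.add \<psi>.add algebra_simps intro: C)
  next
    case (mult p q)
    have "\<phi> p * (\<phi> q - \<psi> q) + \<psi> q * (\<phi> p - \<psi> p) \<in> J" using mult by (intro J) auto
    then show ?case using mult by (auto simp: \<phi>.mult \<psi>.mult algebra_simps intro: C)
  qed (use const var in auto)
qed

section \<open>The bigrading of the polynomial ring\<close>

text \<open>
  The component of bidegree \<open>(p, q)\<close>.  Degrees are integers, as in \<^const>\<open>S_piece\<close>, so that shifted
  degrees need no case distinction; a component of negative degree is zero.
\<close>

definition bicomp :: "int \<Rightarrow> int \<Rightarrow> 'k::field spoly \<Rightarrow> 'k spoly" where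
  "bicomp p q = Poly_Mapping.mapp (\<lambda>m. if int (mon_degree m) = p
     then Poly_Mapping.mapp (\<lambda>n c. if int (mon_degree n) = q then c else 0) else (\<lambda>_. 0))"

lemma lookup_bicomp:
  "lookup (lookup (bicomp p q s) m) n =
     (if int (mon_degree m) = p \<and> int (mon_degree n) = q
      then lookup (lookup s m) n else 0)"
  by (auto simp: bicomp_def lookup_mapp when_def in_keys_iff)

lemma spoly_eqI:
  fixes s t :: "'k::field spoly"
  assumes "\<And>m n. lookup (lookup s m) n =
    lookup (lookup t m) n"
  shows "s = t"
  using assms by (intro poly_mapping_eqI) auto

lemma S_piece_iff:
  "s \<in> S_piece p q \<longleftrightarrow> (\<forall>m n. lookup (lookup s m) n \<noteq> 0 \<longrightarrow>
     int (mon_degree m) = p \<and> int (mon_degree n) = q)"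
proof -
  have "lookup s m \<noteq> 0 \<longleftrightarrow> (\<exists>n. lookup (lookup s m) n \<noteq> 0)" for m
    using poly_mapping_eqI[of "lookup s m" 0] by auto
  then show ?thesis unfolding S_piece_def Ball_def in_keys_iff mem_Collect_eq by metis
qed

lemma bicomp_add: "bicomp p q (s + t) = bicomp p q s + bicomp p q t"
  by (rule spoly_eqI) (simp add: lookup_bicomp lookup_add)

lemma bicomp_uminus: "bicomp p q (- s) = - bicomp p q s"
  by (rule spoly_eqI) (simp add: lookup_bicomp)

lemma bicomp_diff: "bicomp p q (s - t) = bicomp p q s - bicomp p q t"
  by (rule spoly_eqI) (simp add: lookup_bicomp lookup_minus)

lemma bicomp_zero [simp]: "bicomp p q 0 = 0"
  by (rule spoly_eqI) (simp add: lookup_bicomp)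

lemma bicomp_sum: "bicomp p q (sum u A) = (\<Sum>a\<in>A. bicomp p q (u a))"
  by (induction A rule: infinite_finite_induct) (auto simp: bicomp_add)

lemma bicomp_in_piece: "bicomp p q s \<in> S_piece p q"
  by (simp add: S_piece_iff lookup_bicomp)

lemma bicomp_piece: "s \<in> S_piece p q \<Longrightarrow> bicomp p q s = s"
  by (rule spoly_eqI) (auto simp: lookup_bicomp S_piece_iff)

lemma bicomp_other_piece: "s \<in> S_piece p q \<Longrightarrow> (p', q') \<noteq> (p, q) \<Longrightarrow> bicomp p' q' s = 0"
  by (rule spoly_eqI) (auto simp: lookup_bicomp S_piece_iff)

lemma S_piece_add: "s \<in> S_piece p q \<Longrightarrow> t \<in> S_piece p q \<Longrightarrow> s + t \<in> S_piece p q"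
  by (metis bicomp_add bicomp_in_piece bicomp_piece)

lemma S_piece_uminus: "s \<in> S_piece p q \<Longrightarrow> - s \<in> S_piece p q"
  by (metis bicomp_uminus bicomp_in_piece bicomp_piece)

lemma S_piece_zero [simp]: "0 \<in> S_piece p q"
  by (simp add: S_piece_iff)

lemma finite_bicomp_support: "finite {pq. bicomp (fst pq) (snd pq) s \<noteq> 0}"
  and sum_bicomp: "finite A \<Longrightarrow> {pq. bicomp (fst pq) (snd pq) s \<noteq> 0} \<subseteq> A \<Longrightarrow>
    (\<Sum>pq\<in>A. bicomp (fst pq) (snd pq) s) = s"
proof -
  have neq: "bicomp (int (mon_degree m)) (int (mon_degree n)) s \<noteq> 0"
    if "lookup (lookup s m) n \<noteq> 0" for m n
    using that lookup_bicomp[of "int (mon_degree m)" "int (mon_degree n)" s m n]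
    by (metis lookup_zero)
  have "{pq. bicomp (fst pq) (snd pq) s \<noteq> 0} \<subseteq>
    (\<Union>m\<in>keys s. (\<lambda>n. (int (mon_degree m), int (mon_degree n))) `
       keys (lookup s m))"
  proof clarify
    fix p q assume "bicomp (fst (p, q)) (snd (p, q)) s \<noteq> 0"
    then obtain m n where "lookup (lookup (bicomp p q s) m) n \<noteq> 0"
      using spoly_eqI[of "bicomp p q s" 0] by auto
    then have mn: "int (mon_degree m) = p" "int (mon_degree n) = q"
      "lookup (lookup s m) n \<noteq> 0"
      by (auto simp: lookup_bicomp split: if_splits)
    then have "m \<in> keys s" "n \<in> keys (lookup s m)"
      by (auto simp: in_keys_iff)
    with mn show "(p, q) \<in> (\<Union>m\<in>keys s. (\<lambda>n. (int (mon_degree m), int (mon_degree n))) `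
       keys (lookup s m))" by blast
  qed
  then show "finite {pq. bicomp (fst pq) (snd pq) s \<noteq> 0}"
    by (rule finite_subset) auto
  assume A: "finite A" "{pq. bicomp (fst pq) (snd pq) s \<noteq> 0} \<subseteq> A"
  show "(\<Sum>pq\<in>A. bicomp (fst pq) (snd pq) s) = s"
  proof (rule spoly_eqI)
    fix m :: "3 \<Rightarrow>\<^sub>0 nat" and n :: "2 \<Rightarrow>\<^sub>0 nat"
    let ?pq = "(int (mon_degree m), int (mon_degree n))"
    have "lookup (lookup (\<Sum>pq\<in>A. bicomp (fst pq) (snd pq) s) m) n =
      (\<Sum>pq\<in>A. if pq = ?pq then lookup (lookup s m) n else 0)"
      unfolding lookup_sum lookup_bicomp by (intro sum.cong) auto
    also have "\<dots> = lookup (lookup s m) n"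
      using A neq[of m n] by (subst sum.delta) (auto simp: subset_iff)
    finally show "lookup (lookup (\<Sum>pq\<in>A. bicomp (fst pq) (snd pq) s) m) n =
       lookup (lookup s m) n" .
  qed
qed

lemma mon_degree_add: "mon_degree (m + n) = mon_degree m + mon_degree n"
  by (simp add: mon_degree_def lookup_add sum.distrib)

lemma S_piece_induct [consumes 1, case_names zero single add]:
  assumes s: "s \<in> S_piece p q" and "P 0"
    and single: "\<And>m n c. int (mon_degree m) = p \<Longrightarrow> int (mon_degree n) = q \<Longrightarrow>
      P (single m (single n c))"
    and add: "\<And>s t. P s \<Longrightarrow> P t \<Longrightarrow> P (s + t)"
  shows "P s"
proof -
  have "\<forall>m\<in>keys s. int (mon_degree m) = p \<and>
      (\<forall>n\<in>keys (lookup s m). int (mon_degree n) = q)"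
    using s by (simp add: S_piece_def)
  then show ?thesis
  proof (induction s rule: poly_mapping_restricted_induct)
    case (single m r)
    then have m: "int (mon_degree m) = p"
      and "\<forall>n\<in>keys r. int (mon_degree n) = q" by auto
    from this(2) show ?case
      by (induction r rule: poly_mapping_restricted_induct)
         (use m assms in \<open>auto simp: single_add\<close>)
  qed (use assms in auto)
qed

lemma S_piece_mult:
  assumes "s \<in> S_piece a b" "t \<in> S_piece p q"
  shows "s * t \<in> S_piece (a + p) (b + q)"
  using assms(1)
proof (induction rule: S_piece_induct)
  case (single m n c)
  show ?case using assms(2)
  proof (induction rule: S_piece_induct)
    case (single m' n' c')
    then show ?case using \<open>int (mon_degree m) = a\<close> \<open>int (mon_degree n) = b\<close>
      by (auto simp: mult_single S_piece_iff lookup_single when_def mon_degree_add)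
  qed (auto simp: distrib_left intro: S_piece_add)
qed (auto simp: distrib_right intro: S_piece_add)

text \<open>
  Multiplication by a bihomogeneous element shifts components.  Hence ideals with bihomogeneous
  generators, and equations with bihomogeneous coefficients, are compatible with components.
\<close>

lemma bicomp_mult:
  assumes "s \<in> S_piece a b"
  shows "bicomp (a + p) (b + q) (s * t) = s * bicomp p q t"
proof -
  let ?A = "insert (p, q) {pq. bicomp (fst pq) (snd pq) t \<noteq> 0}"
  have fin: "finite ?A" using finite_bicomp_support by auto
  have "s * t = (\<Sum>pq\<in>?A. s * bicomp (fst pq) (snd pq) t)"
    using sum_bicomp[OF fin subset_insertI] by (metis (no_types) sum_distrib_left)
  then have "bicomp (a + p) (b + q) (s * t) =
      (\<Sum>pq\<in>?A. bicomp (a + p) (b + q) (s * bicomp (fst pq) (snd pq) t))"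
    by (simp add: bicomp_sum)
  also have "\<dots> = (\<Sum>pq\<in>?A. if pq = (p, q) then s * bicomp p q t else 0)"
  proof (rule sum.cong)
    fix pq assume "pq \<in> ?A"
    have "s * bicomp (fst pq) (snd pq) t \<in> S_piece (a + fst pq) (b + snd pq)"
      by (intro S_piece_mult assms bicomp_in_piece)
    then show "bicomp (a + p) (b + q) (s * bicomp (fst pq) (snd pq) t) =
        (if pq = (p, q) then s * bicomp p q t else 0)"
      by (cases "pq = (p, q)") (auto simp: bicomp_piece intro!: bicomp_other_piece simp: prod_eq_iff)
  qed simp
  also have "\<dots> = s * bicomp p q t"
    using fin by (subst sum.delta) auto
  finally show ?thesis .
qed

lemma bicomp_mult':
  assumes "s \<in> S_piece a b"
  shows "bicomp p q (s * t) = s * bicomp (p - a) (q - b) t"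
  using bicomp_mult[OF assms, of "p - a" "q - b" t] by simp

lemma S_piece_power: "s \<in> S_piece a b \<Longrightarrow> s ^ n \<in> S_piece (int n * a) (int n * b)"
proof (induction n)
  case 0
  then show ?case
    by (auto simp: S_piece_iff lookup_one when_def mon_degree_def)
next
  case (Suc n)
  then show ?case using S_piece_mult[OF Suc.prems Suc.IH[OF Suc.prems]]
    by (simp add: algebra_simps)
qed

lemma mon_degree_single [simp]: "mon_degree (single v k) = k"
proof -
  have "mon_degree (single v k) = (\<Sum>u\<in>UNIV. if u = v then k else 0)"
    unfolding mon_degree_def by (intro sum.cong) (auto simp: lookup_single when_def)
  then show ?thesis by simp
qed

lemma mon_degree_0 [simp]: "mon_degree 0 = 0"
  by (simp add: mon_degree_def)

lemma pvar_in_piece: "pvar v \<in> S_piece 1 0"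
  by (auto simp: S_piece_iff pvar_def lookup_single when_def lookup_one split: if_splits)

lemma pconst_in_piece: "homogeneous e r \<Longrightarrow> pconst r \<in> S_piece 0 (int e)"
  by (auto simp: S_piece_iff pconst_def lookup_single when_def homogeneous_def in_keys_iff)

lemma xvar_in_piece: "xvar v \<in> S_piece 0 1"
  using pconst_in_piece[of 1 "pvar v"]
  by (simp add: xvar_def homogeneous_def pvar_def)

lemma xvar_power_in_piece: "xvar v ^ n \<in> S_piece 0 (int n)"
  using S_piece_power[OF xvar_in_piece, of v n] by simp

section \<open>Koszul syzygies and Cech classes\<close>

lemma two_generated_closed:
  fixes u v :: "'a::comm_ring_1"
  shows "0 \<in> {a * u + b * v |a b. True}"
    and "w \<in> {a * u + b * v |a b. True} \<Longrightarrow> w' \<in> {a * u + b * v |a b. True} \<Longrightarrow>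
      w + w' \<in> {a * u + b * v |a b. True}"
    and "w \<in> {a * u + b * v |a b. True} \<Longrightarrow> s * w \<in> {a * u + b * v |a b. True}"
proof -
  let ?J = "{a * u + b * v |a b. True}"
  show "0 \<in> ?J"
    by (rule CollectI, rule exI[of _ 0], rule exI[of _ 0]) simp
  show "w + w' \<in> ?J" if w: "w \<in> ?J" "w' \<in> ?J"
  proof -
    obtain a b where ab: "w = a * u + b * v" using w(1) by blast
    obtain a' b' where ab': "w' = a' * u + b' * v" using w(2) by blast
    have "w + w' = (a + a') * u + (b + b') * v" unfolding ab ab' by (simp add: algebra_simps)
    then show ?thesis by blast
  qed
  show "s * w \<in> ?J" if w: "w \<in> ?J"
  proof -
    obtain a b where ab: "w = a * u + b * v" using w by blast
    have "s * w = (s * a) * u + (s * b) * v" unfolding ab by (simp add: algebra_simps)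
    then show ?thesis by blast
  qed
qed

text \<open>
  The part of the argument that uses only the exactness of the two Koszul complexes involved: the one
  on powers of \<open>x, y\<close> and the one on \<open>g1, g2\<close>.
\<close>

locale koszul_cech =
  fixes x y g1 g2 :: "'a::idom"
  assumes x_nz: "x \<noteq> 0" and y_nz: "y \<noteq> 0" and g1_nz: "g1 \<noteq> 0" and g2_nz: "g2 \<noteq> 0"
    and coprime_powers: "x ^ n dvd y ^ m * z \<Longrightarrow> x ^ n dvd z"
    and koszul: "a * g1 + b * g2 = 0 \<Longrightarrow> \<exists>c. a = c * g2"
begin

lemma koszul': "a * g1 + b * g2 = 0 \<Longrightarrow> \<exists>c. a = c * g2 \<and> b = - (c * g1)"
proof -
  assume *: "a * g1 + b * g2 = 0"
  then obtain c where c: "a = c * g2" using koszul by blast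
  have "(b + c * g1) * g2 = 0" using * by (simp add: c algebra_simps)
  then have "b = - (c * g1)" using g2_nz by (simp add: add_eq_0_iff2)
  with c show ?thesis by blast
qed

lemma cross_eq:
  assumes "y ^ m * a = x ^ n * b"
  shows "\<exists>c. a = x ^ n * c \<and> b = y ^ m * c"
proof -
  have "x ^ n dvd y ^ m * a" using assms by simp
  then have "x ^ n dvd a" by (rule coprime_powers)
  then obtain c where c: "a = x ^ n * c" by (auto simp: dvd_def)
  then have "x ^ n * (y ^ m * c) = x ^ n * b" using assms by (simp add: mult.left_commute)
  then have "b = y ^ m * c" using x_nz by simp
  with c show ?thesis by blast
qed

definition eq_ideal :: "'a set" where
  "eq_ideal = {a * g1 + b * g2 |a b. True}"

definition pow_ideal :: "nat \<Rightarrow> 'a set" where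
  "pow_ideal n = {a * x ^ n + b * y ^ n |a b. True}"

text \<open>
  The elements whose classes modulo \<open>(g1, g2)\<close> are torsion with respect to \<open>(x, y)\<close>.
\<close>

definition torsion :: "'a set" where
  "torsion = {F. \<exists>n. x ^ n * F \<in> eq_ideal \<and> y ^ n * F \<in> eq_ideal}"

text \<open>
  The diagram chase from \<open>F\<close> to \<open>w\<close>: lift \<open>F\<close> along \<open>(g1, g2)\<close> to \<open>(a / U, b / U)\<close> and to
  \<open>(a' / V, b' / V)\<close>.  The difference of the two lifts is a Koszul syzygy with coefficient
  \<open>w / (U V)\<close>.
\<close>

definition chase :: "'a \<Rightarrow> 'a \<Rightarrow> 'a \<Rightarrow> 'a \<Rightarrow> bool" where
  "chase U V F w \<longleftrightarrow> (\<exists>a b a' b'. U * F = a * g1 + b * g2 \<and> V * F = a' * g1 + b' * g2 \<and>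
     V * a - U * a' = w * g2 \<and> V * b - U * b' = - (w * g1))"

lemma chaseI:
  "U * F = a * g1 + b * g2 \<Longrightarrow> V * F = a' * g1 + b' * g2 \<Longrightarrow>
   V * a - U * a' = w * g2 \<Longrightarrow> V * b - U * b' = - (w * g1) \<Longrightarrow> chase U V F w"
  unfolding chase_def by blast

lemma chaseE:
  assumes "chase U V F w"
  obtains a b a' b' where "U * F = a * g1 + b * g2" "V * F = a' * g1 + b' * g2"
    "V * a - U * a' = w * g2" "V * b - U * b' = - (w * g1)"
  using assms unfolding chase_def by blast

definition linked :: "nat \<Rightarrow> 'a \<Rightarrow> 'a \<Rightarrow> bool" where
  "linked n = chase (x ^ n) (y ^ n)"

lemmas linkedI = chaseI[where U = "x ^ n" and V = "y ^ n" for n, folded linked_def]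
lemmas linkedE = chaseE[where U = "x ^ n" and V = "y ^ n" for n, folded linked_def]

lemma linked_add:
  assumes "linked n F w" "linked n F' w'"
  shows "linked n (F + F') (w + w')"
proof -
  have "chase U V (F + F') (w + w')" if FF': "chase U V F w" "chase U V F' w'" for U V
  proof -
    obtain a b c e where 1: "U * F = a * g1 + b * g2" "V * F = c * g1 + e * g2"
      "V * a - U * c = w * g2" "V * b - U * e = - (w * g1)"
      by (rule chaseE[OF FF'(1)])
    obtain a' b' c' e' where 2: "U * F' = a' * g1 + b' * g2" "V * F' = c' * g1 + e' * g2"
      "V * a' - U * c' = w' * g2" "V * b' - U * e' = - (w' * g1)"
      by (rule chaseE[OF FF'(2)])
    show ?thesis by (rule chaseI[of _ _ "a + a'" "b + b'" _ "c + c'" "e + e'"]) (use 1 2 in Groebner_Basis.algebra)+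
  qed
  with assms show ?thesis unfolding linked_def by blast
qed

text \<open>
  The case \<open>s = 1\<close> says that the relation depends only on the fraction \<open>w / (x y)\<^sup>n\<close>.
\<close>

lemma linked_scale:
  assumes "linked n F w"
  shows "linked (n + k) (s * F) ((x * y) ^ k * (s * w))"
proof -
  have "chase (U * P) (V * Q) (s * F) (P * Q * (s * w))" if F: "chase U V F w" for U V P Q
  proof -
    obtain a b c e where 1: "U * F = a * g1 + b * g2" "V * F = c * g1 + e * g2"
      "V * a - U * c = w * g2" "V * b - U * e = - (w * g1)"
      by (rule chaseE[OF F])
    show ?thesis
      by (rule chaseI[of _ _ "P * s * a" "P * s * b" _ "Q * s * c" "Q * s * e"]) (use 1 in Groebner_Basis.algebra)+
  qed
  with assms show ?thesis unfolding linked_def power_add power_mult_distrib by blast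
qed

lemma linked_mult: "linked n F w \<Longrightarrow> linked n (s * F) (s * w)"
  using linked_scale[of n F w 0 s] by simp

lemma linked_raise: "linked n F w \<Longrightarrow> linked (n + k) F ((x * y) ^ k * w)"
  using linked_scale[of n F w k 1] by simp

text \<open>
  Equating the two expressions of \<open>(x y)\<^sup>n F\<close> produces a syzygy of \<open>g1, g2\<close>, hence \<open>w\<close>.
\<close>

lemma linked_left_total:
  assumes "F \<in> torsion"
  shows "\<exists>n w. linked n F w"
proof -
  obtain n a b c e where 1: "x ^ n * F = a * g1 + b * g2" "y ^ n * F = c * g1 + e * g2"
    using assms by (auto simp: torsion_def eq_ideal_def)
  have "y ^ n * (x ^ n * F) = x ^ n * (y ^ n * F)" by (rule mult.left_commute)
  then have "(y ^ n * a - x ^ n * c) * g1 + (y ^ n * b - x ^ n * e) * g2 = 0"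
    unfolding 1 by (simp add: algebra_simps)
  then obtain w where "y ^ n * a - x ^ n * c = w * g2" "y ^ n * b - x ^ n * e = - (w * g1)"
    using koszul' by blast
  with 1 show ?thesis using linkedI by blast
qed

lemma linked_torsion:
  assumes "linked n F w"
  shows "F \<in> torsion" "g1 * w \<in> pow_ideal n" "g2 * w \<in> pow_ideal n"
proof -
  obtain a b c e where 1: "x ^ n * F = a * g1 + b * g2" "y ^ n * F = c * g1 + e * g2"
     "y ^ n * a - x ^ n * c = w * g2" "y ^ n * b - x ^ n * e = - (w * g1)"
    by (rule linkedE[OF assms(1)])
  then show "F \<in> torsion" by (auto simp: torsion_def eq_ideal_def)
  have "g2 * w = (- c) * x ^ n + a * y ^ n" using 1(3) by (simp add: algebra_simps)
  then show "g2 * w \<in> pow_ideal n" unfolding pow_ideal_def by blast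
  have "w * g1 = - (y ^ n * b - x ^ n * e)" unfolding 1(4) by simp
  then have "g1 * w = e * x ^ n + (- b) * y ^ n" by (simp add: algebra_simps)
  then show "g1 * w \<in> pow_ideal n" unfolding pow_ideal_def by blast
qed

text \<open>
  The same chase in the opposite direction: the syzygy between \<open>x\<^sup>n\<close> and \<open>y\<^sup>n\<close> obtained by equating
  the two expressions of \<open>g1 g2 w\<close> produces \<open>F\<close>.
\<close>

lemma linked_right_total:
  assumes "g1 * w \<in> pow_ideal n" "g2 * w \<in> pow_ideal n"
  shows "\<exists>F. linked n F w"
proof -
  obtain b c where 2: "g2 * w = c * x ^ n + b * y ^ n"
    using assms by (auto simp: pow_ideal_def)
  obtain b' c' where 1: "g1 * w = c' * x ^ n + b' * y ^ n"
    using assms by (auto simp: pow_ideal_def)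
  have "g1 * (g2 * w) = g2 * (g1 * w)" by (rule mult.left_commute)
  then have "y ^ n * (b * g1 - b' * g2) = x ^ n * (c' * g2 - c * g1)"
    unfolding 1 2 by (simp add: algebra_simps)
  then obtain F where F: "b * g1 - b' * g2 = x ^ n * F" "c' * g2 - c * g1 = y ^ n * F"
    using cross_eq by blast
  have "linked n F w"
  proof (rule linkedI)
    show "x ^ n * F = b * g1 + (- b') * g2" using F by simp
    show "y ^ n * F = (- c) * g1 + c' * g2" using F by simp
    show "y ^ n * b - x ^ n * - c = w * g2" using 2 by (simp add: algebra_simps)
    show "y ^ n * (- b') - x ^ n * c' = - (w * g1)" using 1 by (simp add: algebra_simps)
  qed
  then show ?thesis by blast
qed

text \<open>
  This lemma and the next one say that \<open>F\<close> and \<open>w\<close> vanish in the respective quotients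
  simultaneously.  They give well-definedness of the induced map in one direction and its injectivity
  in the other.
\<close>

lemma linked_zero_left:
  assumes "linked n F w" "F \<in> eq_ideal"
  shows "w \<in> pow_ideal n"
proof -
  obtain a b c e where 1: "x ^ n * F = a * g1 + b * g2" "y ^ n * F = c * g1 + e * g2"
     "y ^ n * a - x ^ n * c = w * g2" "y ^ n * b - x ^ n * e = - (w * g1)"
    by (rule linkedE[OF assms(1)])
  obtain u v where F: "F = u * g1 + v * g2" using assms(2) by (auto simp: eq_ideal_def)
  have "(a - x ^ n * u) * g1 + (b - x ^ n * v) * g2 = 0" "(c - y ^ n * u) * g1 + (e - y ^ n * v) * g2 = 0"
    using 1(1,2) unfolding F by (simp_all add: algebra_simps)
  then obtain r s where "a - x ^ n * u = r * g2" "c - y ^ n * u = s * g2"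
    using koszul by meson
  then have rs: "a = x ^ n * u + r * g2" "c = y ^ n * u + s * g2" by (simp_all add: algebra_simps)
  have "w * g2 = ((- s) * x ^ n + r * y ^ n) * g2"
    unfolding 1(3)[symmetric] rs by (simp add: algebra_simps)
  then have "w = (- s) * x ^ n + r * y ^ n" using g2_nz by simp
  then show ?thesis unfolding pow_ideal_def by blast
qed

lemma linked_zero_right:
  assumes "linked n F w" "w \<in> pow_ideal n"
  shows "F \<in> eq_ideal"
proof -
  obtain a b c e where 1: "x ^ n * F = a * g1 + b * g2"
    and "y ^ n * F = c * g1 + e * g2"
    and 2: "y ^ n * a - x ^ n * c = w * g2" "y ^ n * b - x ^ n * e = - (w * g1)"
    by (rule linkedE[OF assms(1)])
  obtain v u where w: "w = v * x ^ n + u * y ^ n" using assms(2) by (auto simp: pow_ideal_def)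
  have "y ^ n * (a - u * g2) = x ^ n * (c + v * g2)" "y ^ n * (b + u * g1) = x ^ n * (e - v * g1)"
    using 2 unfolding w by (simp_all add: algebra_simps)
  then obtain r s where "a - u * g2 = x ^ n * r" "b + u * g1 = x ^ n * s"
    using cross_eq by meson
  then have rs: "a = x ^ n * r + u * g2" "b = x ^ n * s - u * g1" by (simp_all add: algebra_simps)
  have "x ^ n * F = x ^ n * (r * g1 + s * g2)"
    unfolding 1 rs by (simp add: algebra_simps)
  then have "F = r * g1 + s * g2" using x_nz by simp
  then show ?thesis by (auto simp: eq_ideal_def)
qed

text \<open>
  Multiplication by \<open>(x y)\<^sup>k\<close> embeds \<open>S / (x\<^sup>n, y\<^sup>n)\<close> into \<open>S / (x\<^bsup>n+k\<^esup>, y\<^bsup>n+k\<^esup>)\<close>.  The top local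
  cohomology is the union of these quotients, so the class of \<open>w / (x y)\<^sup>n\<close> is zero only if \<open>w\<close> is
  already zero at level \<open>n\<close>.
\<close>

lemma pow_ideal_colon:
  "(x * y) ^ k * w \<in> pow_ideal (n + k) \<longleftrightarrow> w \<in> pow_ideal n"
proof
  assume "(x * y) ^ k * w \<in> pow_ideal (n + k)"
  then obtain a b where ab: "(x * y) ^ k * w = a * x ^ (n + k) + b * y ^ (n + k)"
    by (auto simp: pow_ideal_def)
  then have "y ^ k * (x ^ k * w - b * y ^ n) = x ^ (n + k) * a"
    by (simp add: algebra_simps power_add power_mult_distrib)
  then obtain c where "x ^ k * w - b * y ^ n = x ^ (n + k) * c" using cross_eq by blast
  then have "y ^ n * b = x ^ k * (w - x ^ n * c)" by (simp add: algebra_simps power_add)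
  then obtain e where "w - x ^ n * c = y ^ n * e" using cross_eq by blast
  then have "w = c * x ^ n + e * y ^ n" by (simp add: algebra_simps)
  then show "w \<in> pow_ideal n" unfolding pow_ideal_def by blast
next
  assume "w \<in> pow_ideal n"
  then obtain a b where w: "w = a * x ^ n + b * y ^ n" by (auto simp: pow_ideal_def)
  have "(x * y) ^ k * w = (y ^ k * a) * x ^ (n + k) + (x ^ k * b) * y ^ (n + k)"
    unfolding w by (simp add: algebra_simps power_add power_mult_distrib)
  then show "(x * y) ^ k * w \<in> pow_ideal (n + k)" unfolding pow_ideal_def by blast
qed

lemmas eq_ideal_closed =
  two_generated_closed[where u = g1 and v = g2, folded eq_ideal_def]

lemmas pow_ideal_closed =
  two_generated_closed[where u = "x ^ n" and v = "y ^ n" for n, folded pow_ideal_def]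

end

section \<open>The variables as a regular sequence\<close>

lemma ring_map_id: "ring_map (\<lambda>p. p)"
  by unfold_locales auto

lemma ring_map_compose: "ring_map h \<Longrightarrow> ring_map k \<Longrightarrow> ring_map (\<lambda>p. k (h p))"
  by (simp add: ring_map_def)

lemma pvar_neq_0 [simp]: "(pvar v :: ('v \<Rightarrow>\<^sub>0 nat) \<Rightarrow>\<^sub>0 'r::comm_ring_1) \<noteq> 0"
  by (metis pvar_def lookup_single_eq lookup_zero zero_neq_one)

text \<open>
  Setting a variable to zero changes a polynomial by a multiple of that variable; so divisibility by
  the variable is detected by a ring homomorphism.
\<close>

lemma psubst_drop_pvar:
  fixes p :: "('v \<Rightarrow>\<^sub>0 nat) \<Rightarrow>\<^sub>0 'r::comm_ring_1"
  shows "pvar v dvd p - psubst pconst (\<lambda>u. if u = v then 0 else pvar u) p"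
proof -
  let ?e = "psubst pconst (\<lambda>u. if u = v then 0 else pvar u :: ('v \<Rightarrow>\<^sub>0 nat) \<Rightarrow>\<^sub>0 'r)"
  have e: "ring_map ?e" by (intro psubst_ring_map pconst_ring_map)
  have "p \<in> UNIV \<and> ?e p \<in> UNIV \<and> p - ?e p \<in> {q. pvar v dvd q}"
    by (rule ring_map_cong_mod[OF ring_map_id e, where V = UNIV])
      (auto simp: psubst_pconst psubst_pvar pconst_ring_map)
  then show ?thesis by simp
qed

lemma pvar_dvd_mult_pvar:
  fixes p :: "('v::linorder \<Rightarrow>\<^sub>0 nat) \<Rightarrow>\<^sub>0 'r::idom"
  assumes "u \<noteq> v" "pvar v dvd pvar u * p"
  shows "pvar v dvd p"
proof -
  let ?e = "psubst pconst (\<lambda>u. if u = v then 0 else pvar u :: ('v \<Rightarrow>\<^sub>0 nat) \<Rightarrow>\<^sub>0 'r)"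
  interpret e: ring_map ?e by (intro psubst_ring_map pconst_ring_map)
  obtain r where "pvar u * p = pvar v * r" using assms(2) by (auto simp: dvd_def)
  then have "?e (pvar u * p) = ?e (pvar v * r)" by simp
  then have "pvar u * ?e p = 0"
    using assms(1) by (simp add: e.mult psubst_pvar pconst_ring_map)
  then have "?e p = 0" by simp
  with psubst_drop_pvar[of v p] show ?thesis by simp
qed

lemma pconst_dvd: "pconst r dvd (p :: ('v::linorder \<Rightarrow>\<^sub>0 nat) \<Rightarrow>\<^sub>0 'r::idom) \<longleftrightarrow>
    (\<forall>m. r dvd lookup p m)"
proof
  assume "\<forall>m. r dvd lookup p m"
  then have "\<forall>m\<in>keys p. r dvd lookup p m" by blast
  then show "pconst r dvd p"
  proof (induction p rule: poly_mapping_restricted_induct)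
    case (single m c)
    then obtain e where "c = r * e" by (auto simp: dvd_def)
    then show ?case by (metis pconst_mult_single dvd_triv_left)
  qed auto
qed (auto simp: dvd_def lookup_pconst_mult)

lemma xvar_dvd_mult_xvar:
  assumes "u \<noteq> v" "xvar v dvd xvar u * p"
  shows "xvar v dvd p"
  using assms(2) pvar_dvd_mult_pvar[OF assms(1)]
  unfolding xvar_def pconst_dvd lookup_pconst_mult by blast

lemma xvar_neq_0 [simp]: "xvar v \<noteq> 0"
  by (simp add: xvar_def)

lemma xvar_power_dvd_mult:
  assumes "u \<noteq> v" "xvar v ^ n dvd xvar u ^ m * p"
  shows "xvar v ^ n dvd p"
  using assms(2)
proof (induction n arbitrary: p)
  case (Suc n)
  have *: "xvar v dvd xvar u ^ m * q \<Longrightarrow> xvar v dvd q" for q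
  proof (induction m)
    case (Suc m)
    have "xvar v dvd xvar u * (xvar u ^ m * q)"
      using Suc.prems by (simp only: power_Suc mult.assoc)
    then have "xvar v dvd xvar u ^ m * q" by (rule xvar_dvd_mult_xvar[OF assms(1)])
    then show ?case by (rule Suc.IH)
  qed simp
  have "xvar v dvd xvar u ^ m * p"
    by (rule dvd_trans[OF _ Suc.prems]) simp
  then obtain r where r: "p = xvar v * r" using * by (auto simp: dvd_def)
  then have "xvar v * xvar v ^ n dvd xvar v * (xvar u ^ m * r)"
    using Suc.prems by (simp add: mult.left_commute)
  then have "xvar v ^ n dvd xvar u ^ m * r" by simp
  then have "xvar v ^ n dvd r" by (rule Suc.IH)
  then show ?case by (simp add: r)
qed simp

section \<open>Consequences of the Hilbert-Burch resolution\<close>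

definition lin :: "(3 \<Rightarrow> 'k::field rpoly) \<Rightarrow> 'k spoly" where
  "lin c = (\<Sum>i\<in>UNIV. pconst (c i) * pvar i)"

lemma lin_add: "lin (\<lambda>i. a i + b i) = lin a + lin b"
  by (simp add: lin_def pconst.add distrib_right sum.distrib)

lemma lin_diff: "lin (\<lambda>i. a i - b i) = lin a - lin b"
  by (simp add: lin_def pconst.diff left_diff_distrib sum_subtractf)

lemma lin_scale: "lin (\<lambda>i. r * a i) = pconst r * lin a"
  by (simp add: lin_def pconst.mult sum_distrib_left mult.assoc)

lemma lin_delta: "lin (\<lambda>i. if i = j then r else 0) = pconst r * pvar j"
proof -
  have "lin (\<lambda>i. if i = j then r else 0) = (\<Sum>i\<in>UNIV. if i = j then pconst r * pvar j else 0)"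
    unfolding lin_def by (intro sum.cong) auto
  then show ?thesis by simp
qed

lemma single_eq: "single i (Suc 0) = single j (Suc 0) \<Longrightarrow> i = j"
  by (metis keys_single singleton_inject nat.simps(3))

lemma lookup_lin: "lookup (lin c) (single i 1) = c i"
proof -
  have "lookup (lin c) (single i 1) = (\<Sum>j\<in>UNIV. if j = i then c i else 0)"
    unfolding lin_def lookup_sum
    by (intro sum.cong) (auto simp: lookup_pconst_mult pvar_def lookup_single when_def dest!: single_eq)
  then show ?thesis by simp
qed

lemma power_mult_closed:
  assumes "\<And>s t. t \<in> J \<Longrightarrow> s * t \<in> J" "h ^ m * a \<in> J" "m \<le> n"
  shows "h ^ n * a \<in> (J :: 'a::comm_ring_1 set)"
proof -
  have "h ^ n * a = h ^ (n - m) * (h ^ m * a)"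
    using assms(3) by (simp flip: mult.assoc power_add)
  with assms(1,2) show ?thesis by metis
qed

text \<open>
  The homogeneous components may need different powers of \<open>h\<close>, but there are finitely many of them.
\<close>

lemma torsion_from_bicomps:
  fixes J :: "'k::field spoly set"
  assumes J: "0 \<in> J" "\<And>s t. s \<in> J \<Longrightarrow> t \<in> J \<Longrightarrow> s + t \<in> J" "\<And>s t. t \<in> J \<Longrightarrow> s * t \<in> J"
    and comps: "\<And>p q. \<exists>n. h ^ n * bicomp p q a \<in> J"
  shows "\<exists>n. h ^ n * a \<in> J"
proof -
  have "\<exists>n. h ^ n * (\<Sum>pq\<in>A. bicomp (fst pq) (snd pq) a) \<in> J" if "finite A" for A
    using that
  proof (induction A)
    case empty
    then show ?case using J by auto
  next
    case (insert pq A)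
    then obtain m where m: "h ^ m * (\<Sum>pq\<in>A. bicomp (fst pq) (snd pq) a) \<in> J" by blast
    obtain n where n: "h ^ n * bicomp (fst pq) (snd pq) a \<in> J" using comps by blast
    have "h ^ (m + n) * bicomp (fst pq) (snd pq) a + h ^ (m + n) * (\<Sum>pq\<in>A. bicomp (fst pq) (snd pq) a) \<in> J"
      by (intro J(2) power_mult_closed[OF J(3) m] power_mult_closed[OF J(3) n]) auto
    then have "h ^ (m + n) * (\<Sum>pq\<in>insert pq A. bicomp (fst pq) (snd pq) a) \<in> J"
      using insert.hyps by (simp add: distrib_left)
    then show ?case by blast
  qed
  from this[OF finite_bicomp_support[of a]] show ?thesis
    using sum_bicomp[OF finite_bicomp_support order_refl, of a] by simp
qed

text \<open>
  The substitution \<open>T\<^sub>i \<mapsto> h T\<^sub>i\<close>.  It replaces division by \<open>h\<close>: on elements of degree \<open>p\<close> in the \<open>T\<^sub>i\<close> it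
  is multiplication by \<open>h\<^sup>p\<close>.
\<close>

definition scale_vars :: "'k::field rpoly \<Rightarrow> 'k spoly \<Rightarrow> 'k spoly" where
  "scale_vars h = psubst pconst (\<lambda>i. pconst h * pvar i)"

lemma scale_vars_ring_map: "ring_map (scale_vars h)"
  unfolding scale_vars_def by (intro psubst_ring_map pconst_ring_map)

lemma mon_degree_prod: "(\<Prod>i\<in>UNIV. (c * y i) ^ lookup m i) =
    (c::'a::comm_ring_1) ^ mon_degree m * (\<Prod>i\<in>UNIV. y i ^ lookup m i)"
  by (simp add: power_mult_distrib prod.distrib mon_degree_def power_sum)

lemma scale_vars_piece:
  assumes "s \<in> S_piece p q"
  shows "scale_vars h s = pconst h ^ nat p * s"
  using assms
proof (induction rule: S_piece_induct)
  case (single m n c)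
  have "monom_at (\<lambda>i. pconst h * pvar i) m = pconst h ^ mon_degree m * monom_at pvar m"
    by (subst (1 2) monom_at_superset[of UNIV]) (auto simp: mon_degree_prod)
  then have "scale_vars h (single m (single n c)) =
      pconst (single n c) * (pconst h ^ mon_degree m * single m 1)"
    by (simp only: scale_vars_def psubst_single[OF pconst_ring_map] monom_at_pvar)
  also have "\<dots> = pconst h ^ mon_degree m * (pconst (single n c) * single m 1)"
    by (rule mult.left_commute)
  also have "\<dots> = pconst h ^ nat p * single m (single n c)"
    using single by (simp only: pconst_mult_single mult_1_right) auto
  finally show ?case .
qed (auto simp: distrib_left ring_map.add[OF scale_vars_ring_map] ring_map.zero[OF scale_vars_ring_map])

lemma bicomp_scale_vars:
  assumes h: "homogeneous e h"
  shows "bicomp p (q + int (nat p) * int e) (scale_vars h s) = pconst h ^ nat p * bicomp p q s"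
proof -
  let ?A = "insert (p, q) {pq. bicomp (fst pq) (snd pq) s \<noteq> 0}"
  have fin: "finite ?A" using finite_bicomp_support by auto
  interpret sv: ring_map "scale_vars h" by (rule scale_vars_ring_map)
  let ?t = "\<lambda>pq. pconst h ^ nat (fst pq) * bicomp (fst pq) (snd pq) s"
  have "scale_vars h s = (\<Sum>pq\<in>?A. scale_vars h (bicomp (fst pq) (snd pq) s))"
    using sum_bicomp[OF fin subset_insertI] by (metis (no_types) sv.sum)
  also have "\<dots> = (\<Sum>pq\<in>?A. ?t pq)"
    by (intro sum.cong scale_vars_piece[OF bicomp_in_piece]) simp
  finally have "bicomp p (q + int (nat p) * int e) (scale_vars h s) =
      (\<Sum>pq\<in>?A. bicomp p (q + int (nat p) * int e) (?t pq))"
    by (simp add: bicomp_sum)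
  also have "\<dots> = (\<Sum>pq\<in>?A. if pq = (p, q) then ?t (p, q) else 0)"
  proof (rule sum.cong)
    fix pq assume "pq \<in> ?A"
    have "?t pq \<in> S_piece (int (nat (fst pq)) * 0 + fst pq) (int (nat (fst pq)) * int e + snd pq)"
      by (intro S_piece_mult S_piece_power pconst_in_piece h bicomp_in_piece)
    then have *: "?t pq \<in> S_piece (fst pq) (snd pq + int (nat (fst pq)) * int e)"
      by (simp add: add.commute)
    show "bicomp p (q + int (nat p) * int e) (?t pq) = (if pq = (p, q) then ?t (p, q) else 0)"
    proof (cases "pq = (p, q)")
      case True
      then show ?thesis using bicomp_piece[OF *] by simp
    next
      case False
      then have "(p, q + int (nat p) * int e) \<noteq> (fst pq, snd pq + int (nat (fst pq)) * int e)"
        by (auto simp: prod_eq_iff)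
      then show ?thesis using bicomp_other_piece[OF *] False by simp
    qed
  qed simp
  also have "\<dots> = ?t (p, q)"
    using fin by (subst sum.delta) auto
  finally show ?thesis by simp
qed

lemma poly_map_poly_pconst_ring_map:
  fixes y :: "('v \<Rightarrow>\<^sub>0 nat) \<Rightarrow>\<^sub>0 'r::comm_ring_1"
  shows "ring_map (\<lambda>P. poly (map_poly pconst P) y)"
proof
  let ?e = "\<lambda>P. poly (map_poly pconst P) y"
  have add: "?e (P + Q) = ?e P + ?e Q" for P Q
  proof -
    have "map_poly (pconst :: _ \<Rightarrow> ('v \<Rightarrow>\<^sub>0 nat) \<Rightarrow>\<^sub>0 'r) (P + Q) = map_poly pconst P + map_poly pconst Q"
      by (rule poly_eqI) (simp add: coeff_map_poly pconst.add)
    then show ?thesis by simp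
  qed
  then show "?e (P + Q) = ?e P + ?e Q" for P Q .
  have smult: "?e (smult c Q) = pconst c * ?e Q" for c Q
    by (simp add: map_poly_smult pconst.mult)
  show "?e (P * Q) = ?e P * ?e Q" for P Q
    by (induction P) (simp_all add: add smult map_poly_pCons algebra_simps)
  show "?e 1 = 1"
    by (simp add: map_poly_1 pconst.one)
qed

text \<open>
  The composite of \<open>S \<rightarrow> Sym(I) \<rightarrow> Rees(I)\<close>, that is \<open>T\<^sub>i \<mapsto> f\<^sub>i t\<close>.
\<close>

definition rees_eval :: "'k::field rpoly ^ 3 \<Rightarrow> 'k spoly \<Rightarrow> 'k rpoly poly" where
  "rees_eval f = psubst (\<lambda>r. [:r:]) (\<lambda>i. Polynomial.monom (f $ i) 1)"

lemma const_poly_ring_map: "ring_map (\<lambda>r. [:r:])"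
  by unfold_locales (auto simp: one_pCons)

lemma rees_eval_ring_map: "ring_map (rees_eval f)"
  unfolding rees_eval_def by (intro psubst_ring_map const_poly_ring_map)

lemma rees_eval_pconst: "rees_eval f (pconst r) = [:r:]"
  by (simp add: rees_eval_def psubst_pconst const_poly_ring_map)

lemma rees_eval_lin: "rees_eval f (lin c) = Polynomial.monom (\<Sum>i\<in>UNIV. f $ i * c i) 1"
proof -
  interpret e: ring_map "rees_eval f" by (rule rees_eval_ring_map)
  have "rees_eval f (pvar i) = Polynomial.monom (f $ i) 1" for i
    by (simp add: rees_eval_def psubst_pvar const_poly_ring_map)
  then show ?thesis
    by (simp add: lin_def e.add e.mult rees_eval_pconst sum_3 add_monom smult_monom mult.commute)
qed

locale hilbert_burch_ideal =
  fixes I :: "'k::field rpoly set" and d \<mu> :: nat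
    and f :: "'k rpoly ^ 3" and \<phi> :: "'k rpoly ^ 2 ^ 3"
  assumes hom: "\<forall>i. homogeneous d (f $ i)"
    and hb: "hilbert_burch I d \<mu> f \<phi>"
begin

definition g1 :: "'k spoly" where "g1 = lin (\<lambda>i. \<phi> $ i $ 1)"
definition g2 :: "'k spoly" where "g2 = lin (\<lambda>i. \<phi> $ i $ 2)"

lemma sym_equations_nth: "sym_equations \<phi> $ 1 = g1" "sym_equations \<phi> $ 2 = g2"
  by (simp_all add: sym_equations_def vector_matrix_mult_def g1_def g2_def lin_def mult.commute)

lemma I_iff: "r \<in> I \<longleftrightarrow> (\<exists>c. r = (\<Sum>i\<in>UNIV. f $ i * c i))"
proof
  assume "r \<in> I"
  then have "r \<in> range (\<lambda>c :: 'k rpoly ^ 3. \<Sum>i\<in>UNIV. f $ i * c $ i)"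
    using hb by (simp add: hilbert_burch_def)
  then obtain c :: "'k rpoly ^ 3" where "r = (\<Sum>i\<in>UNIV. f $ i * c $ i)" by blast
  then show "\<exists>c. r = (\<Sum>i\<in>UNIV. f $ i * c i)" by (rule exI[where x = "\<lambda>i. c $ i"])
next
  assume "\<exists>c. r = (\<Sum>i\<in>UNIV. f $ i * c i)"
  then obtain c where "r = (\<Sum>i\<in>UNIV. f $ i * c i)" ..
  then have "r = (\<Sum>i\<in>UNIV. f $ i * (\<chi> i. c i) $ i)" by simp
  then have "r \<in> range (\<lambda>c :: 'k rpoly ^ 3. \<Sum>i\<in>UNIV. f $ i * c $ i)" by (rule range_eqI)
  then show "r \<in> I" using hb by (simp add: hilbert_burch_def)
qed

lemma mu_le: "\<mu> \<le> d"
proof -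
  have "0 < \<mu> \<and> \<mu> \<le> d - \<mu>" using hb by (simp add: hilbert_burch_def)
  then show ?thesis by arith
qed

lemma lin_in_piece: "(\<And>i. homogeneous e (c i)) \<Longrightarrow> lin c \<in> S_piece 1 (int e)"
  unfolding lin_def sum_3
  by (intro S_piece_add S_piece_mult[of _ 0 "int e" _ 1 0, simplified] pconst_in_piece pvar_in_piece)

lemma g1_in_piece: "g1 \<in> S_piece 1 (int \<mu>)"
  and g2_in_piece: "g2 \<in> S_piece 1 (int d - int \<mu>)"
proof -
  show "g1 \<in> S_piece 1 (int \<mu>)"
    unfolding g1_def using hb by (intro lin_in_piece) (auto simp: hilbert_burch_def)
  have "g2 \<in> S_piece 1 (int (d - \<mu>))"
    unfolding g2_def using hb by (intro lin_in_piece) (auto simp: hilbert_burch_def)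
  then show "g2 \<in> S_piece 1 (int d - int \<mu>)" using mu_le by (simp add: of_nat_diff)
qed

lemma syzygy:
  assumes "(\<Sum>i\<in>UNIV. f $ i * s i) = 0"
  shows "\<exists>a b. \<forall>i. s i = a * \<phi> $ i $ 1 + b * \<phi> $ i $ 2"
proof -
  have "(\<chi> i. s i) \<in> range ((*v) \<phi>)"
    using hb assms by (simp add: hilbert_burch_def)
  then obtain c where "(\<chi> i. s i) = \<phi> *v c" by blast
  then have "s i = c $ 1 * \<phi> $ i $ 1 + c $ 2 * \<phi> $ i $ 2" for i
    by (simp add: vec_eq_iff matrix_vector_mult_def sum_2 mult.commute)
  then show ?thesis by blast
qed

lemma column_syzygies: "(\<Sum>i\<in>UNIV. f $ i * \<phi> $ i $ 1) = 0" "(\<Sum>i\<in>UNIV. f $ i * \<phi> $ i $ 2) = 0"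
proof -
  have "\<phi> *v c \<in> {c. (\<Sum>i\<in>UNIV. f $ i * c $ i) = 0}" for c
    using hb by (auto simp: hilbert_burch_def)
  from this[of "axis 1 1"] this[of "axis 2 1"]
  show "(\<Sum>i\<in>UNIV. f $ i * \<phi> $ i $ 1) = 0" "(\<Sum>i\<in>UNIV. f $ i * \<phi> $ i $ 2) = 0"
    by (simp_all add: matrix_vector_mult_def axis_def sum_2)
qed

lemma columns_independent:
  assumes "\<And>i. a * \<phi> $ i $ 1 + b * \<phi> $ i $ 2 = a' * \<phi> $ i $ 1 + b' * \<phi> $ i $ 2"
  shows "a = a' \<and> b = b'"
proof -
  have "\<phi> *v (\<chi> k. if k = 1 then a else b) = \<phi> *v (\<chi> k. if k = 1 then a' else b')"
    using assms by (simp add: vec_eq_iff matrix_vector_mult_def sum_2 mult.commute)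
  then have "(\<chi> k::2. if k = 1 then a else b) = (\<chi> k. if k = 1 then a' else b')"
    using hb by (auto simp only: hilbert_burch_def dest: injD)
  then have "(\<chi> k::2. if k = 1 then a else b) $ k = (\<chi> k. if k = 1 then a' else b') $ k" for k
    by simp
  from this[of 1] this[of 2] show ?thesis by simp
qed

lemma lin_syzygy:
  assumes "(\<Sum>i\<in>UNIV. f $ i * s i) = 0"
  shows "\<exists>a b. lin s = a * g1 + b * g2"
proof -
  obtain a b where "\<forall>i. s i = a * \<phi> $ i $ 1 + b * \<phi> $ i $ 2" using syzygy[OF assms] by blast
  then have "s = (\<lambda>i. a * \<phi> $ i $ 1 + b * \<phi> $ i $ 2)" by auto
  then have "lin s = pconst a * g1 + pconst b * g2"
    by (simp add: lin_add lin_scale g1_def g2_def)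
  then show ?thesis by blast
qed

lemma g_nz: "g1 \<noteq> 0" "g2 \<noteq> 0"
proof -
  show "g1 \<noteq> 0"
  proof
    assume "g1 = 0"
    then have "\<phi> $ i $ 1 = 0" for i
      using lookup_lin[of "\<lambda>i. \<phi> $ i $ 1" i] by (simp add: g1_def)
    then show False using columns_independent[of 1 0 0 0] by simp
  qed
  show "g2 \<noteq> 0"
  proof
    assume "g2 = 0"
    then have "\<phi> $ i $ 2 = 0" for i
      using lookup_lin[of "\<lambda>i. \<phi> $ i $ 2" i] by (simp add: g2_def)
    then show False using columns_independent[of 0 1 0 0] by simp
  qed
qed

text \<open>
  For \<open>h = \<Sum> c\<^sub>i f\<^sub>i\<close>, the vector \<open>h e\<^sub>j - f\<^sub>j c\<close> is a syzygy of \<open>f\<close>, so it equals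
  \<open>\<alpha>\<^sub>j \<phi>\<^sub>1 + \<beta>\<^sub>j \<phi>\<^sub>2\<close> for the columns \<open>\<phi>\<^sub>1, \<phi>\<^sub>2\<close> of \<open>\<phi>\<close>.  In other words, the matrix with columns
  \<open>f, \<alpha>, \<beta>\<close> times the matrix with rows \<open>c, \<phi>\<^sub>1, \<phi>\<^sub>2\<close> is \<open>h\<close> times the identity.  The linear
  substitutions \<open>\<sigma>\<close> and \<open>\<tau>\<close> given by these two matrices are therefore inverse to each other up to
  \<open>h\<close>, and they exchange \<open>g1, g2\<close> with the variables \<open>T\<^sub>2, T\<^sub>3\<close>.
\<close>

lemma coordinate_change:
  assumes "h \<in> I" "h \<noteq> 0"
  obtains \<sigma> \<tau> :: "'k spoly \<Rightarrow> 'k spoly" and \<alpha> \<beta> where "ring_map \<sigma>" "ring_map \<tau>"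
    "\<forall>s. \<tau> (\<sigma> s) = scale_vars h s"
    "\<sigma> g1 = pconst h * pvar 2" "\<sigma> g2 = pconst h * pvar 3" "\<tau> (pvar 2) = g1" "\<tau> (pvar 3) = g2"
    "\<sigma> = psubst pconst (\<lambda>j. pconst (f $ j) * pvar 1 + pconst (\<alpha> j) * pvar 2 + pconst (\<beta> j) * pvar 3)"
proof -
  obtain c where c: "h = (\<Sum>i\<in>UNIV. f $ i * c i)" using assms(1) unfolding I_iff by blast
  have "\<exists>a b. \<forall>i. (if i = j then h else 0) - f $ j * c i = a * \<phi> $ i $ 1 + b * \<phi> $ i $ 2" for j
  proof (rule syzygy)
    have "(\<Sum>i\<in>UNIV. f $ i * ((if i = j then h else 0) - f $ j * c i)) =
      (\<Sum>i\<in>UNIV. if i = j then f $ j * h else 0) - f $ j * (\<Sum>i\<in>UNIV. f $ i * c i)"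
      unfolding sum_distrib_left sum_subtractf[symmetric]
      by (intro sum.cong) (auto simp: algebra_simps)
    also have "\<dots> = 0" by (simp flip: c)
    finally show "(\<Sum>i\<in>UNIV. f $ i * ((if i = j then h else 0) - f $ j * c i)) = 0" .
  qed
  then obtain \<alpha> \<beta> where ab:
    "(if i = j then h else 0) - f $ j * c i = \<alpha> j * \<phi> $ i $ 1 + \<beta> j * \<phi> $ i $ 2" for i j
    by metis
  define \<sigma> :: "'k spoly \<Rightarrow> 'k spoly" where "\<sigma> = psubst pconst
    (\<lambda>j. pconst (f $ j) * pvar 1 + pconst (\<alpha> j) * pvar 2 + pconst (\<beta> j) * pvar 3)"
  define \<tau> :: "'k spoly \<Rightarrow> 'k spoly" where "\<tau> = psubst pconst
    (\<lambda>i. if i = 1 then lin (\<lambda>i. c i) else if i = 2 then g1 else g2)"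
  have \<sigma>: "ring_map \<sigma>" and \<tau>: "ring_map \<tau>"
    unfolding \<sigma>_def \<tau>_def by (intro psubst_ring_map pconst_ring_map)+
  interpret \<sigma>: ring_map \<sigma> by (rule \<sigma>)
  interpret \<tau>: ring_map \<tau> by (rule \<tau>)
  have \<sigma>_const: "\<sigma> (pconst r) = pconst r" and \<tau>_const: "\<tau> (pconst r) = pconst r" for r
    by (simp_all add: \<sigma>_def \<tau>_def psubst_pconst pconst_ring_map)
  have \<sigma>_var: "\<sigma> (pvar j) = pconst (f $ j) * pvar 1 + pconst (\<alpha> j) * pvar 2 + pconst (\<beta> j) * pvar 3" for j
    by (simp add: \<sigma>_def psubst_pvar pconst_ring_map)
  have \<tau>_var: "\<tau> (pvar 1) = lin (\<lambda>i. c i)" "\<tau> (pvar 2) = g1" "\<tau> (pvar 3) = g2"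
    by (simp_all add: \<tau>_def psubst_pvar pconst_ring_map)
  have "\<tau> (\<sigma> s) = scale_vars h s" for s
  proof (rule ring_map_eqI[OF ring_map_compose[OF \<sigma> \<tau>] scale_vars_ring_map, of s UNIV])
    fix j
    have "pconst (f $ j) * lin (\<lambda>i. c i) + pconst (\<alpha> j) * g1 + pconst (\<beta> j) * g2 =
      lin (\<lambda>i. f $ j * c i + (\<alpha> j * \<phi> $ i $ 1 + \<beta> j * \<phi> $ i $ 2))"
      by (simp add: lin_add lin_scale g1_def g2_def)
    also have "\<dots> = lin (\<lambda>i. if i = j then h else 0)"
      by (simp flip: ab)
    also have "\<dots> = pconst h * pvar j" by (rule lin_delta)
    finally show "\<tau> (\<sigma> (pvar j)) = scale_vars h (pvar j)"
      by (simp add: \<sigma>_var \<tau>.add \<tau>.mult \<tau>_const \<tau>_var scale_vars_def psubst_pvar pconst_ring_map)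
  qed (auto simp: \<sigma>_const \<tau>_const scale_vars_def psubst_pconst pconst_ring_map)
  \<comment> \<open>the other product of the two matrices, on a syzygy \<open>v\<close>; independence of the columns then makes it \<open>h\<close> times the identity\<close>
  moreover have column: "(\<Sum>j\<in>UNIV. v j * \<alpha> j) * \<phi> $ i $ 1 + (\<Sum>j\<in>UNIV. v j * \<beta> j) * \<phi> $ i $ 2 = h * v i"
    if v: "(\<Sum>i\<in>UNIV. f $ i * v i) = 0" for v :: "3 \<Rightarrow> 'k rpoly" and i
  proof -
    have "(\<Sum>j\<in>UNIV. v j * \<alpha> j) * \<phi> $ i $ 1 + (\<Sum>j\<in>UNIV. v j * \<beta> j) * \<phi> $ i $ 2 =
        (\<Sum>j\<in>UNIV. v j * (\<alpha> j * \<phi> $ i $ 1 + \<beta> j * \<phi> $ i $ 2))"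
      unfolding sum_distrib_right sum.distrib[symmetric]
      by (intro sum.cong) (auto simp: algebra_simps)
    also have "\<dots> = (\<Sum>j\<in>UNIV. v j * ((if i = j then h else 0) - f $ j * c i))"
      by (simp add: ab)
    also have "\<dots> = (\<Sum>j\<in>UNIV. if i = j then h * v i else 0) - (\<Sum>j\<in>UNIV. f $ j * v j) * c i"
      unfolding sum_distrib_right sum_subtractf[symmetric]
      by (intro sum.cong) (auto simp: algebra_simps)
    finally show ?thesis using v by simp
  qed
  have coeffs: "(\<Sum>j\<in>UNIV. \<phi> $ j $ 1 * \<alpha> j) = h \<and> (\<Sum>j\<in>UNIV. \<phi> $ j $ 1 * \<beta> j) = 0"
    "(\<Sum>j\<in>UNIV. \<phi> $ j $ 2 * \<alpha> j) = 0 \<and> (\<Sum>j\<in>UNIV. \<phi> $ j $ 2 * \<beta> j) = h"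
    by (rule columns_independent, simp add: column[OF column_syzygies(1)])
       (rule columns_independent, simp add: column[OF column_syzygies(2)])
  have \<sigma>_lin: "\<sigma> (lin v) = pconst (\<Sum>j\<in>UNIV. f $ j * v j) * pvar 1 +
      pconst (\<Sum>j\<in>UNIV. v j * \<alpha> j) * pvar 2 + pconst (\<Sum>j\<in>UNIV. v j * \<beta> j) * pvar 3" for v
    by (simp add: lin_def \<sigma>.sum \<sigma>.mult \<sigma>_const \<sigma>_var pconst.sum pconst.mult sum_distrib_left
        sum_distrib_right sum.distrib algebra_simps)
  have "\<sigma> g1 = pconst h * pvar 2" "\<sigma> g2 = pconst h * pvar 3"
    by (simp_all add: g1_def g2_def \<sigma>_lin coeffs column_syzygies)
  ultimately show ?thesis
    using that[OF \<sigma> \<tau> _ _ _ _ _ \<sigma>_def] \<tau>_var by blast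
qed

text \<open>
  In the new coordinates the assumption reads \<open>\<sigma>(a) T\<^sub>2 + \<sigma>(b) T\<^sub>3 = 0\<close>, so \<open>T\<^sub>3\<close> divides \<open>\<sigma>(a)\<close>.
\<close>

lemma scale_koszul:
  assumes "h \<in> I" "h \<noteq> 0" and rel: "a * g1 + b * g2 = 0"
  shows "\<exists>c. scale_vars h a = c * g2"
proof -
  obtain \<sigma> \<tau> :: "'k spoly \<Rightarrow> 'k spoly" and \<alpha> \<beta> where maps: "ring_map \<sigma>" "ring_map \<tau>" "\<forall>s. \<tau> (\<sigma> s) = scale_vars h s"
    "\<sigma> g1 = pconst h * pvar 2" "\<sigma> g2 = pconst h * pvar 3" "\<tau> (pvar 2) = g1" "\<tau> (pvar 3) = g2"
    "\<sigma> = psubst pconst (\<lambda>j. pconst (f $ j) * pvar 1 + pconst (\<alpha> j) * pvar 2 + pconst (\<beta> j) * pvar 3)"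
    by (rule coordinate_change[OF assms(1,2)])
  interpret \<sigma>: ring_map \<sigma> by fact
  interpret \<tau>: ring_map \<tau> by fact
  have "\<sigma> (a * g1 + b * g2) = 0" using rel by simp
  then have "\<sigma> a * (pconst h * pvar 2) + \<sigma> b * (pconst h * pvar 3) = 0"
    by (simp only: \<sigma>.add \<sigma>.mult maps(4,5))
  then have "pconst h * (pvar 2 * \<sigma> a + pvar 3 * \<sigma> b) = 0"
    by (simp only: distrib_left mult.left_commute mult.commute[of "\<sigma> _"] mult.assoc)
  then have "pvar 2 * \<sigma> a + pvar 3 * \<sigma> b = 0" using assms(2) by simp
  then have "pvar 2 * \<sigma> a = pvar 3 * (- \<sigma> b)" by (simp add: add_eq_0_iff2)
  then have "pvar 3 dvd pvar 2 * \<sigma> a" by simp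
  then have "pvar 3 dvd \<sigma> a" by (rule pvar_dvd_mult_pvar[rotated]) simp
  then obtain c where "\<sigma> a = pvar 3 * c" by (auto simp: dvd_def)
  then have "\<tau> (\<sigma> a) = g2 * \<tau> c" by (simp add: \<tau>.mult maps(7))
  then show ?thesis unfolding maps(3)[rule_format] by (metis mult.commute)
qed

text \<open>
  Modulo \<open>T\<^sub>2, T\<^sub>3\<close> the substitution \<open>\<sigma>\<close> becomes \<open>T\<^sub>j \<mapsto> f\<^sub>j T\<^sub>1\<close>, which is the map to the Rees algebra
  with \<open>t = T\<^sub>1\<close> and kills \<open>F\<close>.  So \<open>\<sigma>(F)\<close> lies in \<open>(T\<^sub>2, T\<^sub>3)\<close>, which \<open>\<tau>\<close> maps into \<open>(g1, g2)\<close>.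
\<close>

lemma scale_rees:
  assumes "h \<in> I" "h \<noteq> 0" and F: "rees_eval f F = 0"
  shows "\<exists>a b. scale_vars h F = a * g1 + b * g2"
proof -
  obtain \<sigma> \<tau> :: "'k spoly \<Rightarrow> 'k spoly" and \<alpha> \<beta> where maps: "ring_map \<sigma>" "ring_map \<tau>" "\<forall>s. \<tau> (\<sigma> s) = scale_vars h s"
    "\<sigma> g1 = pconst h * pvar 2" "\<sigma> g2 = pconst h * pvar 3" "\<tau> (pvar 2) = g1" "\<tau> (pvar 3) = g2"
    "\<sigma> = psubst pconst (\<lambda>j. pconst (f $ j) * pvar 1 + pconst (\<alpha> j) * pvar 2 + pconst (\<beta> j) * pvar 3)"
    by (rule coordinate_change[OF assms(1,2)])
  interpret \<sigma>: ring_map \<sigma> by fact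
  interpret \<tau>: ring_map \<tau> by fact
  let ?J = "{a * pvar 2 + b * pvar 3 |a b :: 'k spoly. True}"
  let ?\<rho> = "\<lambda>s. poly (map_poly pconst (rees_eval f s)) (pvar 1) :: 'k spoly"
  have \<rho>: "ring_map ?\<rho>"
    by (rule ring_map_compose[OF rees_eval_ring_map poly_map_poly_pconst_ring_map])
  have "\<sigma> F \<in> UNIV \<and> ?\<rho> F \<in> UNIV \<and> \<sigma> F - ?\<rho> F \<in> ?J"
  proof (rule ring_map_cong_mod[OF maps(1) \<rho>, where V = UNIV])
    show "x + y \<in> ?J" if "x \<in> ?J" "y \<in> ?J" for x y using that by (rule two_generated_closed)
    show "x * y \<in> ?J" if "y \<in> ?J" for x y using that by (rule two_generated_closed)
  next
    fix c
    have "\<sigma> (pconst c) - ?\<rho> (pconst c) = 0 * pvar 2 + 0 * pvar 3"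
      by (simp add: maps(8) psubst_pconst pconst_ring_map rees_eval_pconst map_poly_pCons)
    then show "\<sigma> (pconst c) \<in> UNIV \<and> ?\<rho> (pconst c) \<in> UNIV \<and> \<sigma> (pconst c) - ?\<rho> (pconst c) \<in> ?J" by blast
  next
    fix v
    have "\<sigma> (pvar v) - ?\<rho> (pvar v) = pconst (\<alpha> v) * pvar 2 + pconst (\<beta> v) * pvar 3"
      by (simp add: maps(8) psubst_pvar pconst_ring_map rees_eval_def const_poly_ring_map
          map_poly_monom poly_monom)
    then show "\<sigma> (pvar v) \<in> UNIV \<and> ?\<rho> (pvar v) \<in> UNIV \<and> \<sigma> (pvar v) - ?\<rho> (pvar v) \<in> ?J" by blast
  qed auto
  then obtain a b where "\<sigma> F = a * pvar 2 + b * pvar 3" using F by auto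
  then have "\<tau> (\<sigma> F) = \<tau> a * g1 + \<tau> b * g2" by (simp add: \<tau>.add \<tau>.mult maps(6,7))
  then show ?thesis unfolding maps(3)[rule_format] by blast
qed

end

section \<open>Height two and powers of the variables\<close>

text \<open>
  A nonzero element of minimal degree in the ideal generated by the \<open>F i\<close> divides all of them; if it is not
  constant, then a nonconstant common divisor of minimal degree is irreducible, hence prime.
\<close>

lemma field_poly_unit_or_common_prime:
  fixes F :: "'i::finite \<Rightarrow> 'k::field poly"
  shows "(\<exists>a. (\<Sum>i\<in>UNIV. a i * F i) = 1) \<or> (\<exists>q. prime_elem q \<and> (\<forall>i. q dvd F i))"
proof -
  let ?A = "{p. \<exists>a. p = (\<Sum>i\<in>UNIV. a i * F i)}"
  let ?common = "\<lambda>q. degree q > 0 \<and> (\<forall>i. q dvd F i)"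
  have A_diff: "p - s * q \<in> ?A" if "p \<in> ?A" "q \<in> ?A" for p q s
  proof -
    obtain a where a: "p = (\<Sum>i\<in>UNIV. a i * F i)" using \<open>p \<in> ?A\<close> by auto
    obtain b where b: "q = (\<Sum>i\<in>UNIV. b i * F i)" using \<open>q \<in> ?A\<close> by auto
    from a b have "p - s * q = (\<Sum>i\<in>UNIV. (a i - s * b i) * F i)"
      by (simp add: sum_distrib_left sum_subtractf left_diff_distrib mult.assoc)
    then show ?thesis by (intro CollectI exI)
  qed
  have F_A: "F i \<in> ?A" for i
  proof -
    have "(\<Sum>j\<in>UNIV. (if j = i then 1 else 0) * F j) = (\<Sum>j\<in>UNIV. if j = i then F i else 0)"
      by (intro sum.cong) auto
    then have "F i = (\<Sum>j\<in>UNIV. (if j = i then 1 else 0) * F j)" by simp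
    then show ?thesis by (intro CollectI exI)
  qed
  have "(\<exists>a. (\<Sum>i\<in>UNIV. a i * F i) = 1) \<or> (\<exists>q. ?common q)"
  proof (cases "\<forall>i. F i = 0")
    case True
    then have "?common [:0, 1:]" by simp
    then show ?thesis by blast
  next
    case False
    then obtain i where i: "F i \<noteq> 0" by blast
    have "F i \<in> ?A \<and> F i \<noteq> 0" using i F_A[of i] by simp
    from ex_has_least_nat[of "\<lambda>p. p \<in> ?A \<and> p \<noteq> 0", OF this, of degree]
    obtain r where r': "(r \<in> ?A \<and> r \<noteq> 0) \<and> (\<forall>p. p \<in> ?A \<and> p \<noteq> 0 \<longrightarrow> degree r \<le> degree p)" ..
    then have r: "r \<in> ?A" "r \<noteq> 0" by simp_all
    have least: "degree r \<le> degree p" if "p \<in> ?A" "p \<noteq> 0" for p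
      using r' that by simp
    have dvd: "r dvd F i" for i
    proof -
      have "F i - (F i div r) * r \<in> ?A" by (rule A_diff[OF F_A r(1)])
      then have "F i mod r \<in> ?A" by (simp add: minus_div_mult_eq_mod)
      then have "F i mod r = 0" using least degree_mod_less'[OF r(2), of "F i"] by fastforce
      then show ?thesis by (simp add: dvd_eq_mod_eq_0)
    qed
    show ?thesis
    proof (cases "degree r > 0")
      case True
      with dvd show ?thesis by blast
    next
      case False
      then obtain c where c: "r = [:c:]" by (auto elim: degree_eq_zeroE)
      obtain a where "r = (\<Sum>i\<in>UNIV. a i * F i)" using r by blast
      then have "[:inverse c:] * r = (\<Sum>i\<in>UNIV. ([:inverse c:] * a i) * F i)"
        by (simp add: sum_distrib_left mult.assoc)
      moreover have "[:inverse c:] * r = 1" using r(2) c by (simp add: one_pCons)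
      ultimately show ?thesis by metis
    qed
  qed
  moreover have "\<exists>q. prime_elem q \<and> (\<forall>i. q dvd F i)" if "?common q0" for q0
  proof -
    from ex_has_least_nat[of ?common, OF that, of degree]
    obtain q where q': "?common q \<and> (\<forall>p. ?common p \<longrightarrow> degree q \<le> degree p)" ..
    then have q: "?common q" by blast
    have least: "degree q \<le> degree p" if "?common p" for p
      using q' that by blast
    have "irreducible q"
    proof (rule irreducibleI)
      show "q \<noteq> 0" using q by auto
      show "\<not> q dvd 1" using q by (auto simp: is_unit_poly_iff)
      fix a b assume ab: "q = a * b"
      then have nz: "a \<noteq> 0" "b \<noteq> 0" using q by auto
      show "a dvd 1 \<or> b dvd 1"
      proof (rule ccontr)
        assume "\<not> (a dvd 1 \<or> b dvd 1)"
        then have deg: "degree a > 0" "degree b > 0" using nz by (auto simp: is_unit_iff_degree)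
        have "a dvd F i" for i
          using q ab by (metis dvd_mult_left)
        then have "degree q \<le> degree a" using deg by (intro least) blast
        then show False using deg nz by (simp add: ab degree_mult_eq)
      qed
    qed
    then show ?thesis using q field_poly_irreducible_imp_prime by blast
  qed
  ultimately show ?thesis by blast
qed

lemma prime_height_ge_2_chain:
  assumes "2 \<le> prime_height A P" "primeideal P A"
  obtains Q r where "primeideal Q A" "Q \<subset> P" "r \<in> Q" "r \<noteq> \<zero>\<^bsub>A\<^esub>"
proof -
  let ?C = "\<lambda>n. \<exists>c :: nat \<Rightarrow> 'a set. (\<forall>i\<le>n. primeideal (c i) A) \<and> (\<forall>i<n. c i \<subset> c (Suc i)) \<and> c n = P"
  have "\<exists>n\<ge>2. ?C n"
  proof (rule ccontr)
    assume "\<not> ?thesis"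
    have *: "n \<le> 1" if "?C n" for n
    proof (rule ccontr)
      assume "\<not> n \<le> 1"
      then have "n \<ge> 2" by simp
      with that \<open>\<not> (\<exists>n\<ge>2. ?C n)\<close> show False by blast
    qed
    have "prime_height A P \<le> enat 1"
      unfolding prime_height_def
    proof (rule Sup_least)
      fix x assume "x \<in> {enat n |n. ?C n}"
      then obtain n where "x = enat n" "?C n" by auto
      then show "x \<le> enat 1" using *[of n] by simp
    qed
    with assms(1) have "2 \<le> enat 1" by (rule order_trans)
    then show False by (simp add: numeral_eq_enat)
  qed
  then obtain n c where n: "n \<ge> 2" and c: "\<And>i. i \<le> n \<Longrightarrow> primeideal (c i) A"
    "\<And>i. i < n \<Longrightarrow> c i \<subset> c (Suc i)" "c n = P" by blast
  from n have n': "Suc (n - 1) = n" "Suc (n - 2) = n - 1" by auto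
  have sub: "c (n - 1) \<subset> P" "c (n - 2) \<subset> c (n - 1)"
    using c(2)[of "n - 1"] c(2)[of "n - 2"] n n' c(3) by auto
  then obtain r where r: "r \<in> c (n - 1)" "r \<notin> c (n - 2)" by blast
  interpret primeideal "c (n - 2)" A using c(1)[of "n - 2"] by simp
  have "r \<noteq> \<zero>\<^bsub>A\<^esub>" using r(2) additive_subgroup.zero_closed[OF additive_subgroup_axioms] by blast
  moreover have "primeideal (c (n - 1)) A" using c(1)[of "n - 1"] by simp
  ultimately show ?thesis using that sub(1) r(1) by blast
qed

lemma ring_of_type_algebra_simps [simp]:
  "carrier (ring_of_type_algebra :: 'a::comm_ring_1 ring) = UNIV"
  "\<zero>\<^bsub>ring_of_type_algebra\<^esub> = (0 :: 'a)" "\<one>\<^bsub>ring_of_type_algebra\<^esub> = (1 :: 'a)"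
  "a \<oplus>\<^bsub>ring_of_type_algebra\<^esub> b = (a + b :: 'a)"
  "a \<otimes>\<^bsub>ring_of_type_algebra\<^esub> b = (a * b :: 'a)"
  by (simp_all add: ring_of_type_algebra_def)

lemma subgroup_type_algebra:
  fixes H :: "'a::comm_ring_1 set"
  assumes "0 \<in> H" "\<And>x y. x \<in> H \<Longrightarrow> y \<in> H \<Longrightarrow> x + y \<in> H" "\<And>x. x \<in> H \<Longrightarrow> - x \<in> H"
  shows "subgroup H (add_monoid ring_of_type_algebra)"
proof -
  interpret R: cring "ring_of_type_algebra :: 'a ring" by (rule cring_from_type_algebra)
  have "inv\<^bsub>add_monoid ring_of_type_algebra\<^esub> x = - x" for x :: 'a
    using R.minus_equality[of "- x" x] by (simp only: a_inv_def) simp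
  then show ?thesis
    using assms by (intro subgroup.intro) auto
qed

lemma primeideal_type_algebraD:
  assumes "primeideal Q (ring_of_type_algebra :: 'a::comm_ring_1 ring)"
  shows "a \<in> Q \<Longrightarrow> b * a \<in> Q" "a * b \<in> Q \<Longrightarrow> a \<in> Q \<or> b \<in> Q" "1 \<notin> Q"
proof -
  interpret primeideal Q ring_of_type_algebra by (rule assms)
  show *: "a \<in> Q \<Longrightarrow> b * a \<in> Q" for a b using I_l_closed[of a b] by simp
  show "a * b \<in> Q \<Longrightarrow> a \<in> Q \<or> b \<in> Q" using I_prime[of a b] by simp
  show "1 \<notin> Q"
  proof
    assume "1 \<in> Q"
    then have "Q = UNIV" using *[of 1] by auto
    then show False using I_notcarr by simp
  qed
qed

lemma UNIV_two_distinct: "v \<noteq> w \<Longrightarrow> (UNIV :: 2 set) = {v, w}"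
  using exhaust_2 by (metis (full_types) UNIV_2 insert_commute)

text \<open>
  The substitution \<open>x\<^sub>v \<mapsto> t\<close>, \<open>x\<^sub>w \<mapsto> x t\<close> into \<open>K[x][t]\<close>, where \<open>w\<close> is the other index.  A form of degree
  \<open>e\<close> becomes its dehomogenization times \<open>t\<^sup>e\<close>, and inverting \<open>x\<^sub>v\<close> makes the map an isomorphism onto
  \<open>K[x][t, 1/t]\<close>.  This replaces homogenization and unique factorization in \<open>R\<close> by divisibility by
  constants of \<open>K[x][t]\<close>.
\<close>

definition blowup_chart :: "2 \<Rightarrow> 'k::field rpoly \<Rightarrow> 'k poly poly" where
  "blowup_chart v = psubst (\<lambda>c. [:[:c:]:])
     (\<lambda>u. Polynomial.monom (if u = v then 1 else [:0, 1:]) 1)"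

lemma const_poly2_ring_map: "ring_map (\<lambda>c::'k::field. [:[:c:]:])"
  by unfold_locales (auto simp: one_pCons)

lemma blowup_chart_ring_map: "ring_map (blowup_chart v)"
  unfolding blowup_chart_def by (intro psubst_ring_map const_poly2_ring_map)

lemma monom_power': "Polynomial.monom (a :: 'a::comm_semiring_1) 1 ^ n = Polynomial.monom (a ^ n) n"
  by (induction n) (auto simp: mult_monom)

lemma blowup_chart_single:
  assumes "v \<noteq> w"
  shows "blowup_chart v (single m c) =
    Polynomial.monom (Polynomial.monom c (lookup m w))
      (lookup m v + lookup m w)"
proof -
  have *: "([:0, 1:] :: 'a poly) ^ n = Polynomial.monom 1 n" for n
    by (simp add: monom_altdef)
  have "monom_at (\<lambda>u. Polynomial.monom (if u = v then 1 else [:0, 1:]) 1) m =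
     (\<Prod>u\<in>{v, w}. Polynomial.monom (if u = v then 1 else [:0, 1 :: 'a:]) 1 ^ lookup m u)"
    using UNIV_two_distinct[OF assms] by (intro monom_at_superset) auto
  also have "\<dots> = Polynomial.monom (Polynomial.monom 1 (lookup m w))
      (lookup m v + lookup m w)"
    using assms by (simp add: monom_power'[simplified] mult_monom *)
  finally show ?thesis
    by (simp add: blowup_chart_def psubst_single const_poly2_ring_map smult_monom)
qed

text \<open>
  The exponents of \<open>x\<close> and \<open>t\<close> determine the original monomial, so the map is injective.
\<close>

lemma coeff_blowup_chart:
  assumes "v \<noteq> w"
  shows "Polynomial.coeff (Polynomial.coeff (blowup_chart v r)
    (lookup m v + lookup m w)) (lookup m w) =
    lookup r m"
proof (induction r rule: poly_mapping_sum_induct)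
  case zero
  then show ?case by (simp add: ring_map.zero[OF blowup_chart_ring_map])
next
  case (single m' c)
  have "m' = m" if "lookup m' w = lookup m w"
    "lookup m' v = lookup m v"
  proof (rule poly_mapping_eqI)
    fix u show "lookup m' u = lookup m u"
      using that UNIV_two_distinct[OF assms] by (cases "u = v") auto
  qed
  then show ?case
    by (auto simp: blowup_chart_single[OF assms] lookup_single when_def)
next
  case (add p q)
  then show ?case by (simp add: ring_map.add[OF blowup_chart_ring_map] lookup_add)
qed

lemma blowup_chart_inj: "blowup_chart v r = blowup_chart v s \<Longrightarrow> r = s"
proof (rule poly_mapping_eqI)
  fix m assume *: "blowup_chart v r = blowup_chart v s"
  obtain w where "v \<noteq> w" by (metis zero_neq_one)
  then show "lookup r m = lookup s m"
    using coeff_blowup_chart[of v w r m] coeff_blowup_chart[of v w s m] * by simp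
qed

lemma blowup_chart_homogeneous:
  assumes "homogeneous e r"
  shows "\<exists>p. blowup_chart v r = Polynomial.monom p e"
proof -
  obtain w where vw: "v \<noteq> w" by (metis zero_neq_one)
  have deg: "mon_degree m = lookup m v + lookup m w" for m
    unfolding mon_degree_def UNIV_two_distinct[OF vw] using vw by simp
  have "\<forall>m\<in>keys r. mon_degree m = e" using assms by (simp add: homogeneous_def)
  then show ?thesis
  proof (induction r rule: poly_mapping_restricted_induct)
    case zero
    show ?case by (rule exI[of _ 0]) (simp add: ring_map.zero[OF blowup_chart_ring_map])
  next
    case (single m c)
    then show ?case by (auto simp: blowup_chart_single[OF vw] deg)
  next
    case (add p q)
    then obtain a b where "blowup_chart v p = Polynomial.monom a e" "blowup_chart v q = Polynomial.monom b e"
      by blast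
    then have "blowup_chart v (p + q) = Polynomial.monom (a + b) e"
      by (simp add: ring_map.add[OF blowup_chart_ring_map] add_monom)
    then show ?case by blast
  qed
qed

lemma blowup_chart_pvar: "blowup_chart v (pvar v) = Polynomial.monom 1 1"
  by (simp add: blowup_chart_def psubst_pvar const_poly2_ring_map)

lemma blowup_chart_pvar_power: "blowup_chart v (pvar v ^ n) = Polynomial.monom 1 1 ^ n"
  by (simp add: ring_map.power[OF blowup_chart_ring_map] blowup_chart_pvar)

text \<open>
  The elements that satisfy the claim form a subring, and it contains the generators of \<open>K[x][t]\<close>
  because \<open>x t\<close> and \<open>t\<close> are values of the map.
\<close>

lemma blowup_chart_range:
  "\<exists>N r. blowup_chart v r = P * Polynomial.monom 1 1 ^ N"
proof -
  interpret b: ring_map "blowup_chart v" by (rule blowup_chart_ring_map)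
  let ?t = "Polynomial.monom (1 :: 'a poly) 1"
  let ?good = "\<lambda>P. \<exists>N r. blowup_chart v r = P * ?t ^ N"
  obtain w where vw: "w \<noteq> v" by (metis zero_neq_one)
  have add: "?good (P + Q)" if "?good P" "?good Q" for P Q
  proof -
    obtain N r where r: "blowup_chart v r = P * ?t ^ N" using \<open>?good P\<close> by blast
    obtain M s where "blowup_chart v s = Q * ?t ^ M" using \<open>?good Q\<close> by blast
    with r have "blowup_chart v (r * pvar v ^ M + s * pvar v ^ N) = (P + Q) * ?t ^ (N + M)"
      by (simp add: b.add b.mult blowup_chart_pvar_power algebra_simps power_add)
    then show ?thesis by blast
  qed
  have mult: "?good (P * Q)" if "?good P" "?good Q" for P Q
  proof -
    obtain N r where r: "blowup_chart v r = P * ?t ^ N" using \<open>?good P\<close> by blast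
    obtain M s where "blowup_chart v s = Q * ?t ^ M" using \<open>?good Q\<close> by blast
    with r have "blowup_chart v (r * s) = (P * Q) * ?t ^ (N + M)"
      by (simp add: b.mult algebra_simps power_add)
    then show ?thesis by blast
  qed
  have const: "?good [:[:c:]:]" for c
  proof -
    have "blowup_chart v (pconst c) = [:[:c:]:] * ?t ^ 0"
      by (simp add: blowup_chart_def psubst_pconst const_poly2_ring_map)
    then show ?thesis by blast
  qed
  have x: "?good [:[:0, 1:]:]"
  proof -
    have "blowup_chart v (pvar w) = [:[:0, 1:]:] * ?t ^ 1"
      using vw by (simp add: blowup_chart_def psubst_pvar const_poly2_ring_map smult_monom)
    then show ?thesis by blast
  qed
  have t: "?good ?t"
  proof -
    have "blowup_chart v (pvar v) = ?t * ?t ^ 0" by (simp add: blowup_chart_pvar)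
    then show ?thesis by blast
  qed
  have inner: "?good [:p:]" for p
  proof (induction p)
    case 0
    then show ?case using const[of 0] by simp
  next
    case (pCons c p)
    have "[:pCons c p:] = [:[:c:]:] + [:[:0, 1:]:] * [:p:]" by simp
    then show ?case using add[OF const mult[OF x pCons(2)]] by metis
  qed
  show "?good P"
  proof (induction P)
    case 0
    then show ?case using const[of 0] by simp
  next
    case (pCons p P)
    have "pCons p P = [:p:] + ?t * P" by (simp add: monom_altdef)
    then show ?case using add[OF inner mult[OF t pCons(2)]] by metis
  qed
qed

lemma const_poly_max_power:
  fixes q :: "'k::field poly" and P :: "'k poly poly"
  assumes "degree q > 0" "P \<noteq> 0"
  obtains k P' where "P = [:q:] ^ k * P'" "\<not> [:q:] dvd P'"
proof -
  obtain n where n: "Polynomial.coeff P n \<noteq> 0" using assms(2) by (meson leading_coeff_neq_0)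
  have bound: "k \<le> degree (Polynomial.coeff P n)" if "[:q:] ^ k dvd P" for k
  proof -
    have "[:q:] ^ k = [:q ^ k:]" by (induction k) (auto simp: one_pCons)
    then have "q ^ k dvd Polynomial.coeff P n" using that by (simp add: const_poly_dvd_iff)
    then have "degree (q ^ k) \<le> degree (Polynomial.coeff P n)" using n by (rule dvd_imp_degree_le)
    then have "k * degree q \<le> degree (Polynomial.coeff P n)"
      using assms(1) by (subst (asm) degree_power_eq) auto
    then show ?thesis using assms(1) by (metis Suc_leI le_trans mult.right_neutral mult_le_mono2 One_nat_def)
  qed
  define k where "k = (GREATEST k. [:q:] ^ k dvd P)"
  have "[:q:] ^ k dvd P"
    unfolding k_def by (rule GreatestI_nat[where k = 0 and b = "degree (Polynomial.coeff P n)"]) (use bound in auto)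
  then obtain P' where P': "P = [:q:] ^ k * P'" by (auto simp: dvd_def)
  have "\<not> [:q:] dvd P'"
  proof
    assume "[:q:] dvd P'"
    then have "[:q:] ^ Suc k dvd P" by (auto simp: P' dvd_def mult.assoc)
    then have "Suc k \<le> k"
      unfolding k_def by (rule Greatest_le_nat) (rule bound)
    then show False by simp
  qed
  with P' that show ?thesis by blast
qed

context
  fixes v :: 2 and q :: "'k::field poly"
  assumes q: "prime_elem q"
begin

text \<open>
  The homogeneous prime ideal of the point \<open>q = 0\<close> of the projective line.
\<close>

definition curve_prime :: "'k rpoly set" where
  "curve_prime = {r. [:q:] dvd blowup_chart v r}"

lemma const_q_prime: "prime_elem [:q:]"
  using q by (rule lift_prime_elem_poly)

lemma const_q_not_dvd_t: "\<not> [:q:] dvd Polynomial.monom 1 1 ^ n"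
proof
  assume "[:q:] dvd Polynomial.monom 1 1 ^ n"
  then have "[:q:] dvd Polynomial.monom 1 n" by (simp add: monom_power'[simplified])
  then have "q dvd Polynomial.coeff (Polynomial.monom 1 n) n" by (simp only: const_poly_dvd_iff)
  then show False using q by (simp add: prime_elem_def)
qed

lemma pvar_power_not_in_curve_prime: "pvar v ^ n \<notin> curve_prime"
  using const_q_not_dvd_t by (simp add: curve_prime_def blowup_chart_pvar_power)

lemma curve_prime_primeideal: "primeideal curve_prime ring_of_type_algebra"
proof (rule primeidealI)
  interpret b: ring_map "blowup_chart v" by (rule blowup_chart_ring_map)
  show "cring (ring_of_type_algebra :: 'k rpoly ring)" by (rule cring_from_type_algebra)
  show "ideal curve_prime ring_of_type_algebra"
    by (intro idealI subgroup_type_algebra ring_from_type_algebra)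
       (auto simp: curve_prime_def b.add b.mult b.uminus)
  show "carrier ring_of_type_algebra \<noteq> curve_prime"
    using pvar_power_not_in_curve_prime[of 1] by auto
  show "a \<in> curve_prime \<or> b \<in> curve_prime"
    if "a \<otimes>\<^bsub>ring_of_type_algebra\<^esub> b \<in> curve_prime" for a b
    using that const_q_prime by (simp add: curve_prime_def b.mult prime_elem_dvd_mult_iff)
qed

text \<open>
  The prime ideal is principal up to powers of \<open>x\<^sub>v\<close>, generated by the homogenization \<open>qh\<close> of \<open>q\<close>.
  A nonzero prime \<open>Q\<close> below it contains an element of the form \<open>qh\<^sup>k r'\<close> with \<open>r'\<close> outside the prime,
  so it contains \<open>qh\<close> and is equal to it.
\<close>

lemma curve_prime_height: "\<not> 2 \<le> prime_height ring_of_type_algebra curve_prime"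
proof
  assume "2 \<le> prime_height ring_of_type_algebra curve_prime"
  then obtain Q r where Q: "primeideal Q ring_of_type_algebra" "Q \<subset> curve_prime"
    and r: "r \<in> Q" "r \<noteq> 0"
    by (rule prime_height_ge_2_chain) (auto intro: curve_prime_primeideal)
  interpret b: ring_map "blowup_chart v" by (rule blowup_chart_ring_map)
  note Q_mult = primeideal_type_algebraD(1)[OF Q(1)] and Q_prime = primeideal_type_algebraD(2)[OF Q(1)]
  let ?t = "Polynomial.monom (1 :: 'k poly) 1"
  have Q_power: "a \<in> Q" if "a ^ n \<in> Q" for a n
    using that primeideal_type_algebraD(3)[OF Q(1)]
    by (induction n) (auto dest: Q_prime)
  have deg: "degree q > 0"
    using q by (auto simp: prime_elem_def is_unit_iff_degree)
  have "blowup_chart v r \<noteq> 0" using blowup_chart_inj[of v r 0] r by auto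
  from const_poly_max_power[OF deg this] obtain k P' where
    P': "blowup_chart v r = [:q:] ^ k * P'" "\<not> [:q:] dvd P'" .
  obtain N qh where qh: "blowup_chart v qh = [:q:] * ?t ^ N" using blowup_chart_range by blast
  obtain M r' where r': "blowup_chart v r' = P' * ?t ^ M" using blowup_chart_range by blast
  have "blowup_chart v (pvar v ^ (M + N * k) * r) = blowup_chart v (qh ^ k * r')"
    unfolding b.mult b.power blowup_chart_pvar P' qh r' power_mult_distrib power_add power_mult
    by (simp only: mult_ac)
  then have "pvar v ^ (M + N * k) * r = qh ^ k * r'" by (rule blowup_chart_inj)
  then have "qh ^ k * r' \<in> Q" using Q_mult[OF r(1)] by metis
  moreover have "r' \<notin> Q"
  proof
    assume "r' \<in> Q"
    then have "[:q:] dvd P' * ?t ^ M" using Q(2) r' by (auto simp: curve_prime_def)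
    then show False
      using P'(2) const_q_not_dvd_t const_q_prime by (simp add: prime_elem_dvd_mult_iff)
  qed
  ultimately have "qh \<in> Q" using Q_prime Q_power by blast
  have "s \<in> Q" if "s \<in> curve_prime" for s
  proof -
    obtain s' where s': "blowup_chart v s = [:q:] * s'"
      using \<open>s \<in> curve_prime\<close> by (auto simp: curve_prime_def dvd_def)
    obtain L s'' where s'': "blowup_chart v s'' = s' * ?t ^ L" using blowup_chart_range by blast
    have "blowup_chart v (pvar v ^ (L + N) * s) = blowup_chart v (s'' * qh)"
      by (simp add: b.mult b.power blowup_chart_pvar s' s'' qh power_add mult_ac)
    then have "pvar v ^ (L + N) * s = s'' * qh" by (rule blowup_chart_inj)
    then have "pvar v ^ (L + N) * s \<in> Q" using Q_mult[OF \<open>qh \<in> Q\<close>] by metis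
    moreover have "pvar v ^ (L + N) \<notin> Q" using pvar_power_not_in_curve_prime Q(2) by blast
    ultimately show ?thesis using Q_prime by blast
  qed
  then show False using Q(2) by blast
qed

end

text \<open>
  If the dehomogenized generators had a common prime factor \<open>q\<close>, then \<open>I\<close> would be contained in the
  height one prime of \<open>q\<close>.  So they generate the unit ideal of \<open>K[x]\<close>, and homogenizing an equation
  \<open>\<Sum> a\<^sub>i f\<^sub>i(x, 1) = 1\<close> writes a power of \<open>x\<^sub>v\<close> as a combination of the \<open>f\<^sub>i\<close>.
\<close>

lemma (in hilbert_burch_ideal) pvar_power_in_ideal:
  assumes height: "ideal_height ring_of_type_algebra I = 2"
  shows "\<exists>N. pvar v ^ N \<in> I"
proof -
  interpret b: ring_map "blowup_chart v :: 'k rpoly \<Rightarrow> _" by (rule blowup_chart_ring_map)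
  have "\<forall>i. \<exists>p. blowup_chart v (f $ i) = Polynomial.monom p d"
    using hom blowup_chart_homogeneous by blast
  from choice[OF this] obtain F where F: "\<And>i. blowup_chart v (f $ i) = Polynomial.monom (F i) d"
    by blast
  have "\<not> (prime_elem q \<and> (\<forall>i. q dvd F i))" for q
  proof
    assume q: "prime_elem q \<and> (\<forall>i. q dvd F i)"
    have "[:q:] dvd Polynomial.monom (F i) d" for i
      using q by (simp add: const_poly_dvd_iff)
    then have "I \<subseteq> curve_prime v q"
      using q by (auto simp: curve_prime_def I_iff b.sum b.mult F intro!: dvd_sum)
    then have "ideal_height ring_of_type_algebra I \<le> prime_height ring_of_type_algebra (curve_prime v q)"
      unfolding ideal_height_def using q by (intro Inf_lower) (auto intro: curve_prime_primeideal)
    then show False using height curve_prime_height q by metis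
  qed
  then obtain a where a: "(\<Sum>i\<in>UNIV. a i * F i) = 1"
    using field_poly_unit_or_common_prime[of F] by blast
  let ?t = "Polynomial.monom (1 :: 'k poly) 1"
  have "\<forall>i. \<exists>N. \<exists>r. blowup_chart v r = [:a i:] * ?t ^ N"
    using blowup_chart_range by blast
  from choice[OF this] obtain N where "\<forall>i. \<exists>r. blowup_chart v r = [:a i:] * ?t ^ N i" ..
  from choice[OF this] obtain r where r: "\<And>i. blowup_chart v (r i) = [:a i:] * ?t ^ N i"
    by blast
  define M where "M = (\<Sum>i\<in>UNIV. N i)"
  define s where "s i = r i * pvar v ^ (M - N i)" for i
  have s: "blowup_chart v (s i) = [:a i:] * ?t ^ M" for i
  proof -
    have "N i \<le> M" unfolding M_def by (rule member_le_sum) auto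
    then show ?thesis
      by (simp add: s_def b.mult r blowup_chart_pvar_power mult.assoc flip: power_add)
  qed
  have "blowup_chart v (\<Sum>i\<in>UNIV. f $ i * s i) = (\<Sum>i\<in>UNIV. Polynomial.monom (F i) d * ([:a i:] * ?t ^ M))"
    by (simp add: b.sum b.mult F s)
  also have "\<dots> = (\<Sum>i\<in>UNIV. Polynomial.monom (a i * F i) (d + M))"
    by (simp add: monom_power'[simplified] mult_monom smult_monom mult.commute)
  also have "\<dots> = Polynomial.monom (\<Sum>i\<in>UNIV. a i * F i) (d + M)"
    by (rule sym, rule poly_eqI) (simp add: coeff_sum)
  also have "\<dots> = blowup_chart v (pvar v ^ (d + M))"
    by (simp add: a blowup_chart_pvar_power monom_power'[simplified])
  finally have "(\<Sum>i\<in>UNIV. f $ i * s i) = pvar v ^ (d + M)" by (rule blowup_chart_inj)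
  then have "pvar v ^ (d + M) = (\<Sum>i\<in>UNIV. f $ i * s i)" ..
  then have "pvar v ^ (d + M) \<in> I" using iffD2[OF I_iff, OF exI] by blast
  then show ?thesis by blast
qed

section \<open>The Koszul complex of the symmetric algebra equations\<close>

locale height_two_ideal = hilbert_burch_ideal +
  assumes height: "ideal_height ring_of_type_algebra I = 2"
begin

lemma bicomp_g1: "bicomp p q (s * g1) = bicomp (p - 1) (q - int \<mu>) s * g1"
  using bicomp_mult'[OF g1_in_piece, of p q s] by (simp add: mult.commute)

lemma bicomp_g2: "bicomp p q (s * g2) = bicomp (p - 1) (q - (int d - int \<mu>)) s * g2"
  using bicomp_mult'[OF g2_in_piece, of p q s] by (simp add: mult.commute)

lemma bicomp_xvar_power: "bicomp p q (xvar v ^ n * s) = xvar v ^ n * bicomp p (q - int n) s"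
  using bicomp_mult'[OF xvar_power_in_piece, of p q v n s] by simp

text \<open>
  Membership of the rescaled element turns into membership of a multiple by a power of \<open>x\<^sub>v\<close>, one
  homogeneous component at a time.
\<close>

lemma saturate:
  fixes J :: "'a spoly set"
  assumes J: "0 \<in> J" "\<And>s t. s \<in> J \<Longrightarrow> t \<in> J \<Longrightarrow> s + t \<in> J" "\<And>s t. t \<in> J \<Longrightarrow> s * t \<in> J"
    and comps: "\<And>p q s. s \<in> J \<Longrightarrow> bicomp p q s \<in> J"
    and h: "scale_vars (pvar v ^ N) a \<in> J"
  shows "\<exists>n. xvar v ^ n * a \<in> J"
proof -
  have pv: "(pvar v :: 'a rpoly) ^ N = single (single v N) 1"
    using monom_at_pvar[of "single v N"] by simp
  have hom: "homogeneous N (pvar v ^ N :: 'a rpoly)"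
    unfolding pv homogeneous_def by simp
  have pow: "pconst ((pvar v :: 'a rpoly) ^ N) ^ n = xvar v ^ (N * n)" for n
    by (simp add: xvar_def pconst.power power_mult)
  have "\<exists>n. pconst (pvar v ^ N) ^ n * bicomp p q a \<in> J" for p q
    using comps[OF h] bicomp_scale_vars[OF hom, of p q a] by metis
  from torsion_from_bicomps[OF J this] show ?thesis
    unfolding pow by blast
qed

lemma pvar_power_obtain:
  obtains N where "pvar v ^ N \<in> I" "(pvar v :: 'a rpoly) ^ N \<noteq> 0"
  using pvar_power_in_ideal[OF height, of v] by (metis pvar_neq_0 power_not_zero)

lemma xvar_torsion_koszul:
  assumes "a * g1 + b * g2 = 0"
  shows "\<exists>n c. xvar v ^ n * a = c * g2"
proof -
  obtain N where N: "pvar v ^ N \<in> I" "(pvar v :: 'a rpoly) ^ N \<noteq> 0" by (rule pvar_power_obtain)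
  let ?J = "{s. g2 dvd s}"
  obtain c where "scale_vars (pvar v ^ N) a = c * g2"
    using scale_koszul[OF N assms] by blast
  then have "scale_vars (pvar v ^ N) a \<in> ?J" by simp
  then have "\<exists>n. xvar v ^ n * a \<in> ?J"
  proof (rule saturate[rotated -1])
    show "bicomp p q s \<in> ?J" if s: "s \<in> ?J" for p q s
    proof -
      obtain c where "s = c * g2" using s by (auto simp: dvd_def mult.commute)
      then show ?thesis by (simp add: bicomp_g2)
    qed
  qed auto
  then show ?thesis by (auto simp: dvd_def mult.commute)
qed

sublocale koszul_cech "xvar 1 :: 'a spoly" "xvar 2" g1 g2
proof
  show "xvar 1 ^ n dvd z" if "xvar 1 ^ n dvd xvar 2 ^ m * z" for n m and z :: "'a spoly"
    using xvar_power_dvd_mult[of 2 1, OF _ that] by simp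
  show "\<exists>c. a = c * g2" if ab: "a * g1 + b * g2 = 0" for a b
  proof -
    obtain n c where 1: "xvar 1 ^ n * a = c * g2" using xvar_torsion_koszul[OF ab] by blast
    obtain m c' where 2: "xvar 2 ^ m * a = c' * g2" using xvar_torsion_koszul[OF ab] by blast
    \<comment> \<open>divisibility by \<open>g2\<close> after inverting \<open>x\<^sub>1\<close> and after inverting \<open>x\<^sub>2\<close> glues, because \<open>x\<^sub>1, x\<^sub>2\<close> is a regular sequence\<close>
    have "xvar 2 ^ m * (xvar 1 ^ n * a) = xvar 1 ^ n * (xvar 2 ^ m * a)" by (rule mult.left_commute)
    then have "(xvar 2 ^ m * c) * g2 = (xvar 1 ^ n * c') * g2" unfolding 1 2 by (simp only: mult.assoc)
    then have "xvar 2 ^ m * c = xvar 1 ^ n * c'" using g_nz by simp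
    then have "xvar 1 ^ n dvd xvar 2 ^ m * c" by simp
    then have "xvar 1 ^ n dvd c" by (rule xvar_power_dvd_mult[rotated]) simp
    then obtain e where "c = xvar 1 ^ n * e" by (auto simp: dvd_def)
    with 1 have "xvar 1 ^ n * a = xvar 1 ^ n * (e * g2)" by (simp only: mult.assoc)
    then have "a = e * g2" by simp
    then show ?thesis by blast
  qed
qed (use g_nz in auto)

lemma bicomp_eq_ideal: "s \<in> eq_ideal \<Longrightarrow> bicomp p q s \<in> eq_ideal"
proof -
  assume "s \<in> eq_ideal"
  then obtain a b where s: "s = a * g1 + b * g2" unfolding eq_ideal_def by blast
  have "bicomp p q s = bicomp (p - 1) (q - int \<mu>) a * g1 + bicomp (p - 1) (q - (int d - int \<mu>)) b * g2"
    by (simp only: s bicomp_add bicomp_g1 bicomp_g2)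
  then show ?thesis unfolding eq_ideal_def by blast
qed

lemma bicomp_pow_ideal: "s \<in> pow_ideal n \<Longrightarrow> bicomp p q s \<in> pow_ideal n"
proof -
  assume "s \<in> pow_ideal n"
  then obtain a b where s: "s = a * xvar 1 ^ n + b * xvar 2 ^ n" unfolding pow_ideal_def by blast
  have "bicomp p q s = bicomp p (q - int n) a * xvar 1 ^ n + bicomp p (q - int n) b * xvar 2 ^ n"
    using bicomp_xvar_power[of p q 1 n a] bicomp_xvar_power[of p q 2 n b]
    by (simp add: s bicomp_add mult.commute)
  then show ?thesis unfolding pow_ideal_def by blast
qed

lemma bicomp_torsion: "s \<in> torsion \<Longrightarrow> bicomp p q s \<in> torsion"
proof -
  assume "s \<in> torsion"
  then obtain n where "xvar 1 ^ n * s \<in> eq_ideal" "xvar 2 ^ n * s \<in> eq_ideal"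
    unfolding torsion_def by blast
  from this[THEN bicomp_eq_ideal, of p "q + int n"] show ?thesis
    unfolding torsion_def by (auto simp: bicomp_xvar_power)
qed

text \<open>
  The Rees algebra is torsion free, so torsion maps to zero; conversely \<open>scale_rees\<close> applies with a
  power of either variable as \<open>h\<close>.
\<close>

lemma torsion_eq: "torsion = {F. rees_eval f F = 0}"
proof (intro equalityI subsetI CollectI)
  interpret e: ring_map "rees_eval f" by (rule rees_eval_ring_map)
  fix F assume "F \<in> torsion"
  then obtain n a b where F: "xvar 1 ^ n * F = a * g1 + b * g2"
    unfolding torsion_def eq_ideal_def by blast
  have "rees_eval f (xvar 1 ^ n * F) = 0"
    unfolding F by (simp add: e.add e.mult g1_def g2_def rees_eval_lin column_syzygies)
  moreover have "rees_eval f (xvar 1) \<noteq> 0"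
    by (simp add: xvar_def rees_eval_pconst)
  ultimately show "rees_eval f F = 0"
    by (simp add: e.mult e.power)
next
  fix F assume "F \<in> {F. rees_eval f F = 0}"
  then have F: "rees_eval f F = 0" by simp
  have *: "\<exists>n. xvar v ^ n * F \<in> eq_ideal" for v
  proof -
    obtain N where N: "pvar v ^ N \<in> I" "(pvar v :: 'a rpoly) ^ N \<noteq> 0" by (rule pvar_power_obtain)
    have "scale_vars (pvar v ^ N) F \<in> eq_ideal"
      using scale_rees[OF N F] by (auto simp: eq_ideal_def)
    then show ?thesis
      by (intro saturate[of eq_ideal] eq_ideal_closed bicomp_eq_ideal)
  qed
  obtain n m where nm: "xvar 1 ^ n * F \<in> eq_ideal" "xvar 2 ^ m * F \<in> eq_ideal"
    using * by blast
  have "xvar 1 ^ (n + m) * F \<in> eq_ideal" "xvar 2 ^ (n + m) * F \<in> eq_ideal"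
    by (rule power_mult_closed[OF eq_ideal_closed(3) nm(1)], assumption, simp)
       (rule power_mult_closed[OF eq_ideal_closed(3) nm(2)], assumption, simp)
  then show "F \<in> torsion" unfolding torsion_def by blast
qed

text \<open>
  The bidegrees force the twist: \<open>a\<close> has the bidegree of \<open>x\<^sup>n F\<close> minus that of \<open>g1\<close>, and \<open>w\<close> that of
  \<open>x\<^sup>n y\<^sup>n F\<close> minus those of \<open>g1\<close> and \<open>g2\<close>, whose sum is \<open>(2, d)\<close>.
\<close>

lemma linked_bicomp:
  assumes "linked n F w"
  shows "linked n (bicomp p q F) (bicomp (p - 2) (q + 2 * int n - int d) w)"
proof -
  obtain a b a' b' where 1: "xvar 1 ^ n * F = a * g1 + b * g2" "xvar 2 ^ n * F = a' * g1 + b' * g2"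
     "xvar 2 ^ n * a - xvar 1 ^ n * a' = w * g2" "xvar 2 ^ n * b - xvar 1 ^ n * b' = - (w * g1)"
    by (rule linkedE[OF assms(1)])
  let ?a = "bicomp (p - 1) (q + int n - int \<mu>)" and ?b = "bicomp (p - 1) (q + int n - (int d - int \<mu>))"
  show ?thesis
  proof (rule linkedI)
    show "xvar 1 ^ n * bicomp p q F = ?a a * g1 + ?b b * g2"
      using arg_cong[OF 1(1), of "bicomp p (q + int n)"]
      by (simp add: bicomp_add bicomp_g1 bicomp_g2 bicomp_xvar_power)
    show "xvar 2 ^ n * bicomp p q F = ?a a' * g1 + ?b b' * g2"
      using arg_cong[OF 1(2), of "bicomp p (q + int n)"]
      by (simp add: bicomp_add bicomp_g1 bicomp_g2 bicomp_xvar_power)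
    have "q + 2 * int n - int \<mu> - (int d - int \<mu>) = q + 2 * int n - int d"
      "q + 2 * int n - int \<mu> - int n = q + int n - int \<mu>" "p - 1 - 1 = p - 2" by simp_all
    note idx = this
    show "xvar 2 ^ n * ?a a - xvar 1 ^ n * ?a a' = bicomp (p - 2) (q + 2 * int n - int d) w * g2"
      using arg_cong[OF 1(3), of "bicomp (p - 1) (q + 2 * int n - int \<mu>)"]
      by (simp only: bicomp_diff bicomp_g2 bicomp_xvar_power idx)
    have "q + 2 * int n - (int d - int \<mu>) - int \<mu> = q + 2 * int n - int d"
      "q + 2 * int n - (int d - int \<mu>) - int n = q + int n - (int d - int \<mu>)" "p - 1 - 1 = p - 2" by simp_all
    note idx = this
    show "xvar 2 ^ n * ?b b - xvar 1 ^ n * ?b b' = - (bicomp (p - 2) (q + 2 * int n - int d) w * g1)"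
      using arg_cong[OF 1(4), of "bicomp (p - 1) (q + 2 * int n - (int d - int \<mu>))"]
      by (simp only: bicomp_diff bicomp_uminus bicomp_g1 bicomp_xvar_power idx)
  qed
qed

end

section \<open>Modules presented by a directed system of submodules of the polynomial ring\<close>

text \<open>
  A module that is the increasing union of images of the ideals \<open>D n\<close> of \<open>S\<close>, where the image of \<open>w\<close>
  at level \<open>n\<close> is the image of \<open>t * w\<close> at the next level.  The typical case is that \<open>\<pi> n w\<close> is the
  class of a fraction \<open>w / t\<^sup>n\<close>.  Finitely many elements come from a common level, and there the module
  axioms are inherited from \<open>S\<close>.
\<close>

locale presented_module =
  fixes M :: "('k::field spoly, 'm) bigraded" (structure) and D :: "nat \<Rightarrow> 'k spoly set"
    and \<pi> :: "nat \<Rightarrow> 'k spoly \<Rightarrow> 'm" and t :: "'k spoly"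
  assumes D_zero: "0 \<in> D n"
    and D_add: "w \<in> D n \<Longrightarrow> w' \<in> D n \<Longrightarrow> w + w' \<in> D n"
    and D_mult: "w \<in> D n \<Longrightarrow> s * w \<in> D n"
    and carrier_eq: "carrier M = (\<Union>n. \<pi> n ` D n)"
    and pi_zero: "\<pi> n 0 = \<zero>"
    and pi_add: "w \<in> D n \<Longrightarrow> w' \<in> D n \<Longrightarrow> \<pi> n (w + w') = \<pi> n w \<oplus> \<pi> n w'"
    and pi_mult: "w \<in> D n \<Longrightarrow> \<pi> n (s * w) = s \<odot> \<pi> n w"
    and D_step: "w \<in> D n \<Longrightarrow> t * w \<in> D (Suc n)"
    and pi_step: "w \<in> D n \<Longrightarrow> \<pi> (Suc n) (t * w) = \<pi> n w"
begin

lemma D_uminus: "w \<in> D n \<Longrightarrow> - w \<in> D n"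
  using D_mult[of w n "- 1"] by simp

lemma D_diff: "w \<in> D n \<Longrightarrow> w' \<in> D n \<Longrightarrow> w - w' \<in> D n"
  using D_add[OF _ D_uminus, of w n w'] by simp

lemma pi_closed: "w \<in> D n \<Longrightarrow> \<pi> n w \<in> carrier M"
  by (auto simp: carrier_eq)

lemma step: "w \<in> D n \<Longrightarrow> t ^ k * w \<in> D (n + k) \<and> \<pi> (n + k) (t ^ k * w) = \<pi> n w"
proof (induction k)
  case (Suc k)
  then show ?case
    using D_step[of "t ^ k * w" "n + k"] pi_step[of "t ^ k * w" "n + k"] by (simp add: mult.assoc)
qed simp

lemma eventually_image:
  assumes "x \<in> carrier M"
  shows "eventually (\<lambda>n. x \<in> \<pi> n ` D n) sequentially"
proof -
  obtain n w where w: "w \<in> D n" "x = \<pi> n w" using assms by (auto simp: carrier_eq)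
  have "x \<in> \<pi> m ` D m" if "m \<ge> n" for m
    using step[OF w(1), of "m - n"] that w(2) by (metis image_eqI le_add_diff_inverse)
  then show ?thesis by (auto simp: eventually_sequentially)
qed

lemma common_level1:
  assumes "x \<in> carrier M"
  obtains n w where "w \<in> D n" "x = \<pi> n w"
  using assms by (auto simp: carrier_eq)

lemma common_level3:
  assumes "x \<in> carrier M" "y \<in> carrier M" "z \<in> carrier M"
  obtains n u v w where "u \<in> D n" "v \<in> D n" "w \<in> D n" "x = \<pi> n u" "y = \<pi> n v" "z = \<pi> n w"
proof -
  have "eventually (\<lambda>n. x \<in> \<pi> n ` D n \<and> y \<in> \<pi> n ` D n \<and> z \<in> \<pi> n ` D n) sequentially"
    using assms by (intro eventually_conj eventually_image)
  then obtain n where "x \<in> \<pi> n ` D n" "y \<in> \<pi> n ` D n" "z \<in> \<pi> n ` D n"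
    using eventually_happens'[OF sequentially_bot] by blast
  with that show ?thesis by blast
qed

lemma abelian_group_M: "abelian_group M"
proof (rule abelian_groupI)
  fix x y assume xy: "x \<in> carrier M" "y \<in> carrier M"
  obtain n u v where uv: "u \<in> D n" "v \<in> D n" "x = \<pi> n u" "y = \<pi> n v"
    using common_level3[OF xy xy(2)] by metis
  show "x \<oplus> y \<in> carrier M" using pi_closed[OF D_add] pi_add uv by metis
  show "x \<oplus> y = y \<oplus> x" using pi_add uv by (metis add.commute)
next
  show "\<zero> \<in> carrier M" using pi_zero pi_closed[OF D_zero] by metis
next
  fix x y z assume "x \<in> carrier M" "y \<in> carrier M" "z \<in> carrier M"
  then obtain n u v w where *: "u \<in> D n" "v \<in> D n" "w \<in> D n" "x = \<pi> n u" "y = \<pi> n v" "z = \<pi> n w"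
    by (rule common_level3)
  then have "\<pi> n u \<oplus> \<pi> n v \<oplus> \<pi> n w = \<pi> n (u + v + w)"
    "\<pi> n u \<oplus> (\<pi> n v \<oplus> \<pi> n w) = \<pi> n (u + (v + w))"
    by (simp_all only: pi_add D_add)
  then show "x \<oplus> y \<oplus> z = x \<oplus> (y \<oplus> z)" by (simp add: * add.assoc)
next
  fix x assume "x \<in> carrier M"
  then obtain n u where u: "u \<in> D n" "x = \<pi> n u" by (rule common_level1)
  show "\<zero> \<oplus> x = x" using pi_add[OF D_zero u(1)] by (simp add: u pi_zero)
  show "\<exists>y\<in>carrier M. y \<oplus> x = \<zero>"
    using pi_add[OF D_uminus[OF u(1)] u(1)] pi_closed[OF D_uminus[OF u(1)]]
    by (intro bexI[of _ "\<pi> n (- u)"]) (simp_all add: u pi_zero)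
qed

lemma module_M: "Module.module ring_of_type_algebra M"
proof (rule moduleI)
  show "cring (ring_of_type_algebra :: 'k spoly ring)" by (rule cring_from_type_algebra)
  show "abelian_group M" by (rule abelian_group_M)
next
  fix a b x assume "x \<in> carrier M"
  then obtain n u where u: "u \<in> D n" "x = \<pi> n u" by (rule common_level1)
  show "a \<odot> x \<in> carrier M"
    using pi_closed[OF D_mult[OF u(1)]] by (simp add: u pi_mult)
  show "(a \<oplus>\<^bsub>ring_of_type_algebra\<^esub> b) \<odot> x = a \<odot> x \<oplus> b \<odot> x"
    using pi_add[OF D_mult[OF u(1)] D_mult[OF u(1)], of a b] u
    by (simp add: pi_mult D_mult flip: distrib_right)
  show "(a \<otimes>\<^bsub>ring_of_type_algebra\<^esub> b) \<odot> x = a \<odot> (b \<odot> x)"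
    using u pi_mult[OF u(1), of "a * b"] pi_mult[OF D_mult[OF u(1)], of a b] pi_mult[OF u(1), of b]
    by (simp add: mult.assoc)
  show "\<one>\<^bsub>ring_of_type_algebra\<^esub> \<odot> x = x" using pi_mult[OF u(1), of 1] u by simp
next
  fix a x y assume xy: "x \<in> carrier M" "y \<in> carrier M"
  obtain n u v where uv: "u \<in> D n" "v \<in> D n" "x = \<pi> n u" "y = \<pi> n v"
    using common_level3[OF xy xy(2)] by metis
  have "\<pi> n (a * (u + v)) = a \<odot> (\<pi> n u \<oplus> \<pi> n v)"
    using uv by (simp only: pi_mult pi_add D_add)
  moreover have "\<pi> n (a * u + a * v) = a \<odot> \<pi> n u \<oplus> a \<odot> \<pi> n v"
    using uv by (simp only: pi_mult pi_add D_mult)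
  ultimately show "a \<odot> (x \<oplus> y) = a \<odot> x \<oplus> a \<odot> y"
    by (simp add: uv distrib_left)
qed

sublocale M: abelian_group M by (rule abelian_group_M)

lemma pi_uminus: "w \<in> D n \<Longrightarrow> \<pi> n (- w) = \<ominus> \<pi> n w"
  using pi_add[OF D_uminus, of w n w] pi_closed D_uminus
  by (intro M.minus_equality[symmetric]) (simp_all add: pi_zero)

lemma pi_diff_eq: "w \<in> D n \<Longrightarrow> w' \<in> D n \<Longrightarrow> \<pi> n w = \<pi> n w' \<longleftrightarrow> \<pi> n (w - w') = \<zero>"
proof -
  assume w: "w \<in> D n" "w' \<in> D n"
  have eq: "\<pi> n w = \<pi> n (w - w') \<oplus> \<pi> n w'"
    using pi_add[OF D_diff[OF w] w(2)] by simp
  show ?thesis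
    using eq pi_closed[OF D_diff[OF w]] pi_closed[OF w(2)] M.add.r_cancel_one' by force
qed

lemma pi_sum:
  assumes "finite A" "\<And>a. a \<in> A \<Longrightarrow> u a \<in> D n"
  shows "sum u A \<in> D n \<and> \<pi> n (sum u A) = finsum M (\<lambda>a. \<pi> n (u a)) A"
  using assms
proof (induction A)
  case empty
  then show ?case by (simp add: D_zero pi_zero)
next
  case (insert a A)
  then have "sum u A \<in> D n" "\<pi> n (sum u A) = finsum M (\<lambda>a. \<pi> n (u a)) A" "u a \<in> D n" by auto
  moreover have "finsum M (\<lambda>a. \<pi> n (u a)) (insert a A) = \<pi> n (u a) \<oplus> finsum M (\<lambda>a. \<pi> n (u a)) A"
    using insert by (intro M.finsum_insert) (auto intro: pi_closed)
  ultimately show ?case using insert.hyps by (simp add: pi_add D_add)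
qed

end

text \<open>
  The level \<open>n\<close> shifts bidegrees by \<open>(a, b + n e)\<close>, as a denominator \<open>t\<^sup>n\<close> with \<open>t\<close> of bidegree
  \<open>(0, e)\<close> does.
\<close>

locale graded_presented_module = presented_module M D \<pi> t
  for M :: "('k::field spoly, 'm) bigraded" (structure) and D \<pi> t +
  fixes a b e :: int
  assumes t_piece: "t \<in> S_piece 0 e"
    and D_bicomp: "w \<in> D n \<Longrightarrow> bicomp p q w \<in> D n"
    and kernel_bicomp: "w \<in> D n \<Longrightarrow> \<pi> n w = \<zero> \<Longrightarrow> \<pi> n (bicomp p q w) = \<zero>"
    and piece_eq: "piece M p q = (\<Union>n. \<pi> n ` (D n \<inter> S_piece (p + a) (q + b + int n * e)))"
begin

abbreviation part :: "nat \<Rightarrow> int \<times> int \<Rightarrow> 'k spoly \<Rightarrow> 'k spoly" where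
  "part n pq \<equiv> bicomp (fst pq + a) (snd pq + b + int n * e)"

lemma pi_in_piece:
  "w \<in> D n \<Longrightarrow> w \<in> S_piece (p + a) (q + b + int n * e) \<Longrightarrow> \<pi> n w \<in> piece M p q"
  unfolding piece_eq by (intro UN_I[of n] imageI IntI) auto

lemma eventually_piece:
  assumes "x \<in> piece M p q"
  shows "eventually (\<lambda>n. x \<in> \<pi> n ` (D n \<inter> S_piece (p + a) (q + b + int n * e))) sequentially"
proof -
  obtain n w where w: "w \<in> D n" "w \<in> S_piece (p + a) (q + b + int n * e)" "x = \<pi> n w"
    using assms by (auto simp: piece_eq)
  have "x \<in> \<pi> m ` (D m \<inter> S_piece (p + a) (q + b + int m * e))" if "m \<ge> n" for m
  proof -
    from that obtain k where k: "m = n + k" by (auto simp: le_iff_add)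
    have "t ^ k * w \<in> S_piece (int k * 0 + (p + a)) (int k * e + (q + b + int n * e))"
      by (intro S_piece_mult S_piece_power t_piece w)
    then have "t ^ k * w \<in> S_piece (p + a) (q + b + int m * e)"
      by (simp add: k algebra_simps)
    then show ?thesis using step[OF w(1), of k] w(3) k by (metis IntI image_eqI)
  qed
  then show ?thesis by (auto simp: eventually_sequentially)
qed

lemma piece_carrier: "piece M p q \<subseteq> carrier M"
  by (auto simp: piece_eq carrier_eq)

lemma piece_subgroup: "subgroup (piece M p q) (add_monoid M)"
proof (rule M.add.subgroupI)
  show "piece M p q \<subseteq> carrier M" by (rule piece_carrier)
  have "\<pi> 0 0 \<in> piece M p q" by (intro pi_in_piece D_zero S_piece_zero)
  then show "piece M p q \<noteq> {}" by blast
next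
  fix x assume "x \<in> piece M p q"
  then obtain n w where w: "w \<in> D n" "w \<in> S_piece (p + a) (q + b + int n * e)" "x = \<pi> n w"
    by (auto simp: piece_eq)
  have "\<ominus> x = \<pi> n (- w)" using w by (simp add: pi_uminus)
  then show "\<ominus> x \<in> piece M p q"
    using pi_in_piece[OF D_uminus S_piece_uminus, OF w(1,2)] by simp
next
  fix x y assume xy: "x \<in> piece M p q" "y \<in> piece M p q"
  have "eventually (\<lambda>n. x \<in> \<pi> n ` (D n \<inter> S_piece (p + a) (q + b + int n * e)) \<and>
      y \<in> \<pi> n ` (D n \<inter> S_piece (p + a) (q + b + int n * e))) sequentially"
    using xy by (intro eventually_conj eventually_piece)
  then obtain n where "x \<in> \<pi> n ` (D n \<inter> S_piece (p + a) (q + b + int n * e))"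
      "y \<in> \<pi> n ` (D n \<inter> S_piece (p + a) (q + b + int n * e))"
    using eventually_happens'[OF sequentially_bot] by blast
  then obtain u v where uv: "u \<in> D n \<inter> S_piece (p + a) (q + b + int n * e)" "x = \<pi> n u"
    "v \<in> D n \<inter> S_piece (p + a) (q + b + int n * e)" "y = \<pi> n v" by blast
  have "x \<oplus> y = \<pi> n (u + v)" "u + v \<in> D n \<inter> S_piece (p + a) (q + b + int n * e)"
    using uv by (auto simp: pi_add D_add S_piece_add)
  then show "x \<oplus> y \<in> piece M p q" using pi_in_piece[of "u + v"] by simp
qed

lemma piece_smult:
  assumes "s \<in> S_piece a' b'" "x \<in> piece M p q"
  shows "s \<odot> x \<in> piece M (p + a') (q + b')"
proof -
  obtain n w where w: "w \<in> D n" "w \<in> S_piece (p + a) (q + b + int n * e)" "x = \<pi> n w"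
    using assms(2) by (auto simp: piece_eq)
  have "s * w \<in> S_piece (a' + (p + a)) (b' + (q + b + int n * e))"
    by (intro S_piece_mult assms w)
  then have "s * w \<in> S_piece (p + a' + a) (q + b' + b + int n * e)" by (simp add: algebra_simps)
  moreover have "s \<odot> x = \<pi> n (s * w)" using w by (simp add: pi_mult)
  ultimately show ?thesis using pi_in_piece[OF D_mult[OF w(1)]] by simp
qed

text \<open>
  The components of a numerator give the components of its class.  Components in the kernel of \<open>\<pi> n\<close>
  have to be dropped, because the sum runs over the support of \<open>c\<close>.
\<close>

lemma homogeneous_decomposition:
  assumes "m \<in> carrier M"
  obtains c where "\<And>p q. c (p, q) \<in> piece M p q" "finite {pq. c pq \<noteq> \<zero>}"
    "m = finsum M c {pq. c pq \<noteq> \<zero>}"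
proof -
  obtain n w where w: "w \<in> D n" "m = \<pi> n w" using assms by (rule common_level1)
  define c where "c pq = \<pi> n (part n pq w)" for pq
  let ?sh = "\<lambda>pq. (fst pq + a, snd pq + b + int n * e)"
  define B where "B = {pq. part n pq w \<noteq> 0}"
  define A where "A = {pq. c pq \<noteq> \<zero>}"
  have inj: "inj ?sh" by (auto simp: inj_on_def prod_eq_iff)
  have B_image: "?sh ` B = {pq. bicomp (fst pq) (snd pq) w \<noteq> 0}"
  proof (intro equalityI subsetI)
    fix pq assume *: "pq \<in> {pq. bicomp (fst pq) (snd pq) w \<noteq> 0}"
    have "pq = ?sh (fst pq - a, snd pq - b - int n * e)" by (simp add: prod_eq_iff)
    moreover have "(fst pq - a, snd pq - b - int n * e) \<in> B" using * by (simp add: B_def)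
    ultimately show "pq \<in> ?sh ` B" by (rule image_eqI)
  qed (auto simp: B_def)
  have finB: "finite B"
  proof (rule finite_imageD)
    show "finite (?sh ` B)" unfolding B_image by (rule finite_bicomp_support)
    show "inj_on ?sh B" using inj by (rule inj_on_subset) simp
  qed
  have AB: "A \<subseteq> B" unfolding A_def B_def c_def using pi_zero by auto
  then have finA: "finite A" using finB finite_subset by blast
  have "w = (\<Sum>pq\<in>?sh ` B. bicomp (fst pq) (snd pq) w)"
    using sum_bicomp[OF finite_bicomp_support order_refl, of w] unfolding B_image by simp
  also have "\<dots> = (\<Sum>pq\<in>B. part n pq w)"
    using inj by (subst sum.reindex) (auto simp: inj_on_def)
  also have "\<dots> = (\<Sum>pq\<in>B - A. part n pq w) + (\<Sum>pq\<in>A. part n pq w)"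
    using AB finB by (rule sum.subset_diff)
  finally have w_eq: "w = (\<Sum>pq\<in>B - A. part n pq w) + (\<Sum>pq\<in>A. part n pq w)" .
  have D: "part n pq w \<in> D n" for pq by (rule D_bicomp[OF w(1)])
  have BA: "(\<Sum>pq\<in>B - A. part n pq w) \<in> D n \<and>
      \<pi> n (\<Sum>pq\<in>B - A. part n pq w) = finsum M (\<lambda>pq. \<pi> n (part n pq w)) (B - A)"
    using finB D by (intro pi_sum) auto
  have A: "(\<Sum>pq\<in>A. part n pq w) \<in> D n \<and>
      \<pi> n (\<Sum>pq\<in>A. part n pq w) = finsum M (\<lambda>pq. \<pi> n (part n pq w)) A"
    using finA D by (intro pi_sum) auto
  have "finsum M (\<lambda>pq. \<pi> n (part n pq w)) (B - A) = finsum M (\<lambda>pq. \<zero>) (B - A)"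
    by (rule M.finsum_cong') (auto simp: A_def c_def)
  then have "\<pi> n (\<Sum>pq\<in>B - A. part n pq w) = \<zero>" using BA by simp
  then have "\<pi> n w = finsum M (\<lambda>pq. \<pi> n (part n pq w)) A"
    using A BA pi_closed[of "\<Sum>pq\<in>A. part n pq w" n] by (subst w_eq) (simp add: pi_add)
  then have "m = finsum M c {pq. c pq \<noteq> \<zero>}"
    unfolding w(2) A_def c_def .
  moreover have "c (p, q) \<in> piece M p q" for p q
    unfolding c_def using D_bicomp[OF w(1)] bicomp_in_piece by (intro pi_in_piece) auto
  moreover have "finite {pq. c pq \<noteq> \<zero>}" using finA by (simp add: A_def)
  ultimately show ?thesis by (rule that[rotated -1])
qed

text \<open>
  Two decompositions have homogeneous numerators at a common level.  The sums of these numerators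
  differ by an element of the kernel, which is homogeneous, so corresponding numerators have equal
  classes.
\<close>

lemma homogeneous_decomposition_unique:
  assumes c: "\<And>p q. c (p, q) \<in> piece M p q" "finite {pq. c pq \<noteq> \<zero>}"
    "m = finsum M c {pq. c pq \<noteq> \<zero>}"
    and c': "\<And>p q. c' (p, q) \<in> piece M p q" "finite {pq. c' pq \<noteq> \<zero>}"
    "m = finsum M c' {pq. c' pq \<noteq> \<zero>}"
  shows "c = c'"
proof -
  define A where "A = {pq. c pq \<noteq> \<zero>} \<union> {pq. c' pq \<noteq> \<zero>}"
  have finA: "finite A" unfolding A_def using c(2) c'(2) by simp
  let ?P = "\<lambda>n pq. D n \<inter> S_piece (fst pq + a) (snd pq + b + int n * e)"
  have cp: "c pq \<in> piece M (fst pq) (snd pq)" "c' pq \<in> piece M (fst pq) (snd pq)" for pq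
    using c(1)[of "fst pq" "snd pq"] c'(1)[of "fst pq" "snd pq"] by simp_all
  have "eventually (\<lambda>n. \<forall>pq\<in>A. c pq \<in> \<pi> n ` ?P n pq \<and> c' pq \<in> \<pi> n ` ?P n pq) sequentially"
    using cp finA by (intro eventually_ball_finite ballI eventually_conj eventually_piece)
  then obtain n where n: "\<And>pq. pq \<in> A \<Longrightarrow> c pq \<in> \<pi> n ` ?P n pq \<and> c' pq \<in> \<pi> n ` ?P n pq"
    using eventually_happens'[OF sequentially_bot] by blast
  have lift: "\<forall>pq\<in>A. \<exists>u. u \<in> ?P n pq \<and> v pq = \<pi> n u" if "\<And>pq. pq \<in> A \<Longrightarrow> v pq \<in> \<pi> n ` ?P n pq" for v
    using that unfolding image_iff by blast
  have "\<forall>pq\<in>A. \<exists>u. u \<in> ?P n pq \<and> c pq = \<pi> n u" using n by (intro lift) blast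
  from bchoice[OF this] obtain u where u: "\<And>pq. pq \<in> A \<Longrightarrow> u pq \<in> ?P n pq \<and> c pq = \<pi> n (u pq)"
    by (elim exE) blast
  have "\<forall>pq\<in>A. \<exists>u. u \<in> ?P n pq \<and> c' pq = \<pi> n u" using n by (intro lift) blast
  from bchoice[OF this] obtain u' where u': "\<And>pq. pq \<in> A \<Longrightarrow> u' pq \<in> ?P n pq \<and> c' pq = \<pi> n (u' pq)"
    by (elim exE) blast
  have extend: "finsum M v {pq. v pq \<noteq> \<zero>} = finsum M v A"
    if "{pq. v pq \<noteq> \<zero>} \<subseteq> A" "\<And>pq. v pq \<in> carrier M" for v
    using that finA by (intro M.add.finprod_mono_neutral_cong_left) auto
  have car: "c pq \<in> carrier M" "c' pq \<in> carrier M" for pq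
    using cp piece_carrier by blast+
  have "m = finsum M c A"
    unfolding c(3) by (rule extend) (simp_all add: A_def car)
  also have "\<dots> = finsum M (\<lambda>pq. \<pi> n (u pq)) A"
  proof (rule M.finsum_cong'[OF refl])
    show "(\<lambda>pq. \<pi> n (u pq)) \<in> A \<rightarrow> carrier M" using u pi_closed by blast
  qed (use u in blast)
  finally have "m = finsum M (\<lambda>pq. \<pi> n (u pq)) A" .
  then have m: "m = \<pi> n (sum u A)" "sum u A \<in> D n"
    using pi_sum[OF finA, of u n] u by auto
  have "m = finsum M c' A"
    unfolding c'(3) by (rule extend) (simp_all add: A_def car)
  also have "\<dots> = finsum M (\<lambda>pq. \<pi> n (u' pq)) A"
  proof (rule M.finsum_cong'[OF refl])
    show "(\<lambda>pq. \<pi> n (u' pq)) \<in> A \<rightarrow> carrier M" using u' pi_closed by blast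
  qed (use u' in blast)
  finally have "m = finsum M (\<lambda>pq. \<pi> n (u' pq)) A" .
  then have m': "m = \<pi> n (sum u' A)" "sum u' A \<in> D n"
    using pi_sum[OF finA, of u' n] u' by auto
  \<comment> \<open>the kernel at level \<open>n\<close> is homogeneous, so each component of this difference lies in it\<close>
  have ker: "\<pi> n (sum u A - sum u' A) = \<zero>"
    using pi_diff_eq[OF m(2) m'(2)] m m' by simp
  show "c = c'"
  proof
    fix pq show "c pq = c' pq"
    proof (cases "pq \<in> A")
      case True
      have part_sum: "part n pq (sum v A) = v pq" if v: "\<And>rs. rs \<in> A \<Longrightarrow> v rs \<in> ?P n rs" for v
      proof -
        have "part n pq (sum v A) = (\<Sum>rs\<in>A. if rs = pq then v pq else 0)"
          unfolding bicomp_sum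
        proof (rule sum.cong)
          fix rs assume "rs \<in> A"
          then have v': "v rs \<in> S_piece (fst rs + a) (snd rs + b + int n * e)" using v by blast
          show "part n pq (v rs) = (if rs = pq then v pq else 0)"
          proof (cases "rs = pq")
            case True
            then show ?thesis using bicomp_piece[OF v'] by simp
          next
            case False
            then have "(fst pq + a, snd pq + b + int n * e) \<noteq> (fst rs + a, snd rs + b + int n * e)"
              by (auto simp: prod_eq_iff)
            then show ?thesis using bicomp_other_piece[OF v'] False by simp
          qed
        qed simp
        then show ?thesis using True finA by simp
      qed
      have "\<pi> n (part n pq (sum u A - sum u' A)) = \<zero>"
        by (rule kernel_bicomp[OF D_diff[OF m(2) m'(2)] ker])
      then have "\<pi> n (u pq - u' pq) = \<zero>"
        using part_sum[of u] part_sum[of u'] u u' by (simp add: bicomp_diff)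
      then have "\<pi> n (u pq) = \<pi> n (u' pq)"
        using pi_diff_eq[of "u pq" n "u' pq"] u[OF True] u'[OF True] by simp
      then show ?thesis using u[OF True] u'[OF True] by simp
    next
      case False
      then show ?thesis by (simp add: A_def)
    qed
  qed
qed

lemma bigraded_module_M: "bigraded_module M"
  unfolding bigraded_module_def
proof (intro conjI allI ballI module_M piece_subgroup piece_smult)
  fix m assume m: "m \<in> carrier M"
  from homogeneous_decomposition[OF m] obtain c where c:
    "\<And>p q. c (p, q) \<in> piece M p q" "finite {pq. c pq \<noteq> \<zero>}"
    "m = finsum M c {pq. c pq \<noteq> \<zero>}" by blast
  show "\<exists>!c. (\<forall>p q. c (p, q) \<in> piece M p q) \<and> finite {pq. c pq \<noteq> \<zero>} \<and>
     m = finsum M c {pq. c pq \<noteq> \<zero>}"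
  proof (rule ex1I[of _ c])
    show "(\<forall>p q. c (p, q) \<in> piece M p q) \<and> finite {pq. c pq \<noteq> \<zero>} \<and>
     m = finsum M c {pq. c pq \<noteq> \<zero>}" using c by blast
    fix c' assume "(\<forall>p q. c' (p, q) \<in> piece M p q) \<and> finite {pq. c' pq \<noteq> \<zero>} \<and>
     m = finsum M c' {pq. c' pq \<noteq> \<zero>}"
    then show "c' = c"
      using c by (intro homogeneous_decomposition_unique[of c' m c]) blast+
  qed
qed

end

section \<open>The symmetric algebra as a quotient of the polynomial ring\<close>

lemma polys_in_closed:
  "pconst c \<in> polys_in V" "v \<in> V \<Longrightarrow> pvar v \<in> polys_in V"
  "p \<in> polys_in V \<Longrightarrow> q \<in> polys_in V \<Longrightarrow> p + q \<in> polys_in V"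
  "p \<in> polys_in V \<Longrightarrow> q \<in> polys_in V \<Longrightarrow> p * q \<in> polys_in V"
proof -
  show "pconst c \<in> polys_in V" by (auto simp: polys_in_def pconst_def)
  show "v \<in> V \<Longrightarrow> pvar v \<in> polys_in V" by (auto simp: polys_in_def pvar_def)
  show "p \<in> polys_in V \<Longrightarrow> q \<in> polys_in V \<Longrightarrow> p + q \<in> polys_in V"
    using keys_add[of p q] unfolding polys_in_def by blast
  assume pq: "p \<in> polys_in V" "q \<in> polys_in V"
  show "p * q \<in> polys_in V"
    unfolding polys_in_def
  proof (rule CollectI, rule ballI)
    fix m assume "m \<in> keys (p * q)"
    then obtain a b where "m = a + b" "a \<in> keys p" "b \<in> keys q"
      using keys_mult[of p q] by blast
    then show "keys m \<subseteq> V"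
      using pq keys_add[of a b] unfolding polys_in_def by blast
  qed
qed

lemma polys_in_minus:
  "p \<in> polys_in V \<Longrightarrow> - p \<in> polys_in V"
  "p \<in> polys_in V \<Longrightarrow> q \<in> polys_in V \<Longrightarrow> p - q \<in> polys_in V"
proof -
  show *: "p \<in> polys_in V \<Longrightarrow> - p \<in> polys_in V" for p :: "('a \<Rightarrow>\<^sub>0 nat) \<Rightarrow>\<^sub>0 'b"
    using polys_in_closed(4)[OF polys_in_closed(1)[of "- 1" V], of p]
    by (simp add: pconst.uminus pconst.one)
  show "p \<in> polys_in V \<Longrightarrow> q \<in> polys_in V \<Longrightarrow> p - q \<in> polys_in V"
    using polys_in_closed(3)[OF _ *, of p q] by simp
qed

lemma sym_free_simps [simp]:
  "carrier (sym_free N) = polys_in (carrier N)"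
  "\<zero>\<^bsub>sym_free N\<^esub> = 0" "\<one>\<^bsub>sym_free N\<^esub> = 1"
  "p \<oplus>\<^bsub>sym_free N\<^esub> q = p + q" "p \<otimes>\<^bsub>sym_free N\<^esub> q = p * q"
  by (simp_all add: sym_free_def polys_in_def)

lemma ring_sym_free:
  fixes N :: "('a::comm_ring_1, 'b) module"
  shows "ring (sym_free N)"
proof -
  interpret R: cring "ring_of_type_algebra :: (('b \<Rightarrow>\<^sub>0 nat) \<Rightarrow>\<^sub>0 'a) ring" by (rule cring_from_type_algebra)
  have "\<ominus>\<^bsub>ring_of_type_algebra\<^esub> p = - p" for p :: "('b \<Rightarrow>\<^sub>0 nat) \<Rightarrow>\<^sub>0 'a"
    using R.minus_equality[of "- p" p] by simp
  then have "subring (polys_in (carrier N)) (ring_of_type_algebra :: (('b \<Rightarrow>\<^sub>0 nat) \<Rightarrow>\<^sub>0 'a) ring)"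
    using polys_in_closed(1)[of 1 "carrier N"]
    by (intro R.subringI) (auto simp: polys_in_closed polys_in_minus pconst.one)
  from R.subring_is_ring[OF this] show ?thesis by (simp add: sym_free_def polys_in_def)
qed

lemma a_inv_sym_free:
  assumes "p \<in> polys_in (carrier N)"
  shows "\<ominus>\<^bsub>sym_free N\<^esub> p = - p"
proof -
  interpret R: ring "sym_free N" by (rule ring_sym_free)
  show ?thesis using R.minus_equality[of "- p" p] assms polys_in_minus(1)[OF assms] by simp
qed

text \<open>
  The symmetric algebra is a quotient of a subring of a polynomial type.  This lemma supplies the
  ideals of that subring that are needed to bound the ideal generated by the relators.
\<close>

lemma ideal_preimage:
  assumes h: "ring_map h"
    and L: "0 \<in> L" "\<And>x y. x \<in> L \<Longrightarrow> y \<in> L \<Longrightarrow> x + y \<in> L" "\<And>x y. y \<in> L \<Longrightarrow> x * y \<in> L"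
  shows "ideal {p \<in> polys_in (carrier N). h p \<in> L} (sym_free N)"
proof -
  interpret h: ring_map h by (rule h)
  interpret R: ring "sym_free N" by (rule ring_sym_free)
  have L_mult: "x \<in> L \<Longrightarrow> x * y \<in> L" for x y using L(3)[of x y] by (simp add: mult.commute)
  have L_uminus: "x \<in> L \<Longrightarrow> - x \<in> L" for x using L(3)[of x "- 1"] by simp
  show ?thesis
  proof (intro idealI ring_sym_free R.add.subgroupI)
    show "{p \<in> polys_in (carrier N). h p \<in> L} \<subseteq> carrier (sym_free N)" by auto
    have "0 \<in> {p \<in> polys_in (carrier N). h p \<in> L}"
      using polys_in_closed(1)[of 0 "carrier N"] L(1) by simp
    then show "{p \<in> polys_in (carrier N). h p \<in> L} \<noteq> {}" by blast
  next
    fix p assume "p \<in> {p \<in> polys_in (carrier N). h p \<in> L}"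
    then show "\<ominus>\<^bsub>sym_free N\<^esub> p \<in> {p \<in> polys_in (carrier N). h p \<in> L}"
      by (simp add: a_inv_sym_free polys_in_minus h.uminus L_uminus)
  qed (auto simp: polys_in_closed h.add h.mult L L_mult)
qed

definition sym_relators :: "('r::comm_ring_1, 'm) module \<Rightarrow> (('m \<Rightarrow>\<^sub>0 nat) \<Rightarrow>\<^sub>0 'r) set" where
  "sym_relators M =
     {pvar (a \<oplus>\<^bsub>M\<^esub> b) - pvar a - pvar b |a b. a \<in> carrier M \<and> b \<in> carrier M} \<union>
     {pvar (r \<odot>\<^bsub>M\<^esub> a) - pconst r * pvar a |r a. a \<in> carrier M}"

lemma sym_rel_eq: "sym_rel N = Idl\<^bsub>sym_free N\<^esub> (sym_relators N)"
  unfolding sym_rel_def sym_relators_def ..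

lemma sym_rel_induct:
  assumes "ring_map h"
    and "0 \<in> L" "\<And>x y. x \<in> L \<Longrightarrow> y \<in> L \<Longrightarrow> x + y \<in> L" "\<And>x y. y \<in> L \<Longrightarrow> x * y \<in> L"
    and "sym_relators N \<subseteq> polys_in (carrier N)" "\<And>r. r \<in> sym_relators N \<Longrightarrow> h r \<in> L"
    and "p \<in> sym_rel N"
  shows "h p \<in> L"
proof -
  interpret R: ring "sym_free N" by (rule ring_sym_free)
  have "sym_rel N \<subseteq> {p \<in> polys_in (carrier N). h p \<in> L}"
    unfolding sym_rel_eq using ideal_preimage[OF assms(1-4), of N] assms(5,6)
    by (intro R.genideal_minimal) blast+
  with assms(7) show ?thesis by blast
qed

context hilbert_burch_ideal
begin

abbreviation "Imod \<equiv> ideal_as_module I"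

lemma carrier_Imod [simp]: "carrier Imod = I"
  by (simp add: ideal_as_module_def)

lemma I_closed: "a \<in> I \<Longrightarrow> b \<in> I \<Longrightarrow> a + b \<in> I" "a \<in> I \<Longrightarrow> r * a \<in> I" "f $ i \<in> I" "0 \<in> I"
proof -
  show "a + b \<in> I" if a: "a \<in> I" and b: "b \<in> I"
  proof -
    obtain c where c: "a = (\<Sum>i\<in>UNIV. f $ i * c i)" using a unfolding I_iff by blast
    obtain e where e: "b = (\<Sum>i\<in>UNIV. f $ i * e i)" using b unfolding I_iff by blast
    have "a + b = (\<Sum>i\<in>UNIV. f $ i * (c i + e i))" by (simp add: c e distrib_left sum.distrib)
    then show ?thesis unfolding I_iff by (rule exI[where x = "\<lambda>i. c i + e i"])
  qed
  show mult: "r * a \<in> I" if a: "a \<in> I" for r a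
  proof -
    obtain c where c: "a = (\<Sum>i\<in>UNIV. f $ i * c i)" using a unfolding I_iff by blast
    have "r * a = (\<Sum>i\<in>UNIV. f $ i * (r * c i))" by (simp add: c sum_distrib_left mult.left_commute)
    then show ?thesis unfolding I_iff by (rule exI[where x = "\<lambda>i. r * c i"])
  qed
  have "(\<Sum>j\<in>UNIV. f $ j * (if j = i then 1 else 0)) = (\<Sum>j\<in>UNIV. if j = i then f $ i else 0)" for i
    by (intro sum.cong) auto
  then have "f $ i = (\<Sum>j\<in>UNIV. f $ j * (if j = i then 1 else 0))" for i by simp
  then show fI: "f $ i \<in> I" for i unfolding I_iff by (rule exI[where x = "\<lambda>j. if j = i then 1 else 0"])
  show "0 \<in> I" using mult[OF fI, of 0] by simp
qed

lemma sym_relators_in: "sym_relators Imod \<subseteq> polys_in (carrier Imod)"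
  by (auto simp: sym_relators_def ideal_as_module_def I_closed intro!: polys_in_minus polys_in_closed)

abbreviation "J \<equiv> sym_rel Imod"

lemma ideal_J: "ideal J (sym_free Imod)"
  using ring.genideal_ideal[OF ring_sym_free] sym_relators_in
  unfolding sym_rel_eq by (metis sym_free_simps(1))

lemma J_closed:
  "0 \<in> J" "p \<in> J \<Longrightarrow> q \<in> J \<Longrightarrow> p + q \<in> J" "p \<in> polys_in I \<Longrightarrow> q \<in> J \<Longrightarrow> p * q \<in> J"
  "p \<in> J \<Longrightarrow> - p \<in> J" "p \<in> J \<Longrightarrow> q \<in> J \<Longrightarrow> p - q \<in> J" "J \<subseteq> polys_in I"
proof -
  interpret ideal J "sym_free Imod" by (rule ideal_J)
  show "0 \<in> J" using additive_subgroup.zero_closed[OF additive_subgroup_axioms] by simp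
  show add: "p \<in> J \<Longrightarrow> q \<in> J \<Longrightarrow> p + q \<in> J" for p q using additive_subgroup.a_closed[OF additive_subgroup_axioms, of p q] by simp
  show mult: "p \<in> polys_in I \<Longrightarrow> q \<in> J \<Longrightarrow> p * q \<in> J" for p q using I_l_closed[of q p] by simp
  show neg: "p \<in> J \<Longrightarrow> - p \<in> J" for p
    using mult[OF polys_in_closed(1)[of "- 1"], of p] by (simp add: pconst.uminus pconst.one)
  show "p \<in> J \<Longrightarrow> q \<in> J \<Longrightarrow> p - q \<in> J" using add[OF _ neg, of p q] by simp
  show "J \<subseteq> polys_in I" using a_subset by simp
qed

lemma J_relators:
  "a \<in> I \<Longrightarrow> b \<in> I \<Longrightarrow> pvar (a + b) - pvar a - pvar b \<in> J"
  "a \<in> I \<Longrightarrow> pvar (r * a) - pconst r * pvar a \<in> J"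
proof -
  interpret R: ring "sym_free Imod" by (rule ring_sym_free)
  have "sym_relators Imod \<subseteq> J"
    unfolding sym_rel_eq using sym_relators_in by (intro R.genideal_self) simp
  moreover have "pvar (a + b) - pvar a - pvar b \<in> sym_relators Imod" if "a \<in> I" "b \<in> I"
    unfolding sym_relators_def using that by (intro UnI1) (auto simp: ideal_as_module_def)
  moreover have "pvar (r * a) - pconst r * pvar a \<in> sym_relators Imod" if "a \<in> I"
    unfolding sym_relators_def using that by (intro UnI2) (auto simp: ideal_as_module_def)
  ultimately show "a \<in> I \<Longrightarrow> b \<in> I \<Longrightarrow> pvar (a + b) - pvar a - pvar b \<in> J"
    "a \<in> I \<Longrightarrow> pvar (r * a) - pconst r * pvar a \<in> J" by blast+
qed

text \<open>
  \<open>\<Phi>\<close> lifts the map \<open>S \<rightarrow> Sym(I)\<close> to polynomials, and \<open>\<Psi>\<close> below lifts its inverse modulo \<open>(g1, g2)\<close>: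
  it sends the variable of \<open>a\<close> to \<open>\<Sum> c\<^sub>i T\<^sub>i\<close> for a chosen expression \<open>a = \<Sum> c\<^sub>i f\<^sub>i\<close>.
\<close>

definition \<Phi> :: "'k spoly \<Rightarrow> ('k rpoly \<Rightarrow>\<^sub>0 nat) \<Rightarrow>\<^sub>0 'k rpoly" where
  "\<Phi> = psubst pconst (\<lambda>i. pvar (f $ i))"

lemma Phi_ring_map: "ring_map \<Phi>"
  unfolding \<Phi>_def by (intro psubst_ring_map pconst_ring_map)

sublocale Phi: ring_map \<Phi> by (rule Phi_ring_map)

lemma Phi_pconst: "\<Phi> (pconst r) = pconst r" and Phi_pvar: "\<Phi> (pvar i) = pvar (f $ i)"
  by (simp_all add: \<Phi>_def psubst_pconst psubst_pvar pconst_ring_map)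

lemma Phi_in: "\<Phi> s \<in> polys_in I"
  by (induction s rule: poly_induct)
     (auto simp: Phi_pconst Phi_pvar Phi.add Phi.mult polys_in_closed I_closed)

text \<open>
  Linearity of \<open>I \<rightarrow> Sym(I)\<close>, applied to \<open>\<Sum> c\<^sub>i f\<^sub>i\<close>.
\<close>

lemma Phi_lin: "\<Phi> (lin c) - pvar (\<Sum>i\<in>UNIV. f $ i * c i) \<in> J"
proof -
  let ?x = "\<lambda>i. c i * f $ i"
  have xI: "?x i \<in> I" for i by (intro I_closed)
  have s: "(\<Sum>i\<in>UNIV. f $ i * c i) = ?x 1 + ?x 2 + ?x 3" by (simp add: sum_3 mult.commute)
  have l: "\<Phi> (lin c) = pconst (c 1) * pvar (f $ 1) + pconst (c 2) * pvar (f $ 2) + pconst (c 3) * pvar (f $ 3)"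
    by (simp add: lin_def sum_3 Phi.add Phi.mult Phi_pconst Phi_pvar)
  have "pvar (?x 1 + ?x 2 + ?x 3) - pvar (?x 1 + ?x 2) - pvar (?x 3) \<in> J"
    "pvar (?x 1 + ?x 2) - pvar (?x 1) - pvar (?x 2) \<in> J"
    by (intro J_relators I_closed(1) xI)+
  from J_closed(2)[OF this] have "pvar (?x 1 + ?x 2 + ?x 3) - pvar (?x 1) - pvar (?x 2) - pvar (?x 3) \<in> J"
    by (simp add: algebra_simps)
  moreover have "(pvar (?x 1) - pconst (c 1) * pvar (f $ 1)) + (pvar (?x 2) - pconst (c 2) * pvar (f $ 2)) +
      (pvar (?x 3) - pconst (c 3) * pvar (f $ 3)) \<in> J"
    by (intro J_closed(2) J_relators(2) I_closed(3))
  ultimately have "pvar (?x 1 + ?x 2 + ?x 3) - \<Phi> (lin c) \<in> J"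
    unfolding l using J_closed(2) by (force simp: algebra_simps)
  then show ?thesis using J_closed(4) unfolding s by fastforce
qed

lemma pvar_zero_in_J: "pvar 0 \<in> J"
  using J_closed(4)[OF J_relators(1)[OF I_closed(4) I_closed(4)]] by simp

lemma Phi_g: "\<Phi> g1 \<in> J" "\<Phi> g2 \<in> J"
proof -
  have *: "\<Phi> (lin c) \<in> J" if "(\<Sum>i\<in>UNIV. f $ i * c i) = 0" for c
    using J_closed(2)[OF Phi_lin[of c] pvar_zero_in_J] that by simp
  show "\<Phi> g1 \<in> J" "\<Phi> g2 \<in> J"
    unfolding g1_def g2_def by (intro * column_syzygies)+
qed

definition coef :: "'k rpoly \<Rightarrow> 3 \<Rightarrow> 'k rpoly" where
  "coef a = (SOME c. a = (\<Sum>i\<in>UNIV. f $ i * c i))"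

lemma coef: "a \<in> I \<Longrightarrow> (\<Sum>i\<in>UNIV. f $ i * coef a i) = a"
  using someI_ex[of "\<lambda>c. a = (\<Sum>i\<in>UNIV. f $ i * c i)"] unfolding coef_def I_iff by simp

definition \<Psi> :: "(('k rpoly \<Rightarrow>\<^sub>0 nat) \<Rightarrow>\<^sub>0 'k rpoly) \<Rightarrow> 'k spoly" where
  "\<Psi> = psubst pconst (\<lambda>a. lin (coef a))"

lemma Psi_ring_map: "ring_map \<Psi>"
  unfolding \<Psi>_def by (intro psubst_ring_map pconst_ring_map)

sublocale Psi: ring_map \<Psi> by (rule Psi_ring_map)

lemma Psi_pconst: "\<Psi> (pconst r) = pconst r" and Psi_pvar: "\<Psi> (pvar a) = lin (coef a)"
  by (simp_all add: \<Psi>_def psubst_pconst psubst_pvar pconst_ring_map)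

lemma Phi_Psi:
  assumes "p \<in> polys_in I"
  shows "p - \<Phi> (\<Psi> p) \<in> J"
proof -
  have "p \<in> polys_in I \<and> \<Phi> (\<Psi> p) \<in> polys_in I \<and> p - \<Phi> (\<Psi> p) \<in> J"
  proof (rule ring_map_cong_mod[OF ring_map_id ring_map_compose[OF Psi_ring_map Phi_ring_map] assms])
    fix v assume v: "v \<in> I"
    have "- (\<Phi> (lin (coef v)) - pvar v) \<in> J"
      using J_closed(4)[OF Phi_lin[of "coef v"]] coef[OF v] by simp
    then show "pvar v \<in> polys_in I \<and> \<Phi> (\<Psi> (pvar v)) \<in> polys_in I \<and> pvar v - \<Phi> (\<Psi> (pvar v)) \<in> J"
      using v by (simp add: Psi_pvar Phi_in polys_in_closed)
  qed (auto simp: polys_in_closed J_closed Psi_pconst Phi_pconst)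
  then show ?thesis by blast
qed

end

context height_two_ideal
begin

lemma lin_syzygy_eq_ideal: "(\<Sum>i\<in>UNIV. f $ i * s i) = 0 \<Longrightarrow> lin s \<in> eq_ideal"
  using lin_syzygy unfolding eq_ideal_def by blast

text \<open>
  Expressions of one element in the generators differ by a syzygy, and syzygies give linear forms in
  \<open>(g1, g2)\<close>; so \<open>\<Psi>\<close> respects the relators whatever expressions were chosen.
\<close>

lemma Psi_J:
  assumes "p \<in> J"
  shows "\<Psi> p \<in> eq_ideal"
proof (rule sym_rel_induct[OF Psi_ring_map eq_ideal_closed sym_relators_in _ assms])
  fix r assume "r \<in> sym_relators Imod"
  then consider a b where "a \<in> I" "b \<in> I" "r = pvar (a + b) - pvar a - pvar b"
    | c a where "a \<in> I" "r = pvar (c * a) - pconst c * pvar a"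
    unfolding sym_relators_def by (auto simp: ideal_as_module_def)
  then show "\<Psi> r \<in> eq_ideal"
  proof cases
    case 1
    have "lin (\<lambda>i. coef (a + b) i - coef a i - coef b i) \<in> eq_ideal"
      by (rule lin_syzygy_eq_ideal) (simp add: right_diff_distrib sum_subtractf coef 1 I_closed)
    then show ?thesis unfolding 1(3) by (simp add: Psi.diff Psi_pvar lin_diff)
  next
    case 2
    have "(\<Sum>i\<in>UNIV. f $ i * (c * coef a i)) = c * (\<Sum>i\<in>UNIV. f $ i * coef a i)"
      by (simp add: sum_distrib_left mult.left_commute)
    then have "lin (\<lambda>i. coef (c * a) i - c * coef a i) \<in> eq_ideal"
      by (intro lin_syzygy_eq_ideal) (simp add: right_diff_distrib sum_subtractf coef 2 I_closed)
    then show ?thesis unfolding 2(2) by (simp add: Psi.diff Psi.mult Psi_pvar Psi_pconst lin_diff lin_scale)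
  qed
qed

lemma Psi_Phi: "\<Psi> (\<Phi> s) - s \<in> eq_ideal"
proof -
  have "\<Psi> (\<Phi> s) \<in> UNIV \<and> s \<in> UNIV \<and> \<Psi> (\<Phi> s) - s \<in> eq_ideal"
  proof (rule ring_map_cong_mod[OF ring_map_compose[OF Phi_ring_map Psi_ring_map] ring_map_id, where V = UNIV])
    fix j :: 3
    have "(\<Sum>i\<in>UNIV. f $ i * (coef (f $ j) i - (if i = j then 1 else 0))) =
        (\<Sum>i\<in>UNIV. f $ i * coef (f $ j) i) - (\<Sum>i\<in>UNIV. if i = j then f $ j else 0)"
      unfolding sum_subtractf[symmetric] by (intro sum.cong) (auto simp: algebra_simps)
    then have "lin (\<lambda>i. coef (f $ j) i - (if i = j then 1 else 0)) \<in> eq_ideal"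
      by (intro lin_syzygy_eq_ideal) (simp add: coef I_closed)
    then show "\<Psi> (\<Phi> (pvar j)) \<in> UNIV \<and> pvar j \<in> UNIV \<and> \<Psi> (\<Phi> (pvar j)) - pvar j \<in> eq_ideal"
      by (simp add: Phi_pvar Psi_pvar lin_diff lin_delta pconst.one)
  qed (auto simp: eq_ideal_closed Phi_pconst Psi_pconst)
  then show ?thesis by blast
qed

lemma Phi_in_J_iff: "\<Phi> s \<in> J \<longleftrightarrow> s \<in> eq_ideal"
proof
  assume "\<Phi> s \<in> J"
  then have "\<Psi> (\<Phi> s) \<in> eq_ideal" by (rule Psi_J)
  moreover have "(- 1) * (\<Psi> (\<Phi> s) - s) \<in> eq_ideal" by (intro eq_ideal_closed Psi_Phi)
  ultimately have "\<Psi> (\<Phi> s) + (- 1) * (\<Psi> (\<Phi> s) - s) \<in> eq_ideal" by (rule eq_ideal_closed)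
  then show "s \<in> eq_ideal" by simp
next
  assume "s \<in> eq_ideal"
  then obtain a b where "s = a * g1 + b * g2" unfolding eq_ideal_def by blast
  then show "\<Phi> s \<in> J" by (simp add: Phi.add Phi.mult J_closed Phi_in Phi_g)
qed

abbreviation "\<kappa> \<equiv> S_to_sym I f"

lemma coset_J: "J +>\<^bsub>sym_free Imod\<^esub> p = (\<lambda>j. j + p) ` J"
  by (auto simp: a_r_coset_def')

lemma kappa_eq: "\<kappa> s = (\<lambda>j. j + \<Phi> s) ` J"
  by (simp add: S_to_sym_def coset_J \<Phi>_def)

lemma coset_J_eq_iff: "(\<lambda>j. j + p) ` J = (\<lambda>j. j + q) ` J \<longleftrightarrow> p - q \<in> J"
proof
  assume *: "(\<lambda>j. j + p) ` J = (\<lambda>j. j + q) ` J"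
  have "0 + p \<in> (\<lambda>j. j + p) ` J" using J_closed(1) by (rule imageI)
  then have "p \<in> (\<lambda>j. j + q) ` J" using * by simp
  then show "p - q \<in> J" by auto
next
  assume *: "p - q \<in> J"
  have sub: "(\<lambda>j. j + a) ` J \<subseteq> (\<lambda>j. j + b) ` J" if "a - b \<in> J" for a b
  proof
    fix x assume "x \<in> (\<lambda>j. j + a) ` J"
    then obtain j where "j \<in> J" "x = j + a" by blast
    then have "x = (j + (a - b)) + b" "j + (a - b) \<in> J" using J_closed(2)[OF _ that] by simp_all
    then show "x \<in> (\<lambda>j. j + b) ` J" by blast
  qed
  have "q - p \<in> J" using J_closed(4)[OF *] by simp
  with * sub show "(\<lambda>j. j + p) ` J = (\<lambda>j. j + q) ` J" by blast
qed

lemma kappa_eq_iff: "\<kappa> s = \<kappa> s' \<longleftrightarrow> s - s' \<in> eq_ideal"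
  unfolding kappa_eq coset_J_eq_iff using Phi_in_J_iff[of "s - s'"] by (simp add: Phi.diff)

abbreviation "Sym \<equiv> sym_alg Imod"

lemma Sym_carrier: "carrier Sym = range \<kappa>"
proof -
  have "carrier Sym = {J +>\<^bsub>sym_free Imod\<^esub> p |p. p \<in> polys_in I}"
    by (auto simp: sym_alg_def FactRing_def A_RCOSETS_def')
  also have "\<dots> = range \<kappa>"
  proof (intro equalityI subsetI)
    fix A assume "A \<in> {J +>\<^bsub>sym_free Imod\<^esub> p |p. p \<in> polys_in I}"
    then obtain p where p: "p \<in> polys_in I" "A = (\<lambda>j. j + p) ` J" unfolding coset_J by blast
    have "A = \<kappa> (\<Psi> p)" unfolding p(2) kappa_eq coset_J_eq_iff by (rule Phi_Psi[OF p(1)])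
    then show "A \<in> range \<kappa>" by blast
  next
    fix A assume "A \<in> range \<kappa>"
    then show "A \<in> {J +>\<^bsub>sym_free Imod\<^esub> p |p. p \<in> polys_in I}"
      unfolding coset_J kappa_eq using Phi_in by blast
  qed
  finally show ?thesis .
qed

lemma kappa_hom: "\<kappa> (s + s') = \<kappa> s \<oplus>\<^bsub>Sym\<^esub> \<kappa> s'" "\<kappa> (s * s') = \<kappa> s \<otimes>\<^bsub>Sym\<^esub> \<kappa> s'"
proof -
  interpret ideal J "sym_free Imod" by (rule ideal_J)
  have h: "(+>\<^bsub>sym_free Imod\<^esub>) J \<in> ring_hom (sym_free Imod) Sym"
    unfolding sym_alg_def by (rule rcos_ring_hom)
  have \<kappa>: "\<kappa> s = J +>\<^bsub>sym_free Imod\<^esub> \<Phi> s" for s by (simp add: S_to_sym_def \<Phi>_def)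
  show "\<kappa> (s + s') = \<kappa> s \<oplus>\<^bsub>Sym\<^esub> \<kappa> s'"
    using ring_hom_add[OF h, of "\<Phi> s" "\<Phi> s'"] by (simp add: \<kappa> Phi.add Phi_in)
  show "\<kappa> (s * s') = \<kappa> s \<otimes>\<^bsub>Sym\<^esub> \<kappa> s'"
    using ring_hom_mult[OF h, of "\<Phi> s" "\<Phi> s'"] by (simp add: \<kappa> Phi.mult Phi_in)
qed

lemma kappa_zero: "\<kappa> 0 = \<zero>\<^bsub>Sym\<^esub>"
  by (simp add: kappa_eq sym_alg_def FactRing_def)

text \<open>
  \<^const>\<open>sym_to_rees\<close> picks the only element of the image of a coset, so the underlying substitution
  has to be constant on cosets.
\<close>

lemma sym_to_rees_kappa: "sym_to_rees (\<kappa> s) = rees_eval f s"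
proof -
  define E :: "(('a rpoly \<Rightarrow>\<^sub>0 nat) \<Rightarrow>\<^sub>0 'a rpoly) \<Rightarrow> 'a rpoly poly"
    where "E = psubst (\<lambda>r. [:r:]) (\<lambda>a. Polynomial.monom a 1)"
  have E: "ring_map E" unfolding E_def by (intro psubst_ring_map const_poly_ring_map)
  interpret E: ring_map E by (rule E)
  have var: "E (pvar a) = Polynomial.monom a 1" and const: "E (pconst r) = [:r:]" for a r
    by (simp_all add: E_def psubst_pvar psubst_pconst const_poly_ring_map)
  have "E j \<in> {0}" if "j \<in> J" for j
  proof (rule sym_rel_induct[OF E _ _ _ sym_relators_in _ that])
    fix r assume "r \<in> sym_relators Imod"
    then show "E r \<in> {0}"
      unfolding sym_relators_def
      by (auto simp: ideal_as_module_def E.diff E.mult var const add_monom[symmetric] smult_monom)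
  qed auto
  then have "E ` \<kappa> s = {E (\<Phi> s)}"
    using J_closed(1) unfolding kappa_eq image_image by (auto simp: E.add)
  moreover have "E (\<Phi> s) = rees_eval f s"
    by (rule ring_map_eqI[OF ring_map_compose[OF Phi_ring_map E] rees_eval_ring_map, where V = UNIV])
       (simp_all add: Phi_pconst Phi_pvar var const rees_eval_def psubst_pvar psubst_pconst const_poly_ring_map)
  ultimately show ?thesis by (simp add: sym_to_rees_def E_def)
qed

abbreviation "Ker \<equiv> rees_kernel I f"

lemma Ker_ops:
  "\<zero>\<^bsub>Ker\<^esub> = \<zero>\<^bsub>Sym\<^esub>" "x \<oplus>\<^bsub>Ker\<^esub> y = x \<oplus>\<^bsub>Sym\<^esub> y" "s \<odot>\<^bsub>Ker\<^esub> x = \<kappa> s \<otimes>\<^bsub>Sym\<^esub> x"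
  by (simp_all add: rees_kernel_def submod_def sym_module_def Let_def)

lemma Ker_carrier: "carrier Ker = \<kappa> ` torsion"
proof -
  have "carrier Ker = {x \<in> range \<kappa>. sym_to_rees x = 0}"
    by (simp add: rees_kernel_def submod_def a_kernel_def' Sym_carrier rees_alg_def)
  then show ?thesis unfolding torsion_eq by (auto simp: sym_to_rees_kappa)
qed

lemma torsion_closed:
  "0 \<in> torsion" "s \<in> torsion \<Longrightarrow> t \<in> torsion \<Longrightarrow> s + t \<in> torsion" "t \<in> torsion \<Longrightarrow> s * t \<in> torsion"
proof -
  interpret e: ring_map "rees_eval f" by (rule rees_eval_ring_map)
  show "0 \<in> torsion" "s \<in> torsion \<Longrightarrow> t \<in> torsion \<Longrightarrow> s + t \<in> torsion" "t \<in> torsion \<Longrightarrow> s * t \<in> torsion"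
    unfolding torsion_eq by (simp_all add: e.add e.mult)
qed

lemma Ker_piece: "piece Ker p q = \<kappa> ` (torsion \<inter> S_piece p q)"
proof -
  have "piece Ker p q = \<kappa> ` S_piece p q \<inter> {x \<in> range \<kappa>. sym_to_rees x = 0}"
    by (simp add: rees_kernel_def submod_def a_kernel_def' Sym_carrier rees_alg_def sym_module_def Let_def)
  then show ?thesis unfolding torsion_eq by (auto simp: sym_to_rees_kappa)
qed

lemma kappa_zero_iff: "\<kappa> s = \<zero>\<^bsub>Ker\<^esub> \<longleftrightarrow> s \<in> eq_ideal"
  using kappa_eq_iff[of s 0] by (simp add: Ker_ops kappa_zero)

lemma Ker_presented: "graded_presented_module Ker (\<lambda>_. torsion) (\<lambda>_. \<kappa>) 1 0 0 0"
proof
  show "1 \<in> S_piece 0 0" using S_piece_power[of 0 0 0 0] by simp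
qed (auto simp: torsion_closed Ker_carrier Ker_ops kappa_zero kappa_hom Ker_piece bicomp_torsion
      kappa_zero_iff[unfolded Ker_ops] bicomp_eq_ideal)

end

section \<open>Localizations of the polynomial ring\<close>

lemma S_module_simps [simp]:
  "carrier S_module = UNIV" "\<zero>\<^bsub>S_module\<^esub> = 0" "a \<oplus>\<^bsub>S_module\<^esub> b = a + b" "a \<odot>\<^bsub>S_module\<^esub> b = a * b"
  "piece S_module = S_piece"
  by (simp_all add: S_module_def)

abbreviation "fr \<equiv> frac S_module"
abbreviation "loc \<equiv> localization S_module"

lemma frac_mem_iff:
  assumes "s \<noteq> 0"
  shows "(n, j) \<in> fr s m i \<longleftrightarrow> s ^ j * m = s ^ i * n"
proof -
  have "(s ^ (k + j) * m = s ^ (k + i) * n) \<longleftrightarrow> s ^ j * m = s ^ i * n" for k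
    using assms by (simp add: power_add mult.assoc)
  then show ?thesis by (simp add: frac_def frac_rel_def)
qed

lemma frac_eq_iff:
  assumes "s \<noteq> 0"
  shows "fr s m i = fr s n j \<longleftrightarrow> s ^ j * m = s ^ i * n"
proof
  assume *: "fr s m i = fr s n j"
  have "(n, j) \<in> fr s n j" by (simp add: frac_mem_iff assms)
  then show "s ^ j * m = s ^ i * n" unfolding *[symmetric] by (simp add: frac_mem_iff assms)
next
  assume eq: "s ^ j * m = s ^ i * n"
  have "s ^ b * m = s ^ i * a \<longleftrightarrow> s ^ b * n = s ^ j * a" for a b
  proof -
    have "s ^ b * m = s ^ i * a \<longleftrightarrow> s ^ j * (s ^ b * m) = s ^ j * (s ^ i * a)" using assms by simp
    also have "s ^ j * (s ^ b * m) = s ^ b * (s ^ j * m)" by (rule mult.left_commute)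
    also have "\<dots> = s ^ i * (s ^ b * n)" unfolding eq by (rule mult.left_commute)
    also have "s ^ j * (s ^ i * a) = s ^ i * (s ^ j * a)" by (rule mult.left_commute)
    finally show ?thesis using assms by simp
  qed
  then have "(a, b) \<in> fr s m i \<longleftrightarrow> (a, b) \<in> fr s n j" for a b
    by (simp add: frac_mem_iff assms)
  then show "fr s m i = fr s n j" by auto
qed

lemma loc_carrier: "carrier (loc s e) = {fr s m i |m i. True}"
  by (auto simp: localization_def frac_def quotient_def)

lemma loc_zero: "\<zero>\<^bsub>loc s e\<^esub> = fr s 0 0"
  by (simp add: localization_def)

text \<open>
  The operations of a localization are unions over all representatives; this lemma evaluates them.
\<close>

lemma UN_constant_pair:
  assumes "A \<noteq> {}" "\<And>m i. (m, i) \<in> A \<Longrightarrow> u m i = c"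
  shows "(\<Union>(m, i)\<in>A. u m i) = c"
  using assms by fastforce

lemma frac_nonempty: "s \<noteq> 0 \<Longrightarrow> fr s m i \<noteq> {}"
  using frac_mem_iff[of s m i m i] by auto

lemma loc_add:
  assumes "s \<noteq> 0"
  shows "fr s m i \<oplus>\<^bsub>loc s e\<^esub> fr s n j =
    fr s (s ^ j * m + s ^ i * n) (i + j)"
proof -
  have "(\<Union>(m', i')\<in>fr s m i. \<Union>(n', j')\<in>fr s n j.
      fr s (s ^ j' * m' + s ^ i' * n') (i' + j')) =
      fr s (s ^ j * m + s ^ i * n) (i + j)"
  proof (intro UN_constant_pair frac_nonempty assms)
    fix m' i' n' j'
    assume "(m', i') \<in> fr s m i" "(n', j') \<in> fr s n j"
    then have 1: "s ^ i' * m = s ^ i * m'" and 2: "s ^ j' * n = s ^ j * n'"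
      by (simp_all add: frac_mem_iff assms)
    have "s ^ (i + j) * (s ^ j' * m' + s ^ i' * n') =
        s ^ j * s ^ j' * (s ^ i * m') + s ^ i * s ^ i' * (s ^ j * n')"
      by (simp add: power_add algebra_simps)
    also have "\<dots> = s ^ (i' + j') * (s ^ j * m + s ^ i * n)"
      unfolding 1[symmetric] 2[symmetric] by (simp add: power_add algebra_simps)
    finally show "fr s (s ^ j' * m' + s ^ i' * n') (i' + j') =
        fr s (s ^ j * m + s ^ i * n) (i + j)"
      by (simp add: frac_eq_iff assms)
  qed
  then show ?thesis by (simp add: localization_def)
qed

lemma loc_smult:
  assumes "s \<noteq> 0"
  shows "r \<odot>\<^bsub>loc s e\<^esub> fr s m i = fr s (r * m) i"
proof -
  have "(\<Union>(m', i')\<in>fr s m i. fr s (r * m') i') = fr s (r * m) i"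
    by (intro UN_constant_pair frac_nonempty assms)
       (simp add: frac_mem_iff frac_eq_iff assms mult.left_commute[of _ r])
  then show ?thesis by (simp add: localization_def)
qed

lemma loc_map_frac:
  assumes "s \<noteq> 0" "t \<noteq> 0"
  shows "loc_map S_module s t (fr s m i) = fr (s * t) (t ^ i * m) i"
proof -
  have "(\<Union>(m', i')\<in>fr s m i. fr (s * t) (t ^ i' * m') i') =
      fr (s * t) (t ^ i * m) i"
  proof (intro UN_constant_pair frac_nonempty assms)
    fix m' i' assume "(m', i') \<in> fr s m i"
    then have 1: "s ^ i' * m = s ^ i * m'" by (simp add: frac_mem_iff assms)
    have "(s * t) ^ i * (t ^ i' * m') = t ^ i * t ^ i' * (s ^ i * m')"
      by (simp add: power_mult_distrib mult_ac)
    also have "\<dots> = (s * t) ^ i' * (t ^ i * m)"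
      unfolding 1[symmetric] by (simp add: power_mult_distrib mult_ac)
    finally show "fr (s * t) (t ^ i' * m') i' = fr (s * t) (t ^ i * m) i"
      using assms by (simp add: frac_eq_iff)
  qed
  then show ?thesis by (simp add: loc_map_def)
qed

lemma frac_add_same:
  "s \<noteq> 0 \<Longrightarrow> fr s m i \<oplus>\<^bsub>loc s e\<^esub> fr s n i = fr s (m + n) i"
  by (simp add: loc_add frac_eq_iff power_add algebra_simps)

lemma frac_zero: "s \<noteq> 0 \<Longrightarrow> fr s 0 i = fr s 0 0"
  by (simp add: frac_eq_iff)

lemma frac_step: "s \<noteq> 0 \<Longrightarrow> fr s (s * m) (Suc i) = fr s m i"
  by (simp add: frac_eq_iff mult_ac)

lemma loc_presented:
  assumes "s \<noteq> 0"
  shows "presented_module (loc s e) (\<lambda>_. UNIV) (\<lambda>n w. fr s w n) s"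
proof
  show "fr s 0 n = \<zero>\<^bsub>loc s e\<^esub>" for n
    unfolding loc_zero by (rule frac_zero[OF assms])
qed (auto simp: loc_carrier frac_add_same loc_smult frac_step assms)

section \<open>The top local cohomology of the polynomial ring\<close>

lemma card_2_sets: "{\<sigma> :: 2 set. card \<sigma> = 2} = {UNIV}"
proof -
  have "\<sigma> = UNIV" if "card \<sigma> = 2" for \<sigma> :: "2 set"
    using that by (intro card_subset_eq) auto
  then show ?thesis by auto
qed

lemma card_1_sets: "{\<sigma> :: 2 set. card \<sigma> = Suc 0} = {{1}, {2}}"
proof -
  have "\<sigma> = {1} \<or> \<sigma> = {2}" if \<sigma>: "card \<sigma> = Suc 0" for \<sigma> :: "2 set"
  proof -
    obtain v where "\<sigma> = {v}" using \<sigma> by (auto simp: card_Suc_eq)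
    then show ?thesis using exhaust_2[of v] by auto
  qed
  then show ?thesis by auto
qed

lemma card_3_sets: "{\<sigma> :: 2 set. card \<sigma> = 3} = {}"
proof -
  have "card \<sigma> \<le> 2" for \<sigma> :: "2 set" using card_mono[of UNIV \<sigma>] by simp
  then have "card \<sigma> \<noteq> 3" for \<sigma> :: "2 set" by (rule order.strict_implies_not_eq[OF le_less_trans]) simp
  then show ?thesis by blast
qed

lemma card_2: "card (UNIV :: 2 set) = 2"
  by simp

abbreviation "x12 \<equiv> xvar 1 * xvar 2"

lemma xprod_simps: "xprod UNIV = x12" "xprod {v} = xvar v" "xprod (UNIV - {1}) = xvar 2" "xprod (UNIV - {2}) = xvar 1"
proof -
  have "UNIV - {1} = {2 :: 2}" "UNIV - {2} = {1 :: 2}" by (auto simp: UNIV_2)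
  then show "xprod UNIV = x12" "xprod {v} = xvar v" "xprod (UNIV - {1}) = xvar 2" "xprod (UNIV - {2}) = xvar 1"
    by (simp_all add: xprod_def UNIV_2)
qed

lemma x12_nz: "x12 \<noteq> 0"
  by simp

text \<open>
  The cochain with value \<open>w / (x\<^sub>1 x\<^sub>2)\<^sup>n\<close>; the only index set of cardinality two is the set of both
  indices.
\<close>

definition top_cochain :: "nat \<Rightarrow> 'k::field spoly \<Rightarrow> 2 set \<Rightarrow> ('k spoly \<times> nat) set" where
  "top_cochain n w = (\<lambda>\<sigma>\<in>{UNIV}. fr x12 w n)"

abbreviation "top_cech \<equiv> submod (cech S_module 2) (cocycles S_module 2)"

lemma top_cochain_UNIV: "top_cochain n w UNIV = fr x12 w n"
  by (simp add: top_cochain_def)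

lemma top_cochain_cases:
  assumes "c \<in> (\<Pi>\<^sub>E \<sigma>\<in>{UNIV}. F \<sigma>)" "c UNIV = fr x12 w n"
  shows "c = top_cochain n w"
proof
  fix \<sigma> show "c \<sigma> = top_cochain n w \<sigma>"
  proof (cases "\<sigma> = UNIV")
    case True
    then show ?thesis by (simp only: top_cochain_UNIV assms(2))
  next
    case False
    then have "c \<sigma> = undefined" using PiE_arb[OF assms(1)] by simp
    also have "undefined = top_cochain n w \<sigma>" using False by (simp add: top_cochain_def)
    finally show ?thesis .
  qed
qed

lemma top_cech_carrier:
  "carrier (top_cech :: ('k::field spoly, _) bigraded) = (\<Union>n. range (top_cochain n))"
proof -
  have "cocycles S_module 2 = carrier (cech (S_module :: ('k spoly, _) bigraded) 2)"
    unfolding cocycles_def a_kernel_def' cech_diff_def by (simp add: cech_def card_3_sets restrict_def)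
  then have "carrier top_cech = carrier (cech (S_module :: ('k spoly, _) bigraded) 2)"
    by (simp add: submod_def)
  also have "\<dots> = (\<Pi>\<^sub>E \<sigma>\<in>{UNIV}. carrier (loc_at S_module \<sigma>))"
    by (simp add: cech_def card_2_sets)
  also have "\<dots> = (\<Union>n. range (top_cochain n))"
  proof (intro equalityI subsetI)
    fix c assume c: "c \<in> (\<Pi>\<^sub>E \<sigma>\<in>{UNIV}. carrier (loc_at (S_module :: ('k spoly, _) bigraded) \<sigma>))"
    then have "c UNIV \<in> carrier (loc_at S_module UNIV)" by (rule PiE_mem) simp
    then obtain w n where "c UNIV = fr x12 w n"
      by (auto simp: loc_carrier xprod_simps)
    from top_cochain_cases[OF c this] show "c \<in> (\<Union>n. range (top_cochain n))" by blast
  next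
    fix c :: "2 set \<Rightarrow> ('k spoly \<times> nat) set" assume "c \<in> (\<Union>n. range (top_cochain n))"
    then obtain n w where c: "c = top_cochain n w" by blast
    have "fr x12 w n \<in> carrier (loc_at S_module UNIV)"
      unfolding loc_carrier xprod_simps(1) by blast
    then show "c \<in> (\<Pi>\<^sub>E \<sigma>\<in>{UNIV}. carrier (loc_at S_module \<sigma>))"
      unfolding c top_cochain_def restrict_PiE_iff by blast
  qed
  finally show ?thesis .
qed

lemma top_cech_ops:
  "\<zero>\<^bsub>top_cech\<^esub> = top_cochain 0 0"
  "top_cochain n w \<oplus>\<^bsub>top_cech\<^esub> top_cochain n w' = top_cochain n (w + w')"
  "s \<odot>\<^bsub>top_cech\<^esub> top_cochain n w = top_cochain n (s * w)"
proof -
  have ops: "\<zero>\<^bsub>top_cech\<^esub> = (\<lambda>\<sigma>\<in>{UNIV}. \<zero>\<^bsub>loc (xprod \<sigma>) (card \<sigma>)\<^esub>)"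
    "c \<oplus>\<^bsub>top_cech\<^esub> c' = (\<lambda>\<sigma>\<in>{UNIV}. c \<sigma> \<oplus>\<^bsub>loc (xprod \<sigma>) (card \<sigma>)\<^esub> c' \<sigma>)"
    "s \<odot>\<^bsub>top_cech\<^esub> c = (\<lambda>\<sigma>\<in>{UNIV}. s \<odot>\<^bsub>loc (xprod \<sigma>) (card \<sigma>)\<^esub> c \<sigma>)"
    for c c' by (simp_all add: submod_def cech_def card_2_sets)
  show "\<zero>\<^bsub>top_cech\<^esub> = top_cochain 0 0"
    unfolding ops top_cochain_def by (intro restrict_ext) (simp only: singleton_iff loc_zero xprod_simps(1))
  show "top_cochain n w \<oplus>\<^bsub>top_cech\<^esub> top_cochain n w' = top_cochain n (w + w')"
    unfolding ops top_cochain_def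
    by (intro restrict_ext) (simp only: singleton_iff restrict_apply' xprod_simps(1) frac_add_same[OF x12_nz])
  show "s \<odot>\<^bsub>top_cech\<^esub> top_cochain n w = top_cochain n (s * w)"
    unfolding ops top_cochain_def
    by (intro restrict_ext) (simp only: singleton_iff restrict_apply' xprod_simps(1) loc_smult[OF x12_nz])
qed

lemma top_cochain_eq_iff: "top_cochain n w = top_cochain m u \<longleftrightarrow> x12 ^ m * w = x12 ^ n * u"
proof
  assume "top_cochain n w = top_cochain m u"
  then have "top_cochain n w UNIV = top_cochain m u UNIV" by (rule fun_cong)
  then show "x12 ^ m * w = x12 ^ n * u"
    unfolding top_cochain_UNIV by (rule iffD1[OF frac_eq_iff[OF x12_nz]])
next
  assume "x12 ^ m * w = x12 ^ n * u"
  then have "fr x12 w n = fr x12 u m"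
    by (rule iffD2[OF frac_eq_iff[OF x12_nz]])
  then show "top_cochain n w = top_cochain m u" by (simp only: top_cochain_def)
qed

lemma top_cech_presented: "presented_module top_cech (\<lambda>_. UNIV) top_cochain x12"
  by unfold_locales (auto simp: top_cech_carrier top_cech_ops top_cochain_eq_iff mult_ac)

interpretation TC: presented_module top_cech "\<lambda>_. UNIV" top_cochain x12
  by (rule top_cech_presented)

text \<open>
  The signs of the Cech differential enter only through the fact that they square to one, so they stay
  abstract.
\<close>

lemma cech_diff_1:
  fixes a b :: "'k::field spoly"
  obtains \<epsilon> \<delta> :: "'k spoly" where "\<epsilon> * \<epsilon> = 1" "\<delta> * \<delta> = 1"
    "\<And>c :: 2 set \<Rightarrow> ('k spoly \<times> nat) set. \<And>a b i j. c {2} = fr (xvar 2) a i \<Longrightarrow> c {1} = fr (xvar 1) b j \<Longrightarrow>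
       cech_diff S_module 1 c = top_cochain (i + j)
         (x12 ^ j * (\<epsilon> * (xvar 1 ^ i * a)) + x12 ^ i * (\<delta> * (xvar 2 ^ j * b)))"
proof
  define \<epsilon> :: "2 \<Rightarrow> 'k spoly" where "\<epsilon> v = (- 1) ^ card {u \<in> UNIV. u < v}" for v
  show "\<epsilon> 1 * \<epsilon> 1 = 1" "\<epsilon> 2 * \<epsilon> 2 = 1"
    unfolding \<epsilon>_def by (simp_all flip: power_mult_distrib)
  interpret L: presented_module "loc x12 2 :: ('k spoly, _) bigraded" "\<lambda>_. UNIV"
    "\<lambda>n w. fr x12 w n" x12
    by (rule loc_presented) simp
  fix c :: "2 set \<Rightarrow> ('k spoly \<times> nat) set" and a b i j
  assume c: "c {2} = fr (xvar 2) a i" "c {1} = fr (xvar 1) b j"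
  let ?t = "\<lambda>v. \<epsilon> v \<odot>\<^bsub>loc x12 2\<^esub>
     loc_map S_module (xprod (UNIV - {v})) (xvar v) (c (UNIV - {v}))"
  have sets: "UNIV - {1} = {2 :: 2}" "UNIV - {2} = {1 :: 2}" by (auto simp: UNIV_2)
  have t: "?t 1 = fr x12 (\<epsilon> 1 * (xvar 1 ^ i * a)) i"
    "?t 2 = fr x12 (\<epsilon> 2 * (xvar 2 ^ j * b)) j"
    by (simp_all add: sets xprod_simps(2) c loc_map_frac mult.commute[of "xvar 2" "xvar 1"] loc_smult)
  have "finsum (loc x12 2) ?t UNIV = ?t 1 \<oplus>\<^bsub>loc x12 2\<^esub> ?t 2"
  proof -
    have mem: "fr x12 w n \<in> carrier (loc x12 2)" for w n
      by (auto simp: loc_carrier)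
    have "finsum (loc x12 2) ?t (insert 1 {2}) =
      ?t 1 \<oplus>\<^bsub>loc x12 2\<^esub> finsum (loc x12 2) ?t {2}"
      by (rule L.M.finsum_insert) (simp_all add: t mem)
    moreover have "finsum (loc x12 2) ?t {2} = ?t 2"
      by (simp add: t mem L.M.finsum_insert)
    ultimately show ?thesis unfolding UNIV_2 by simp
  qed
  also have "\<dots> = fr x12 (x12 ^ j * (\<epsilon> 1 * (xvar 1 ^ i * a)) + x12 ^ i * (\<epsilon> 2 * (xvar 2 ^ j * b))) (i + j)"
    unfolding t by (rule loc_add) simp
  finally show "cech_diff S_module 1 c = top_cochain (i + j)
      (x12 ^ j * (\<epsilon> 1 * (xvar 1 ^ i * a)) + x12 ^ i * (\<epsilon> 2 * (xvar 2 ^ j * b)))"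
    unfolding cech_diff_def top_cochain_def numeral_2_eq_2[symmetric] One_nat_def card_2_sets
    by (intro restrict_ext) (simp only: singleton_iff xprod_simps(1) \<epsilon>_def card_2)
qed

context height_two_ideal
begin

abbreviation S_mod :: "('a spoly, 'a spoly) bigraded" where "S_mod \<equiv> S_module"
abbreviation "B \<equiv> coboundaries S_mod 2"

text \<open>
  A sum of fractions with denominators \<open>x\<^sub>1\<^sup>n\<close> and \<open>x\<^sub>2\<^sup>n\<close> is a fraction with denominator
  \<open>(x\<^sub>1 x\<^sub>2)\<^sup>n\<close> and numerator in \<open>(x\<^sub>1\<^sup>n, x\<^sub>2\<^sup>n)\<close>.
\<close>

lemma B_eq: "B = {top_cochain n w |n w. w \<in> pow_ideal n}"
proof -
  obtain \<epsilon> \<delta> :: "'a spoly" where eps: "\<epsilon> * \<epsilon> = 1" "\<delta> * \<delta> = 1"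
    and diff: "\<And>c :: 2 set \<Rightarrow> ('a spoly \<times> nat) set. \<And>a b i j. c {2} = fr (xvar 2) a i \<Longrightarrow>
       c {1} = fr (xvar 1) b j \<Longrightarrow>
       cech_diff S_module 1 c = top_cochain (i + j)
         (x12 ^ j * (\<epsilon> * (xvar 1 ^ i * a)) + x12 ^ i * (\<delta> * (xvar 2 ^ j * b)))"
    using cech_diff_1 by blast
  have car: "carrier (cech S_module 1) = (\<Pi>\<^sub>E \<sigma>\<in>{{1}, {2}}. carrier (loc_at S_mod \<sigma>))"
    by (simp add: cech_def card_1_sets)
  have "B = cech_diff S_module 1 ` carrier (cech S_module 1)"
    by (simp add: coboundaries_def numeral_2_eq_2)
  also have "\<dots> = {top_cochain n w |n w. w \<in> pow_ideal n}"
  proof (intro equalityI subsetI)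
    fix z assume "z \<in> cech_diff S_module 1 ` carrier (cech S_mod 1)"
    then obtain c where c: "c \<in> carrier (cech S_mod 1)"
      "z = cech_diff S_module 1 c" by blast
    from c(1) have "c {1} \<in> carrier (loc_at S_module {1})" "c {2} \<in> carrier (loc_at S_module {2})"
      unfolding car by (rule PiE_mem, simp)+
    then obtain b j a i where ab: "c {1} = fr (xvar 1) b j" "c {2} = fr (xvar 2) a i"
      by (auto simp: loc_carrier xprod_simps(2))
    have "x12 ^ j * (\<epsilon> * (xvar 1 ^ i * a)) + x12 ^ i * (\<delta> * (xvar 2 ^ j * b)) =
        (xvar 2 ^ j * \<epsilon> * a) * xvar 1 ^ (i + j) + (xvar 1 ^ i * \<delta> * b) * xvar 2 ^ (i + j)"
      by (simp add: power_mult_distrib power_add algebra_simps)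
    then have "x12 ^ j * (\<epsilon> * (xvar 1 ^ i * a)) + x12 ^ i * (\<delta> * (xvar 2 ^ j * b)) \<in> pow_ideal (i + j)"
      unfolding pow_ideal_def by blast
    then show "z \<in> {top_cochain n w |n w. w \<in> pow_ideal n}"
      unfolding c(2) diff[OF ab(2,1)] by blast
  next
    fix z assume "z \<in> {top_cochain n w |n w. w \<in> pow_ideal n}"
    then obtain n w where z: "z = top_cochain n w" "w \<in> pow_ideal n" by blast
    then obtain a b where w: "w = a * xvar 1 ^ n + b * xvar 2 ^ n" unfolding pow_ideal_def by blast
    \<comment> \<open>the signs of the differential are cancelled by repeating them\<close>
    define c where "c = (\<lambda>\<sigma>\<in>{{1}, {2 :: 2}}. if \<sigma> = {1} then fr (xvar 1) (\<delta> * b) n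
      else fr (xvar 2) (\<epsilon> * a) n)"
    have c: "c {2} = fr (xvar 2) (\<epsilon> * a) n" "c {1} = fr (xvar 1) (\<delta> * b) n"
      by (simp_all add: c_def)
    have mem: "c \<in> carrier (cech S_module 1)"
      unfolding car c_def by (auto simp: loc_carrier xprod_simps(2))
    have signs: "\<epsilon> * (xvar 1 ^ n * (\<epsilon> * a)) = (\<epsilon> * \<epsilon>) * (xvar 1 ^ n * a)"
      "\<delta> * (xvar 2 ^ n * (\<delta> * b)) = (\<delta> * \<delta>) * (xvar 2 ^ n * b)" by (simp_all only: mult_ac)
    have "cech_diff S_module 1 c = top_cochain (n + n) (x12 ^ n * (xvar 1 ^ n * a) + x12 ^ n * (xvar 2 ^ n * b))"
      unfolding diff[OF c] signs eps by simp
    also have "\<dots> = z"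
      unfolding z top_cochain_eq_iff w by (simp add: power_add algebra_simps)
    finally show "z \<in> cech_diff S_module 1 ` carrier (cech S_module 1)" using mem by blast
  qed
  finally show ?thesis .
qed

lemma top_cochain_in_B: "top_cochain n w \<in> B \<longleftrightarrow> w \<in> pow_ideal n"
proof
  assume "top_cochain n w \<in> B"
  then obtain m u where u: "top_cochain n w = top_cochain m u" "u \<in> pow_ideal m" unfolding B_eq by blast
  have "x12 ^ n * u \<in> pow_ideal (m + n)" using u(2) by (simp add: pow_ideal_colon)
  then have "x12 ^ m * w \<in> pow_ideal (n + m)"
    using u(1) unfolding top_cochain_eq_iff by (simp add: add.commute)
  then show "w \<in> pow_ideal n" by (simp add: pow_ideal_colon)
qed (auto simp: B_eq)

lemma B_subgroup: "abelian_subgroup B top_cech"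
proof (rule abelian_subgroupI3)
  show "abelian_group (top_cech :: ('a spoly, _) bigraded)" by (rule TC.abelian_group_M)
  show "additive_subgroup B top_cech"
  proof (rule additive_subgroup.intro, rule TC.M.add.subgroupI)
    show "B \<subseteq> carrier top_cech" unfolding B_eq top_cech_carrier by blast
    have "top_cochain 0 0 \<in> B" by (simp add: top_cochain_in_B pow_ideal_closed)
    then show "B \<noteq> {}" by blast
  next
    fix x assume "x \<in> B"
    then obtain n w where w: "x = top_cochain n w" "w \<in> pow_ideal n" unfolding B_eq by blast
    have "\<ominus>\<^bsub>top_cech\<^esub> x = top_cochain n (- w)" unfolding w(1) by (rule TC.pi_uminus[symmetric]) simp
    moreover have "- w \<in> pow_ideal n" using pow_ideal_closed(3)[OF w(2), of "- 1"] by simp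
    ultimately show "\<ominus>\<^bsub>top_cech\<^esub> x \<in> B" by (simp add: top_cochain_in_B)
  next
    fix x y assume xy: "x \<in> B" "y \<in> B"
    obtain n w where w: "x = top_cochain n w" "w \<in> pow_ideal n" using xy(1) unfolding B_eq by blast
    obtain m u where u: "y = top_cochain m u" "u \<in> pow_ideal m" using xy(2) unfolding B_eq by blast
    have "x = top_cochain (n + m) (x12 ^ m * w)" "y = top_cochain (n + m) (x12 ^ n * u)"
      unfolding w u top_cochain_eq_iff by (simp_all add: power_add mult_ac)
    then have "x \<oplus>\<^bsub>top_cech\<^esub> y = top_cochain (n + m) (x12 ^ m * w + x12 ^ n * u)"
      by (simp only: top_cech_ops)
    moreover have "x12 ^ m * w + x12 ^ n * u \<in> pow_ideal (n + m)"
      using w(2) u(2) pow_ideal_colon[of m w n] pow_ideal_colon[of n u m]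
      by (intro pow_ideal_closed(2)) (simp_all add: add.commute)
    ultimately show "x \<oplus>\<^bsub>top_cech\<^esub> y \<in> B" by (simp add: top_cochain_in_B)
  qed
qed

sublocale B: abelian_subgroup B top_cech by (rule B_subgroup)

abbreviation "H0 \<equiv> local_cohomology 2 S_mod"

text \<open>
  The class of the fraction \<open>w / (x\<^sub>1 x\<^sub>2)\<^sup>n\<close>.
\<close>

definition cls :: "nat \<Rightarrow> 'a spoly \<Rightarrow> (2 set \<Rightarrow> ('a spoly \<times> nat) set) set" where
  "cls n w = B +>\<^bsub>top_cech\<^esub> top_cochain n w"

lemma top_cochain_carrier: "top_cochain n w \<in> carrier top_cech"
  by (auto simp: top_cech_carrier)

lemma H0_carrier: "carrier H0 = (\<Union>n. range (cls n))"
  by (auto simp: local_cohomology_def quotmod_def A_RCOSETS_def' top_cech_carrier cls_def)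

lemma H0_add: "cls n w \<oplus>\<^bsub>H0\<^esub> cls n w' = cls n (w + w')"
  using B.a_rcos_sum[OF top_cochain_carrier top_cochain_carrier, of n w n w']
  by (simp add: local_cohomology_def quotmod_def cls_def top_cech_ops)

lemma cls_zero_iff: "cls n w = \<zero>\<^bsub>H0\<^esub> \<longleftrightarrow> w \<in> pow_ideal n"
proof -
  have "cls n w = B \<longleftrightarrow> top_cochain n w \<in> B"
    unfolding cls_def
    using TC.M.a_coset_join1[OF _ top_cochain_carrier B.a_subgroup]
      TC.M.a_coset_join2[OF top_cochain_carrier B.a_subgroup] by blast
  then show ?thesis by (simp add: top_cochain_in_B local_cohomology_def quotmod_def)
qed

lemma H0_smult: "s \<odot>\<^bsub>H0\<^esub> cls n w = cls n (s * w)"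
proof -
  have "B +>\<^bsub>top_cech\<^esub> (s \<odot>\<^bsub>top_cech\<^esub> a) = cls n (s * w)" if a: "a \<in> cls n w" for a
  proof -
    obtain b where b: "b \<in> B" "a = b \<oplus>\<^bsub>top_cech\<^esub> top_cochain n w"
      using a unfolding cls_def a_r_coset_def' by blast
    then obtain m u where u: "b = top_cochain m u" "u \<in> pow_ideal m" unfolding B_eq by blast
    have eq: "b = top_cochain (n + m) (x12 ^ n * u)" "top_cochain n w = top_cochain (n + m) (x12 ^ m * w)"
      unfolding u top_cochain_eq_iff by (simp_all add: power_add mult_ac)
    have "s \<odot>\<^bsub>top_cech\<^esub> a = top_cochain (n + m) (s * (x12 ^ n * u)) \<oplus>\<^bsub>top_cech\<^esub> top_cochain (n + m) (s * (x12 ^ m * w))"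
      unfolding b(2) eq top_cech_ops by (simp add: distrib_left)
    moreover have "top_cochain (n + m) (s * (x12 ^ m * w)) = top_cochain n (s * w)"
      unfolding top_cochain_eq_iff by (simp add: power_add mult_ac)
    moreover have "x12 ^ n * u \<in> pow_ideal (n + m)"
      using u(2) pow_ideal_colon[of n u m] by (simp only: add.commute)
    then have "top_cochain (n + m) (s * (x12 ^ n * u)) \<in> B"
      unfolding top_cochain_in_B by (rule pow_ideal_closed(3))
    ultimately have "s \<odot>\<^bsub>top_cech\<^esub> a \<in> B +>\<^bsub>top_cech\<^esub> top_cochain n (s * w)"
      unfolding a_r_coset_def' by auto
    then show ?thesis
      unfolding cls_def
      by (rule TC.M.a_repr_independence[OF _ top_cochain_carrier B.a_subgroup, symmetric])
  qed
  moreover have "top_cochain n w \<in> cls n w"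
    unfolding cls_def by (rule B.a_rcos_self[OF top_cochain_carrier])
  ultimately have "(\<Union>a\<in>cls n w. B +>\<^bsub>top_cech\<^esub> (s \<odot>\<^bsub>top_cech\<^esub> a)) = cls n (s * w)" by blast
  then show ?thesis by (simp add: local_cohomology_def quotmod_def)
qed

lemma H0_piece: "piece H0 p q = (\<Union>n. cls n ` S_piece p (q + 2 * int n))"
proof -
  have "piece (top_cech :: ('a spoly, _) bigraded) p q =
      (\<Pi>\<^sub>E \<sigma>\<in>{UNIV}. piece (loc_at S_module \<sigma>) p q) \<inter> carrier top_cech"
    by (simp add: submod_def cech_def card_2_sets)
  also have "\<dots> = (\<Union>n. top_cochain n ` S_piece p (q + 2 * int n))"
  proof (intro equalityI subsetI)
    fix c assume "c \<in> (\<Pi>\<^sub>E \<sigma>\<in>{UNIV}. piece (loc_at S_mod \<sigma>) p q) \<inter> carrier top_cech"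
    then have c: "c \<in> (\<Pi>\<^sub>E \<sigma>\<in>{UNIV}. piece (loc_at S_mod \<sigma>) p q)" by blast
    then have "c UNIV \<in> piece (loc_at S_module UNIV) p q" by (rule PiE_mem) simp
    then obtain w n where w: "c UNIV = fr x12 w n" "w \<in> S_piece p (q + 2 * int n)"
      by (auto simp: localization_def xprod_simps mult.commute)
    from top_cochain_cases[OF c w(1)] w(2) show "c \<in> (\<Union>n. top_cochain n ` S_piece p (q + 2 * int n))"
      by blast
  next
    fix c :: "2 set \<Rightarrow> ('a spoly \<times> nat) set"
    assume "c \<in> (\<Union>n. top_cochain n ` S_piece p (q + 2 * int n))"
    then obtain n w where w: "c = top_cochain n w" "w \<in> S_piece p (q + 2 * int n)" by blast
    have "fr x12 w n \<in> piece (loc_at S_module UNIV) p q"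
      using w(2) by (auto simp: localization_def xprod_simps mult.commute)
    then show "c \<in> (\<Pi>\<^sub>E \<sigma>\<in>{UNIV}. piece (loc_at S_module \<sigma>) p q) \<inter> carrier top_cech"
      unfolding w(1) using top_cochain_carrier[of n w]
      unfolding top_cochain_def Int_iff restrict_PiE_iff by blast
  qed
  finally show ?thesis
    by (auto simp: local_cohomology_def quotmod_def cls_def)
qed

lemma cls_step: "cls (Suc n) (x12 * w) = cls n w"
proof -
  have "top_cochain (Suc n) (x12 * w) = top_cochain n w"
    unfolding top_cochain_eq_iff by (simp add: mult_ac)
  then show ?thesis by (simp add: cls_def)
qed

definition annihilated :: "nat \<Rightarrow> 'a spoly set" where
  "annihilated n = {w. g1 * w \<in> pow_ideal n \<and> g2 * w \<in> pow_ideal n}"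

abbreviation "H \<equiv> twist H0 (- 2) (- int d)"
abbreviation "Ann \<equiv> submod H {w \<in> carrier H. g1 \<odot>\<^bsub>H\<^esub> w = \<zero>\<^bsub>H\<^esub> \<and> g2 \<odot>\<^bsub>H\<^esub> w = \<zero>\<^bsub>H\<^esub>}"

lemma Ann_ops: "\<zero>\<^bsub>Ann\<^esub> = \<zero>\<^bsub>H0\<^esub>" "x \<oplus>\<^bsub>Ann\<^esub> y = x \<oplus>\<^bsub>H0\<^esub> y" "s \<odot>\<^bsub>Ann\<^esub> x = s \<odot>\<^bsub>H0\<^esub> x"
  by (simp_all add: submod_def twist_def)

lemma Ann_carrier_eq: "carrier Ann = {x \<in> carrier H0. g1 \<odot>\<^bsub>H0\<^esub> x = \<zero>\<^bsub>H0\<^esub> \<and> g2 \<odot>\<^bsub>H0\<^esub> x = \<zero>\<^bsub>H0\<^esub>}"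
  by (simp add: submod_def twist_def)

lemma cls_in_Ann: "cls n w \<in> carrier Ann \<longleftrightarrow> w \<in> annihilated n"
proof -
  have "cls n w \<in> carrier H0" unfolding H0_carrier by blast
  then show ?thesis
    by (simp only: Ann_carrier_eq mem_Collect_eq H0_smult cls_zero_iff annihilated_def simp_thms)
qed

lemma Ann_carrier: "carrier Ann = (\<Union>n. cls n ` annihilated n)"
proof -
  have sub: "carrier Ann \<subseteq> (\<Union>n. range (cls n))" unfolding Ann_carrier_eq H0_carrier by blast
  show ?thesis
  proof (intro equalityI subsetI)
    fix x assume x: "x \<in> carrier Ann"
    then obtain n w where "x = cls n w" using sub by blast
    then show "x \<in> (\<Union>n. cls n ` annihilated n)" using x by (simp only: cls_in_Ann) blast
  next
    fix x assume "x \<in> (\<Union>n. cls n ` annihilated n)"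
    then obtain n w where "w \<in> annihilated n" "x = cls n w" by blast
    then show "x \<in> carrier Ann" by (simp only: cls_in_Ann)
  qed
qed

lemma Ann_piece: "piece Ann p q = (\<Union>n. cls n ` (annihilated n \<inter> S_piece (p + - 2) (q + - int d + int n * 2)))"
proof -
  have "piece Ann p q = piece H0 (p + - 2) (q + - int d) \<inter> carrier Ann"
    by (simp add: submod_def twist_def)
  also have "\<dots> = (\<Union>n. cls n ` (annihilated n \<inter> S_piece (p + - 2) (q + - int d + int n * 2)))"
  proof (intro equalityI subsetI)
    fix x assume x: "x \<in> piece H0 (p + - 2) (q + - int d) \<inter> carrier Ann"
    then obtain n w where "x = cls n w" "w \<in> S_piece (p + - 2) (q + - int d + int n * 2)"
      unfolding H0_piece mult.commute[of 2] by blast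
    moreover from this have "w \<in> annihilated n" using x cls_in_Ann by simp
    ultimately show "x \<in> (\<Union>n. cls n ` (annihilated n \<inter> S_piece (p + - 2) (q + - int d + int n * 2)))"
      by blast
  next
    fix x assume "x \<in> (\<Union>n. cls n ` (annihilated n \<inter> S_piece (p + - 2) (q + - int d + int n * 2)))"
    then obtain n w where "x = cls n w" "w \<in> annihilated n" "w \<in> S_piece (p + - 2) (q + - int d + int n * 2)"
      by blast
    then show "x \<in> piece H0 (p + - 2) (q + - int d) \<inter> carrier Ann"
      unfolding H0_piece mult.commute[of 2] using cls_in_Ann by blast
  qed
  finally show ?thesis .
qed

lemma x12_piece: "x12 \<in> S_piece 0 2"
  using S_piece_mult[OF xvar_in_piece xvar_in_piece, of 1 2] by simp

lemma annihilated_closed: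
  "0 \<in> annihilated n" "w \<in> annihilated n \<Longrightarrow> w' \<in> annihilated n \<Longrightarrow> w + w' \<in> annihilated n"
  "w \<in> annihilated n \<Longrightarrow> s * w \<in> annihilated n"
  "w \<in> annihilated n \<Longrightarrow> x12 * w \<in> annihilated (Suc n)"
  "w \<in> annihilated n \<Longrightarrow> bicomp p q w \<in> annihilated n"
proof -
  show "0 \<in> annihilated n" by (simp add: annihilated_def pow_ideal_closed)
  show "w \<in> annihilated n \<Longrightarrow> w' \<in> annihilated n \<Longrightarrow> w + w' \<in> annihilated n"
    by (simp add: annihilated_def distrib_left pow_ideal_closed)
  show "w \<in> annihilated n \<Longrightarrow> s * w \<in> annihilated n"
    by (simp add: annihilated_def mult.left_commute[of _ s] pow_ideal_closed)
  show "w \<in> annihilated n \<Longrightarrow> x12 * w \<in> annihilated (Suc n)"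
    using pow_ideal_colon[of 1 "g1 * w" n] pow_ideal_colon[of 1 "g2 * w" n]
    by (simp add: annihilated_def mult.left_commute[of _ x12])
  assume "w \<in> annihilated n"
  then have "bicomp (1 + p) (int \<mu> + q) (g1 * w) \<in> pow_ideal n"
    "bicomp (1 + p) (int d - int \<mu> + q) (g2 * w) \<in> pow_ideal n"
    by (simp_all add: annihilated_def bicomp_pow_ideal)
  then show "bicomp p q w \<in> annihilated n"
    by (simp add: annihilated_def bicomp_mult[OF g1_in_piece] bicomp_mult[OF g2_in_piece])
qed

lemma Ann_presented: "graded_presented_module Ann annihilated cls x12 (- 2) (- int d) 2"
proof
  fix n show "cls n 0 = \<zero>\<^bsub>Ann\<^esub>" by (simp add: Ann_ops cls_zero_iff pow_ideal_closed)
next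
  fix w n p q assume "cls n w = \<zero>\<^bsub>Ann\<^esub>"
  then show "cls n (bicomp p q w) = \<zero>\<^bsub>Ann\<^esub>" by (simp add: Ann_ops cls_zero_iff bicomp_pow_ideal)
qed (simp_all add: annihilated_closed Ann_carrier Ann_ops H0_add H0_smult cls_step x12_piece Ann_piece)

end

section \<open>The isomorphism\<close>

context height_two_ideal
begin

interpretation Ker: graded_presented_module Ker "\<lambda>_. torsion" "\<lambda>_. \<kappa>" 1 0 0 0
  by (rule Ker_presented)

interpretation Ann: graded_presented_module Ann annihilated cls x12 "- 2" "- int d" 2
  by (rule Ann_presented)

text \<open>
  The relation that \<^const>\<open>linked\<close> induces on classes; it is the graph of the isomorphism.
\<close>

definition corresponds ::
    "(('a rpoly \<Rightarrow>\<^sub>0 nat) \<Rightarrow>\<^sub>0 'a rpoly) set \<Rightarrow> (2 set \<Rightarrow> ('a spoly \<times> nat) set) set \<Rightarrow> bool" where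
  "corresponds x y \<longleftrightarrow> (\<exists>n F w. linked n F w \<and> x = \<kappa> F \<and> y = cls n w)"

lemma linked_annihilated: "linked n F w \<Longrightarrow> w \<in> annihilated n"
  by (simp add: annihilated_def linked_torsion)

lemma corresponds_raise:
  assumes "linked n F w"
  shows "linked (n + k) F (x12 ^ k * w)" "cls (n + k) (x12 ^ k * w) = cls n w"
  using linked_raise[OF assms] Ann.step[OF linked_annihilated[OF assms]] by blast+

lemma corresponds_common_level:
  assumes "corresponds x y" "corresponds x' y'"
  obtains n F w F' w' where "linked n F w" "linked n F' w'" "x = \<kappa> F" "y = cls n w" "x' = \<kappa> F'" "y' = cls n w'"
proof -
  obtain n F w where 1: "linked n F w" "x = \<kappa> F" "y = cls n w" using assms(1) unfolding corresponds_def by blast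
  obtain m F' w' where 2: "linked m F' w'" "x' = \<kappa> F'" "y' = cls m w'" using assms(2) unfolding corresponds_def by blast
  have "linked (n + m) F (x12 ^ m * w)" "y = cls (n + m) (x12 ^ m * w)"
    using corresponds_raise[OF 1(1), of m] 1(3) by simp_all
  moreover have "linked (n + m) F' (x12 ^ n * w')" "y' = cls (n + m) (x12 ^ n * w')"
    using corresponds_raise[OF 2(1), of n] 2(3) by (simp_all add: add.commute)
  ultimately show ?thesis using that 1(2) 2(2) by blast
qed

lemma corresponds_unique:
  assumes "corresponds x y" "corresponds x' y'"
  shows "x = x' \<longleftrightarrow> y = y'"
proof -
  obtain n F w F' w' where *: "linked n F w" "linked n F' w'" "x = \<kappa> F" "y = cls n w" "x' = \<kappa> F'" "y' = cls n w'"
    using assms by (rule corresponds_common_level)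
  have "linked n (F + (- 1) * F') (w + (- 1) * w')"
    by (intro linked_add linked_mult *)
  then have diff: "linked n (F - F') (w - w')" by simp
  have "x = x' \<longleftrightarrow> F - F' \<in> eq_ideal" unfolding * by (rule kappa_eq_iff)
  also have "\<dots> \<longleftrightarrow> w - w' \<in> pow_ideal n"
    using linked_zero_left[OF diff] linked_zero_right[OF diff] by blast
  also have "\<dots> \<longleftrightarrow> cls n (w - w') = \<zero>\<^bsub>Ann\<^esub>" by (simp add: Ann_ops cls_zero_iff)
  also have "\<dots> \<longleftrightarrow> y = y'"
    unfolding * using Ann.pi_diff_eq[OF linked_annihilated[OF *(1)] linked_annihilated[OF *(2)]] by simp
  finally show ?thesis .
qed

lemma corresponds_left_total:
  assumes "x \<in> carrier Ker"
  shows "\<exists>y. corresponds x y"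
proof -
  obtain F where F: "F \<in> torsion" "x = \<kappa> F" using assms unfolding Ker_carrier by blast
  obtain n w where "linked n F w" using linked_left_total[OF F(1)] by blast
  with F(2) show ?thesis unfolding corresponds_def by blast
qed

lemma corresponds_right_total: "y \<in> carrier Ann \<Longrightarrow> \<exists>x. corresponds x y"
proof -
  assume "y \<in> carrier Ann"
  then obtain n w where w: "w \<in> annihilated n" "y = cls n w" unfolding Ann_carrier by blast
  then obtain F where "linked n F w" using linked_right_total[of w n] unfolding annihilated_def by blast
  with w(2) show ?thesis unfolding corresponds_def by blast
qed

lemma corresponds_carrier:
  assumes "corresponds x y"
  shows "x \<in> carrier Ker \<and> y \<in> carrier Ann"
proof -
  obtain n F w where *: "linked n F w" "x = \<kappa> F" "y = cls n w" using assms unfolding corresponds_def by blast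
  show ?thesis
    unfolding *(2,3) using Ker.pi_closed[OF linked_torsion(1)[OF *(1)]]
      Ann.pi_closed[OF linked_annihilated[OF *(1)]] by blast
qed

lemma corresponds_add:
  assumes "corresponds x y" "corresponds x' y'"
  shows "corresponds (x \<oplus>\<^bsub>Ker\<^esub> x') (y \<oplus>\<^bsub>Ann\<^esub> y')"
proof -
  obtain n F w F' w' where *: "linked n F w" "linked n F' w'" "x = \<kappa> F" "y = cls n w" "x' = \<kappa> F'" "y' = cls n w'"
    using assms by (rule corresponds_common_level)
  have "x \<oplus>\<^bsub>Ker\<^esub> x' = \<kappa> (F + F')" "y \<oplus>\<^bsub>Ann\<^esub> y' = cls n (w + w')"
    unfolding * by (simp_all add: Ker_ops kappa_hom Ann_ops H0_add)
  with linked_add[OF *(1,2)] show ?thesis unfolding corresponds_def by blast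
qed

lemma corresponds_smult:
  assumes "corresponds x y"
  shows "corresponds (s \<odot>\<^bsub>Ker\<^esub> x) (s \<odot>\<^bsub>Ann\<^esub> y)"
proof -
  obtain n F w where *: "linked n F w" "x = \<kappa> F" "y = cls n w" using assms unfolding corresponds_def by blast
  have "s \<odot>\<^bsub>Ker\<^esub> x = \<kappa> (s * F)" "s \<odot>\<^bsub>Ann\<^esub> y = cls n (s * w)"
    unfolding * by (simp_all add: Ker_ops kappa_hom Ann_ops H0_smult)
  with linked_mult[OF *(1)] show ?thesis unfolding corresponds_def by blast
qed

lemma corresponds_piece_left:
  assumes "x \<in> piece Ker p q"
  shows "\<exists>y\<in>piece Ann p q. corresponds x y"
proof -
  obtain F where F: "F \<in> torsion" "F \<in> S_piece p q" "x = \<kappa> F" using assms unfolding Ker_piece by blast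
  obtain n w where "linked n F w" using linked_left_total[OF F(1)] by blast
  from linked_bicomp[OF this, of p q]
  have w: "linked n F (bicomp (p - 2) (q + 2 * int n - int d) w)" (is "linked n F ?w")
    by (simp add: bicomp_piece[OF F(2)])
  have "?w \<in> S_piece (p + - 2) (q + - int d + int n * 2)"
    using bicomp_in_piece[of "p - 2" "q + 2 * int n - int d" w] by (simp add: algebra_simps)
  then have "cls n ?w \<in> piece Ann p q" by (rule Ann.pi_in_piece[OF linked_annihilated[OF w]])
  moreover have "corresponds x (cls n ?w)" unfolding corresponds_def using w F(3) by blast
  ultimately show ?thesis by blast
qed

lemma corresponds_piece_right:
  assumes "y \<in> piece Ann p q"
  shows "\<exists>x\<in>piece Ker p q. corresponds x y"
proof -
  obtain n w where w: "w \<in> annihilated n" "w \<in> S_piece (p + - 2) (q + - int d + int n * 2)" "y = cls n w"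
    using assms unfolding Ann_piece by blast
  then obtain F where "linked n F w" using linked_right_total[of w n] unfolding annihilated_def by blast
  from linked_bicomp[OF this, of p q] have F: "linked n (bicomp p q F) w"
    using bicomp_piece[OF w(2)] by (simp add: algebra_simps)
  have "\<kappa> (bicomp p q F) \<in> piece Ker p q"
    unfolding Ker_piece using linked_torsion(1)[OF F] bicomp_in_piece by blast
  moreover have "corresponds (\<kappa> (bicomp p q F)) y" unfolding corresponds_def using F w(3) by blast
  ultimately show ?thesis by blast
qed

theorem bigraded_iso_Ker_Ann: "bigraded_iso Ker Ann"
proof -
  define h where "h x = (THE y. corresponds x y)" for x
  have h_eq: "h x = y" if "corresponds x y" for x y
    unfolding h_def using that corresponds_unique by (intro the_equality) blast+
  have h: "corresponds x (h x)" if "x \<in> carrier Ker" for x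
    using corresponds_left_total[OF that] h_eq by blast
  have "bij_betw h (carrier Ker) (carrier Ann)"
  proof (rule bij_betw_imageI)
    show "inj_on h (carrier Ker)"
    proof (rule inj_onI)
      fix x x' assume "x \<in> carrier Ker" "x' \<in> carrier Ker" "h x = h x'"
      then show "x = x'" using corresponds_unique[OF h h, of x x'] by simp
    qed
    show "h ` carrier Ker = carrier Ann"
    proof (intro equalityI subsetI)
      fix y assume "y \<in> h ` carrier Ker"
      then obtain x where "x \<in> carrier Ker" "y = h x" by blast
      then show "y \<in> carrier Ann" using corresponds_carrier[OF h] by blast
    next
      fix y assume "y \<in> carrier Ann"
      then obtain x where x: "corresponds x y" using corresponds_right_total by blast
      have "y = h x" using h_eq[OF x] by simp
      moreover have "x \<in> carrier Ker" using corresponds_carrier[OF x] by blast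
      ultimately show "y \<in> h ` carrier Ker" by (rule image_eqI)
    qed
  qed
  moreover have "h (x \<oplus>\<^bsub>Ker\<^esub> x') = h x \<oplus>\<^bsub>Ann\<^esub> h x'"
    if "x \<in> carrier Ker" "x' \<in> carrier Ker" for x x'
    by (rule h_eq[OF corresponds_add[OF h h]]) (use that in blast)+
  moreover have "h (s \<odot>\<^bsub>Ker\<^esub> x) = s \<odot>\<^bsub>Ann\<^esub> h x" if "x \<in> carrier Ker" for s x
    by (rule h_eq[OF corresponds_smult[OF h[OF that]]])
  moreover have "h ` piece Ker p q = piece Ann p q" for p q
  proof (intro equalityI subsetI)
    fix y assume "y \<in> h ` piece Ker p q"
    then obtain x where x: "x \<in> piece Ker p q" "y = h x" by blast
    obtain z where z: "z \<in> piece Ann p q" "corresponds x z" using corresponds_piece_left[OF x(1)] by blast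
    then show "y \<in> piece Ann p q" using h_eq[OF z(2)] x(2) by simp
  next
    fix y assume "y \<in> piece Ann p q"
    then obtain x where x: "x \<in> piece Ker p q" "corresponds x y" using corresponds_piece_right by blast
    have "y = h x" using h_eq[OF x(2)] by simp
    then show "y \<in> h ` piece Ker p q" using x(1) by (rule image_eqI)
  qed
  ultimately show ?thesis
    unfolding bigraded_iso_def using Ker.bigraded_module_M Ann.bigraded_module_M
    by (intro conjI exI[of _ h] allI ballI) simp_all
qed

end

theorem theorem4:
  fixes I :: "'k::field rpoly set"
    and f :: "'k rpoly ^ 3"
    and \<phi> :: "'k rpoly ^ 2 ^ 3"
    and g :: "'k spoly ^ 2"
    and H :: "('k spoly, (2 set \<Rightarrow> ('k spoly \<times> nat) set) set) bigraded"
    and d \<mu> :: nat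
  assumes "\<forall>i. homogeneous d (f $ i)"
    and "minimally_generated_by I f"
    and "ideal_height ring_of_type_algebra I = 2"
    and "hilbert_burch I d \<mu> f \<phi>"
    and "g = sym_equations \<phi>"
    and "H = twist (local_cohomology 2 S_module) (- 2) (- int d)"
  shows "bigraded_iso (rees_kernel I f)
           (submod H {w \<in> carrier H. g $ 1 \<odot>\<^bsub>H\<^esub> w = \<zero>\<^bsub>H\<^esub> \<and> g $ 2 \<odot>\<^bsub>H\<^esub> w = \<zero>\<^bsub>H\<^esub>})"
proof -
  interpret height_two_ideal I d \<mu> f \<phi>
    by unfold_locales (fact assms)+
  show ?thesis
    using bigraded_iso_Ker_Ann unfolding assms(5,6) sym_equations_nth .
qed

end
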